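(* Let $X\in\mathbb{R}^D$ be a sub-Gaussian random vector with covariance $\Sigma$, let $X_1,\dots,X_N$ be independent copies of $X$ and $\hat\Sigma$ the sample covariance. Let $A\in\mathbb{R}^{d_1\times D}$, $B\in\mathbb{R}^{d_2\times D}$. There exists a universal constant $C>0$ such that for any $u>0$, if $N>C(\operatorname{rank}(\Sigma)+u)\|\sqrt{\Sigma^\dagger}\tilde X\|_{\psi_2}^4$, then with probability at least $1-\exp(-u)$, $$\|A(\hat\Sigma^\dagger-\Sigma^\dagger)B^\top\|_2\lesssim \|A\Sigma^\dagger\tilde X\|_{\psi_2}\|B\Sigma^\dagger\tilde X\|_{\psi_2}\sqrt{\frac{\operatorname{rank}(\Sigma)+u}{N}}.$$
   Context: $\tilde X:=X-\mathbb{E}X$, $\Sigma=\mathbb{E}\tilde X\tilde X^\top$, $\hat\mu_X:=N^{-1}\sum_iX_i$, $\hat\Sigma:=N^{-1}\sum_i(X_i-\hat\mu_X)(X_i-\hat\mu_X)^\top$. $M^\dagger$ is the Moore–Penrose pseudoinverse and $\sqrt{\Sigma^\dagger}$ the positive semidefinite square root of $\Sigma^\dagger$. $\|Z\|_{\psi_2}:=\inf\{s>0:\mathbb{E}\exp(|Z/s|^2)\le2\}$ for real $Z$ and $\sup_{\|v\|_2=1}\|v^\top Z\|_{\psi_2}$ for random vectors. $\|\cdot\|_2$ is the spectral norm. $a\lesssim b$ means $a\le C'b$ for a universal constant $C'>0$. *)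

theory Defs
  imports "HOL-Probability.Probability"
begin

text \<open>Matrices are represented as functions nat => nat => real; the dimensions are
explicit natural-number parameters, and only entries with indices in range matter
(unless stated otherwise). Vectors in R^n are functions nat => real, only indices < n matter.\<close>

definition mmul :: "nat \<Rightarrow> (nat \<Rightarrow> nat \<Rightarrow> real) \<Rightarrow> (nat \<Rightarrow> nat \<Rightarrow> real) \<Rightarrow> (nat \<Rightarrow> nat \<Rightarrow> real)" where
  "mmul n A B = (\<lambda>i j. \<Sum>k<n. A i k * B k j)"

definition mvec :: "nat \<Rightarrow> (nat \<Rightarrow> nat \<Rightarrow> real) \<Rightarrow> (nat \<Rightarrow> real) \<Rightarrow> (nat \<Rightarrow> real)" where
  "mvec n A x = (\<lambda>i. \<Sum>k<n. A i k * x k)"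

definition mtrans :: "(nat \<Rightarrow> nat \<Rightarrow> real) \<Rightarrow> (nat \<Rightarrow> nat \<Rightarrow> real)" where
  "mtrans A = (\<lambda>i j. A j i)"

definition vnorm :: "nat \<Rightarrow> (nat \<Rightarrow> real) \<Rightarrow> real" where
  "vnorm n v = sqrt (\<Sum>i<n. (v i)^2)"

definition unit_vecs :: "nat \<Rightarrow> (nat \<Rightarrow> real) set" where
  "unit_vecs n = {v. vnorm n v = 1}"

definition spec_norm :: "nat \<Rightarrow> nat \<Rightarrow> (nat \<Rightarrow> nat \<Rightarrow> real) \<Rightarrow> real" where
  "spec_norm m n M = Sup (insert 0 ((\<lambda>v. vnorm m (mvec n M v)) ` unit_vecs n))"

definition pinv :: "nat \<Rightarrow> nat \<Rightarrow> (nat \<Rightarrow> nat \<Rightarrow> real) \<Rightarrow> (nat \<Rightarrow> nat \<Rightarrow> real)" where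
  "pinv m n A = (THE G.
      (\<forall>i j. \<not> (i < n \<and> j < m) \<longrightarrow> G i j = 0) \<and>
      (\<forall>i<m. \<forall>j<n. mmul n (mmul m A G) A i j = A i j) \<and>
      (\<forall>i<n. \<forall>j<m. mmul m (mmul n G A) G i j = G i j) \<and>
      (\<forall>i<m. \<forall>j<m. mmul n A G i j = mmul n A G j i) \<and>
      (\<forall>i<n. \<forall>j<n. mmul m G A i j = mmul m G A j i))"

definition psd :: "nat \<Rightarrow> (nat \<Rightarrow> nat \<Rightarrow> real) \<Rightarrow> bool" where
  "psd n S \<longleftrightarrow> (\<forall>i<n. \<forall>j<n. S i j = S j i) \<and> (\<forall>v. 0 \<le> (\<Sum>i<n. \<Sum>j<n. v i * S i j * v j))"

definition psd_sqrt :: "nat \<Rightarrow> (nat \<Rightarrow> nat \<Rightarrow> real) \<Rightarrow> (nat \<Rightarrow> nat \<Rightarrow> real)" where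
  "psd_sqrt n M = (THE S. (\<forall>i j. \<not> (i < n \<and> j < n) \<longrightarrow> S i j = 0) \<and> psd n S \<and>
      (\<forall>i<n. \<forall>j<n. mmul n S S i j = M i j))"

definition mrank :: "nat \<Rightarrow> nat \<Rightarrow> (nat \<Rightarrow> nat \<Rightarrow> real) \<Rightarrow> nat" where
  "mrank m n A = Max {card S | S. S \<subseteq> {..<n} \<and>
      (\<forall>c. (\<forall>i<m. (\<Sum>j\<in>S. c j * A i j) = 0) \<longrightarrow> (\<forall>j\<in>S. c j = 0))}"

definition psi2 :: "'a measure \<Rightarrow> ('a \<Rightarrow> real) \<Rightarrow> real" where
  "psi2 M Z = Inf {s. s > 0 \<and> (\<integral>\<^sup>+ x. ennreal (exp ((\<bar>Z x / s\<bar>)^2)) \<partial>M) \<le> 2}"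

definition vpsi2 :: "'a measure \<Rightarrow> nat \<Rightarrow> ('a \<Rightarrow> nat \<Rightarrow> real) \<Rightarrow> real" where
  "vpsi2 M d Z = Sup (insert 0 ((\<lambda>v. psi2 M (\<lambda>x. \<Sum>i<d. v i * Z x i)) ` unit_vecs d))"

definition subgaussian :: "'a measure \<Rightarrow> nat \<Rightarrow> ('a \<Rightarrow> nat \<Rightarrow> real) \<Rightarrow> bool" where
  "subgaussian M d Z \<longleftrightarrow> (\<exists>K. \<forall>v\<in>unit_vecs d. \<exists>s. 0 < s \<and> s \<le> K \<and>
      (\<integral>\<^sup>+ x. ennreal (exp ((\<bar>(\<Sum>i<d. v i * Z x i) / s\<bar>)^2)) \<partial>M) \<le> 2)"

definition mean_vec :: "(nat \<Rightarrow> real) measure \<Rightarrow> nat \<Rightarrow> (nat \<Rightarrow> real)" where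
  "mean_vec \<mu> D = (\<lambda>i. if i < D then (\<integral>x. x i \<partial>\<mu>) else 0)"

definition cov_mat :: "(nat \<Rightarrow> real) measure \<Rightarrow> nat \<Rightarrow> (nat \<Rightarrow> nat \<Rightarrow> real)" where
  "cov_mat \<mu> D = (\<lambda>i j. if i < D \<and> j < D then
      (\<integral>x. (x i - mean_vec \<mu> D i) * (x j - mean_vec \<mu> D j) \<partial>\<mu>) else 0)"

definition sample_mean :: "nat \<Rightarrow> nat \<Rightarrow> (nat \<Rightarrow> nat \<Rightarrow> real) \<Rightarrow> (nat \<Rightarrow> real)" where
  "sample_mean D N Xs = (\<lambda>i. if i < D then (\<Sum>k<N. Xs k i) / real N else 0)"

definition sample_cov :: "nat \<Rightarrow> nat \<Rightarrow> (nat \<Rightarrow> nat \<Rightarrow> real) \<Rightarrow> (nat \<Rightarrow> nat \<Rightarrow> real)" where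
  "sample_cov D N Xs = (\<lambda>i j. if i < D \<and> j < D then
      (\<Sum>k<N. (Xs k i - sample_mean D N Xs i) * (Xs k j - sample_mean D N Xs j)) / real N else 0)"

end

theory Submission
  imports Defs
begin

text \<open>
  Write \<open>Z = X - \<E>X\<close>, \<open>S = \<Sigma>\<close>, \<open>T\<close> for the sample covariance, \<open>E = T - S\<close>, and let \<open>r = rank S\<close>.
  On the event that \<open>T\<close> has the range of \<open>S\<close> one has
  \<open>T\<^sup>\<dagger> - S\<^sup>\<dagger> = S\<^sup>\<dagger> E T\<^sup>\<dagger> E S\<^sup>\<dagger> - S\<^sup>\<dagger> E S\<^sup>\<dagger>\<close>. The bilinear form \<open>a \<bullet> E b\<close> at \<open>a = S\<^sup>\<dagger> A\<^sup>T v\<close>,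
  \<open>b = S\<^sup>\<dagger> B\<^sup>T w\<close> is an empirical covariance of the linear statistics \<open>a \<bullet> Z\<close> and \<open>b \<bullet> Z\<close>, whose
  \<open>\<psi>\<^sub>2\<close> norms are at most \<open>\<parallel>A S\<^sup>\<dagger> Z\<parallel>\<close> and \<open>\<parallel>B S\<^sup>\<dagger> Z\<parallel>\<close>. As \<open>a\<close> depends on \<open>v\<close> through \<open>r\<close> coordinates only,
  a Bernstein bound and a net of the \<open>r\<close>-dimensional unit ball control the form uniformly in \<open>v\<close>, \<open>w\<close>.
  Applied to the pairs \<open>(A, B)\<close>, \<open>(S\<^sup>1\<^sup>/\<^sup>2, A)\<close>, \<open>(S\<^sup>1\<^sup>/\<^sup>2, B)\<close>, \<open>(S\<^sup>1\<^sup>/\<^sup>2, S\<^sup>1\<^sup>/\<^sup>2)\<close> this bounds both terms of the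
  identity: the last pair gives \<open>T \<ge> S / 2\<close>, and in the quadratic term the extra factor
  \<open>\<parallel>(S\<^sup>\<dagger>)\<^sup>1\<^sup>/\<^sup>2 Z\<parallel>\<^sup>2 sqrt ((r + u) / N)\<close> is at most a constant by the assumption on \<open>N\<close>.
\<close>

section \<open>Spectral theorem for symmetric matrices\<close>

text \<open>The identity is of second order for a reason. In \<open>S\<^sup>\<dagger> -
  T\<^sup>\<dagger> = S\<^sup>\<dagger> E T\<^sup>\<dagger>\<close> the matrix \<open>B\<close>
  would meet the random inverse \<open>T\<^sup>\<dagger>\<close>, about which the norms in the claim
  say nothing. In second order \<open>A\<close> and \<open>B\<close> meet only
  \<open>S\<^sup>\<dagger>\<close>, and the random inverse sits in the middle, where the crude bound
  \<open>T\<^sup>\<dagger> \<le> 2 S\<^sup>\<dagger>\<close> is enough. Constants: a pair of nets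
  has at most \<open>2 ^ (36 * R)\<close> elements, which fixes the Bernstein factor 86. This gives
  30000 on the net, 60000 on the ball, 240000 after doubling both scales so that they lie strictly
  above the norms, and 480000 for the linear and the quadratic term together. Each of the four pairs
  may fail with probability \<open>exp (- u) / 4\<close>. Two degeneracies shape the proof. The
  range of \<open>T\<close> lies in that of \<open>S\<close> only almost surely, so this is an event
  of its own. And a sub-Gaussian scale has to be positive, so rank 0 and vanishing norms are treated
  apart: there the forms are identically 0.\<close>

definition ip :: "nat \<Rightarrow> (nat \<Rightarrow> real) \<Rightarrow> (nat \<Rightarrow> real) \<Rightarrow> real" where
  "ip n x y = (\<Sum>i<n. x i * y i)"

text \<open>Both \<open>pinv\<close> and \<open>psd_sqrt\<close> are definite descriptions of
  functions that vanish outside the index range; zero padding turns entrywise equations into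
  equations between functions.\<close>

definition padded :: "nat \<Rightarrow> (nat \<Rightarrow> nat \<Rightarrow> real) \<Rightarrow> bool" where
  "padded n M \<longleftrightarrow> (\<forall>i j. \<not> (i < n \<and> j < n) \<longrightarrow> M i j = 0)"

text \<open>The column relations give the multiplication rule of spectral matrices, the row
  relations the expansion of a vector in the columns of \<open>Q\<close>.\<close>

definition orthogonal_mat :: "nat \<Rightarrow> (nat \<Rightarrow> nat \<Rightarrow> real) \<Rightarrow> bool" where
  "orthogonal_mat n Q \<longleftrightarrow>
     (\<forall>i<n. \<forall>j<n. (\<Sum>k<n. Q k i * Q k j) = of_bool (i = j)) \<and>
     (\<forall>i<n. \<forall>j<n. (\<Sum>k<n. Q i k * Q j k) = of_bool (i = j))"

text \<open>This is \<open>Q diag(f) Q\<^sup>T\<close>. For fixed \<open>Q\<close>, matrix products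
  become pointwise products of \<open>f\<close>, so every function of the covariance is computed on
  its eigenvalues.\<close>

definition spectral :: "nat \<Rightarrow> (nat \<Rightarrow> nat \<Rightarrow> real) \<Rightarrow> (nat \<Rightarrow> real) \<Rightarrow> nat \<Rightarrow> nat \<Rightarrow> real" where
  "spectral n Q f = (\<lambda>i j. if i < n \<and> j < n then \<Sum>k<n. f k * Q i k * Q j k else 0)"

lemma orthogonal_matD:
  assumes "orthogonal_mat n Q" "i < n" "j < n"
  shows "(\<Sum>k<n. Q k i * Q k j) = of_bool (i = j)" "(\<Sum>k<n. Q i k * Q j k) = of_bool (i = j)"
  using assms by (auto simp: orthogonal_mat_def)

text \<open>Indexing by pairs puts the matrices into one product space, where Tychonoff's theorem
  applies: entries lie in [-1, 1] because rows have length 1, and the infinitely many entries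
  outside the range are confined to 0.\<close>

lemma compact_orthogonal:
  "compact {Q :: nat \<times> nat \<Rightarrow> real. (\<forall>i j. \<not> (i < n \<and> j < n) \<longrightarrow> Q (i, j) = 0) \<and>
     orthogonal_mat n (\<lambda>i j. Q (i, j))}" (is "compact ?S")
proof -
  let ?B = "Pi UNIV (\<lambda>p. if fst p < n \<and> snd p < n then {-1..1} else {0 :: real})"
  have "compactin (product_topology (\<lambda>_. euclidean) UNIV)
      (PiE UNIV (\<lambda>p :: nat \<times> nat. if fst p < n \<and> snd p < n then {-1..1} else {0 :: real}))"
    by (subst compactin_PiE) auto
  hence cB: "compact ?B"
    by (simp add: euclidean_product_topology PiE_UNIV_domain Pi_def)
  have c: "continuous_on UNIV (\<lambda>Q :: nat \<times> nat \<Rightarrow> real. Q p)" for p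
    by (rule continuous_on_product_coordinates)
  have "closed {Q :: nat \<times> nat \<Rightarrow> real. \<forall>i j. i < n \<longrightarrow> j < n \<longrightarrow>
      (\<Sum>k<n. Q (k, i) * Q (k, j)) = of_bool (i = j) \<and> (\<Sum>k<n. Q (i, k) * Q (j, k)) = of_bool (i = j)}"
    by (intro closed_Collect_all closed_Collect_imp closed_Collect_conj open_Collect_const
        closed_Collect_eq continuous_intros c)
  moreover have "?S = ?B \<inter> {Q :: nat \<times> nat \<Rightarrow> real. \<forall>i j. i < n \<longrightarrow> j < n \<longrightarrow>
      (\<Sum>k<n. Q (k, i) * Q (k, j)) = of_bool (i = j) \<and> (\<Sum>k<n. Q (i, k) * Q (j, k)) = of_bool (i = j)}"
    (is "_ = ?B \<inter> ?T")
  proof (intro equalityI subsetI)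
    fix Q assume Q: "Q \<in> ?S"
    have "\<bar>Q (i, j)\<bar> \<le> 1" if "i < n" "j < n" for i j
    proof -
      have "(Q (i, j))\<^sup>2 \<le> (\<Sum>k<n. Q (i, k) * Q (i, k))"
        unfolding power2_eq_square using that by (intro member_le_sum[where f = "\<lambda>k. Q (i, k) * Q (i, k)"]) auto
      also have "\<dots> = 1" using Q that by (auto simp: orthogonal_mat_def)
      finally show ?thesis by (simp add: abs_square_le_1)
    qed
    hence "Q \<in> ?B" using Q by (auto simp: abs_le_iff minus_le_iff)
    thus "Q \<in> ?B \<inter> ?T" using Q by (auto simp: orthogonal_mat_def)
  next
    fix Q assume Q: "Q \<in> ?B \<inter> ?T"
    hence "Q p \<in> (if fst p < n \<and> snd p < n then {-1..1} else {0})" for p by blast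
    from this[of "(_,_)"] Q show "Q \<in> ?S" by (auto simp: orthogonal_mat_def split: if_splits)
  qed
  ultimately show ?thesis using compact_Int_closed[OF cB] by simp
qed

lemma orthogonal_rotate:
  assumes Q: "orthogonal_mat n Q" and ij: "i < n" "j < n" "i \<noteq> j" and cs: "c\<^sup>2 + s\<^sup>2 = (1::real)"
  shows "orthogonal_mat n (\<lambda>a k. if k = i then c * Q a i + s * Q a j
       else if k = j then c * Q a j - s * Q a i else Q a k)" (is "orthogonal_mat n ?Q")
proof -
  have col: "(\<Sum>a<n. Q a k * Q a l) = of_bool (k = l)" if "k < n" "l < n" for k l
    using orthogonal_matD[OF Q that] by simp
  have cc: "c * c + s * s = 1" using cs by (simp add: power2_eq_square)
  have 1: "(\<Sum>a<n. ?Q a k * ?Q a l) = of_bool (k = l)" if "k < n" "l < n" for k l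
  proof -
    \<comment> \<open>Every new column is a combination of columns \<open>i\<close>,
      \<open>j\<close> and \<open>k\<close>, so this one expansion covers all cases of rotated and
      unrotated columns.\<close>
    have lin: "(\<Sum>a<n. (p * Q a i + q * Q a j + r * Q a k) * (p' * Q a i + q' * Q a j + r' * Q a l))
       = p * p' + q * q' + r * p' * of_bool (k = i) + r * q' * of_bool (k = j)
        + p * r' * of_bool (i = l) + q * r' * of_bool (j = l) + r * r' * of_bool (k = l)" for p q r p' q' r'
    proof -
      have "(\<Sum>a<n. (p * Q a i + q * Q a j + r * Q a k) * (p' * Q a i + q' * Q a j + r' * Q a l))
        = p * p' * (\<Sum>a<n. Q a i * Q a i) + p * q' * (\<Sum>a<n. Q a i * Q a j) + q * p' * (\<Sum>a<n. Q a j * Q a i)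
          + q * q' * (\<Sum>a<n. Q a j * Q a j) + r * p' * (\<Sum>a<n. Q a k * Q a i) + r * q' * (\<Sum>a<n. Q a k * Q a j)
          + p * r' * (\<Sum>a<n. Q a i * Q a l) + q * r' * (\<Sum>a<n. Q a j * Q a l) + r * r' * (\<Sum>a<n. Q a k * Q a l)"
        unfolding sum_distrib_left sum.distrib[symmetric] by (intro sum.cong) (auto simp: algebra_simps)
      thus ?thesis using that ij by (simp add: col)
    qed
    let ?p = "\<lambda>k. if k = i then c else if k = j then -s else 0"
    let ?q = "\<lambda>k. if k = i then s else if k = j then c else 0"
    let ?r = "\<lambda>k. if k = i \<or> k = j then 0 else 1 :: real"
    have "(\<Sum>a<n. ?Q a k * ?Q a l) = (\<Sum>a<n. (?p k * Q a i + ?q k * Q a j + ?r k * Q a k) *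
        (?p l * Q a i + ?q l * Q a j + ?r l * Q a l))"
      using ij by (intro sum.cong) auto
    also have "\<dots> = of_bool (k = l)"
      unfolding lin using ij cc by (auto simp: algebra_simps)
    finally show ?thesis .
  qed
  have 2: "(\<Sum>k<n. ?Q a k * ?Q b k) = of_bool (a = b)" if "a < n" "b < n" for a b
  proof -
    have split: "(\<Sum>k<n. f k) = f i + f j + (\<Sum>k\<in>{..<n} - {i} - {j}. f k)" for f :: "nat \<Rightarrow> real"
      using ij by (simp add: sum.remove[of "{..<n}" i] sum.remove[of "{..<n} - {i}" j])
    have "(\<Sum>k<n. ?Q a k * ?Q b k) = (c * Q a i + s * Q a j) * (c * Q b i + s * Q b j)
       + (c * Q a j - s * Q a i) * (c * Q b j - s * Q b i) + (\<Sum>k\<in>{..<n} - {i} - {j}. Q a k * Q b k)"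
      unfolding split using ij by (auto intro!: sum.cong)
    also have "(c * Q a i + s * Q a j) * (c * Q b i + s * Q b j)
       + (c * Q a j - s * Q a i) * (c * Q b j - s * Q b i) = (c * c + s * s) * (Q a i * Q b i + Q a j * Q b j)"
      by (simp add: algebra_simps)
    also have "\<dots> + (\<Sum>k\<in>{..<n} - {i} - {j}. Q a k * Q b k) = (\<Sum>k<n. Q a k * Q b k)"
      unfolding split cc by simp
    finally show ?thesis using orthogonal_matD[OF Q that] by simp
  qed
  show ?thesis using 1 2 unfolding orthogonal_mat_def by blast
qed

text \<open>A maximiser of \<open>\<Sum>i<n. i * (Q\<^sup>T M Q) i i\<close> over the compact set of orthogonal matrices diagonalises
  \<open>M\<close>, as the derivative along the rotations of a coordinate plane is a multiple of an off-diagonal entry.\<close>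

lemma spectral_theorem:
  assumes sym: "\<And>i j. i < n \<Longrightarrow> j < n \<Longrightarrow> M i j = M j i" and pad: "padded n M"
  obtains Q l where "orthogonal_mat n Q" "M = spectral n Q l"
proof -
  let ?O = "{Q :: nat \<times> nat \<Rightarrow> real. (\<forall>i j. \<not> (i < n \<and> j < n) \<longrightarrow> Q (i, j) = 0) \<and>
     orthogonal_mat n (\<lambda>i j. Q (i, j))}"
  define bf where "bf x y = (\<Sum>a<n. \<Sum>b<n. x a * M a b * y b)" for x y :: "nat \<Rightarrow> real"
  let ?f = "\<lambda>Q. \<Sum>i<n. real i * bf (\<lambda>a. Q (a, i)) (\<lambda>a. Q (a, i))"
  have c: "continuous_on ?O (\<lambda>Q :: nat \<times> nat \<Rightarrow> real. Q p)" for p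
    by (rule continuous_on_subset[OF continuous_on_product_coordinates]) simp
  have cont: "continuous_on ?O ?f"
    unfolding bf_def by (intro continuous_intros c)
  have "orthogonal_mat n (\<lambda>i j. of_bool (i < n \<and> i = j))"
  proof -
    have "(\<Sum>k<n. of_bool (k < n \<and> k = i) * of_bool (k < n \<and> k = j)) = (of_bool (i = j) :: real)"
      "(\<Sum>k<n. of_bool (i < n \<and> i = k) * of_bool (j < n \<and> j = k)) = (of_bool (i = j) :: real)"
      if "i < n" "j < n" for i j
    proof -
      have "(\<Sum>k<n. of_bool (k < n \<and> k = i) * of_bool (k < n \<and> k = j)) = (\<Sum>k<n. if k = i then of_bool (i = j) else (0 :: real))"
        using that by (intro sum.cong) auto
      thus "(\<Sum>k<n. of_bool (k < n \<and> k = i) * of_bool (k < n \<and> k = j)) = (of_bool (i = j) :: real)"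
        using that by simp
      have "(\<Sum>k<n. of_bool (i < n \<and> i = k) * of_bool (j < n \<and> j = k)) = (\<Sum>k<n. if k = i then of_bool (i = j) else (0 :: real))"
        using that by (intro sum.cong) auto
      thus "(\<Sum>k<n. of_bool (i < n \<and> i = k) * of_bool (j < n \<and> j = k)) = (of_bool (i = j) :: real)"
        using that by simp
    qed
    thus ?thesis unfolding orthogonal_mat_def by blast
  qed
  hence "(\<lambda>p. of_bool (fst p < n \<and> fst p = snd p)) \<in> ?O"
    unfolding mem_Collect_eq fst_conv snd_conv by (intro conjI allI impI) auto
  hence "?O \<noteq> {}" by (rule ex_in_conv[THEN iffD1, OF exI])
  from continuous_attains_sup[OF compact_orthogonal this cont]
  obtain Q0 where Q0: "Q0 \<in> ?O" and max: "\<And>Q. Q \<in> ?O \<Longrightarrow> ?f Q \<le> ?f Q0" by blast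
  define Q where "Q = (\<lambda>i j. Q0 (i, j))"
  have Q: "orthogonal_mat n Q" using Q0 by (simp add: Q_def)
  define q where "q = (\<lambda>i a. Q a i)"
  have bfsym: "bf x y = bf y x" for x y
    unfolding bf_def by (subst sum.swap) (auto intro!: sum.cong simp: sym mult_ac)
  have bfl: "bf (\<lambda>a. s * x a + t * y a) z = s * bf x z + t * bf y z" for s t x y z
    unfolding bf_def sum_distrib_left sum.distrib[symmetric] by (intro sum.cong) (auto simp: algebra_simps)
  have bfr: "bf z (\<lambda>a. s * x a + t * y a) = s * bf z x + t * bf z y" for s t x y z
    using bfl bfsym by metis
  have bf_sum_left: "bf (\<lambda>a. \<Sum>k\<in>A. c k * x k a) y = (\<Sum>k\<in>A. c k * bf (x k) y)"
    if "finite A" for A :: "nat set" and c x y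
    using that
  proof (induction A rule: finite_induct)
    case empty
    show ?case by (simp add: bf_def)
  next
    case (insert k A)
    thus ?case using bfl[of "c k" "x k" 1 "\<lambda>a. \<Sum>k\<in>A. c k * x k a" y] by simp
  qed
  have bf_sum_right: "bf y (\<lambda>a. \<Sum>k\<in>A. c k * x k a) = (\<Sum>k\<in>A. c k * bf y (x k))"
    if "finite A" for A :: "nat set" and c x y
    using bf_sum_left[OF that] bfsym by simp
  have off: "bf (q i) (q j) = 0" if ij: "i < n" "j < n" "i \<noteq> j" for i j
  proof -
    \<comment> \<open>\<open>g t\<close> is the gain of the objective under the rotation by
      \<open>t\<close>, so it is maximal at 0. The weights \<open>real i\<close> have to be
      distinct: with equal weights the objective would be the trace, which no rotation
      changes.\<close>
    define g where "g t = (real i - real j) * (2 * cos t * sin t * bf (q i) (q j) - (sin t)\<^sup>2 * (bf (q i) (q i) - bf (q j) (q j)))" for t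
    have g0: "g t \<le> 0" for t
    proof -
      let ?c = "cos t" and ?s = "sin t"
      define Q' where "Q' = (\<lambda>a k. if k = i then ?c * Q a i + ?s * Q a j
       else if k = j then ?c * Q a j - ?s * Q a i else Q a k)"
      have "orthogonal_mat n Q'" unfolding Q'_def by (rule orthogonal_rotate[OF Q ij]) simp
      moreover have "\<not> (a < n \<and> k < n) \<Longrightarrow> Q' a k = 0" for a k
        using ij Q0 by (auto simp: Q'_def Q_def)
      ultimately have "(\<lambda>p. Q' (fst p) (snd p)) \<in> ?O"
        unfolding mem_Collect_eq fst_conv snd_conv by blast
      from max[OF this] have le: "(\<Sum>k<n. real k * bf (\<lambda>a. Q' a k) (\<lambda>a. Q' a k)) \<le> (\<Sum>k<n. real k * bf (q k) (q k))"
        by (simp add: q_def Q_def)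
      have split: "(\<Sum>k<n. f k) = f i + f j + (\<Sum>k\<in>{..<n} - {i} - {j}. f k)" for f :: "nat \<Rightarrow> real"
        using ij by (simp add: sum.remove[of "{..<n}" i] sum.remove[of "{..<n} - {i}" j])
      have i': "(\<lambda>a. Q' a i) = (\<lambda>a. ?c * q i a + ?s * q j a)" "(\<lambda>a. Q' a j) = (\<lambda>a. ?c * q j a + (- ?s) * q i a)"
        using ij by (auto simp: Q'_def q_def)
      have k': "(\<lambda>a. Q' a k) = q k" if "k \<in> {..<n} - {i} - {j}" for k
        using that by (auto simp: Q'_def q_def)
      have rest: "(\<Sum>k\<in>{..<n} - {i} - {j}. real k * bf (\<lambda>a. Q' a k) (\<lambda>a. Q' a k)) = (\<Sum>k\<in>{..<n} - {i} - {j}. real k * bf (q k) (q k))"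
        by (intro sum.cong refl) (simp only: k')
      have "real i * bf (\<lambda>a. Q' a i) (\<lambda>a. Q' a i) + real j * bf (\<lambda>a. Q' a j) (\<lambda>a. Q' a j)
         \<le> real i * bf (q i) (q i) + real j * bf (q j) (q j)"
        using le unfolding split[of "\<lambda>k. real k * bf (\<lambda>a. Q' a k) (\<lambda>a. Q' a k)"]
          split[of "\<lambda>k. real k * bf (q k) (q k)"] rest by linarith
      moreover have "bf (\<lambda>a. Q' a i) (\<lambda>a. Q' a i) = (1 - ?s\<^sup>2) * bf (q i) (q i) + 2 * ?c * ?s * bf (q i) (q j) + ?s\<^sup>2 * bf (q j) (q j)"
        unfolding i' bfl bfr cos_squared_eq[symmetric] by (simp add: algebra_simps power2_eq_square bfsym[of "q j" "q i"])
      moreover have "bf (\<lambda>a. Q' a j) (\<lambda>a. Q' a j) = (1 - ?s\<^sup>2) * bf (q j) (q j) - 2 * ?c * ?s * bf (q i) (q j) + ?s\<^sup>2 * bf (q i) (q i)"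
        unfolding i' bfl bfr cos_squared_eq[symmetric] by (simp add: algebra_simps power2_eq_square bfsym[of "q j" "q i"])
      ultimately show ?thesis unfolding g_def by (simp add: algebra_simps)
    qed
    have "(g has_real_derivative (real i - real j) * (2 * bf (q i) (q j))) (at 0)"
      unfolding g_def by (auto intro!: derivative_eq_intros)
    moreover have "g 0 = 0" by (simp add: g_def)
    ultimately have "(real i - real j) * (2 * bf (q i) (q j)) = 0"
      by (rule_tac DERIV_local_max[of g _ 0 1]) (auto simp: g0)
    thus ?thesis using ij by simp
  qed
  have "M = spectral n Q (\<lambda>k. bf (q k) (q k))"
  proof (intro ext)
    fix i j
    show "M i j = spectral n Q (\<lambda>k. bf (q k) (q k)) i j"
    proof (cases "i < n \<and> j < n")
      case True
      have "M i j = (\<Sum>a<n. \<Sum>b<n. of_bool (i = a) * M a b * of_bool (j = b))"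
      proof -
        have "(\<Sum>b<n. of_bool (i = a) * M a b * of_bool (j = b)) = (\<Sum>b<n. if b = j then of_bool (i = a) * M a j else 0)" for a
          by (intro sum.cong) auto
        hence "(\<Sum>a<n. \<Sum>b<n. of_bool (i = a) * M a b * of_bool (j = b)) = (\<Sum>a<n. if a = i then M i j else 0)"
          using True by (intro sum.cong) auto
        thus ?thesis using True by simp
      qed
      \<comment> \<open>The row relations expand the standard basis vectors in the columns of
        \<open>Q\<close>, in which \<open>bf\<close> is diagonal by \<open>off\<close>.\<close>
      also have "\<dots> = bf (\<lambda>a. \<Sum>k<n. Q i k * q k a) (\<lambda>b. \<Sum>m<n. Q j m * q m b)"
        unfolding bf_def q_def using True
        by (intro sum.cong arg_cong2[where f = "(*)"] refl) (simp_all add: orthogonal_matD[OF Q])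
      also have "\<dots> = (\<Sum>k<n. \<Sum>m<n. Q i k * Q j m * bf (q k) (q m))"
        unfolding bf_sum_left[OF finite_lessThan] bf_sum_right[OF finite_lessThan]
        by (simp add: sum_distrib_left mult_ac)
      also have "\<dots> = (\<Sum>k<n. \<Sum>l<n. if l = k then Q i k * Q j k * bf (q k) (q k) else 0)"
        by (intro sum.cong) (auto simp: off)
      also have "\<dots> = spectral n Q (\<lambda>k. bf (q k) (q k)) i j"
        using True by (simp add: spectral_def mult_ac)
      finally show ?thesis .
    next
      case False
      thus ?thesis using pad by (auto simp: spectral_def padded_def)
    qed
  qed
  thus ?thesis using that Q by blast
qed

section \<open>Pseudoinverse, square root and rank in an eigenbasis\<close>

lemma mmul_assoc: "mmul m (mmul n A B) C = mmul n A (mmul m B C)"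
  unfolding mmul_def sum_distrib_left sum_distrib_right
  by (intro ext, subst sum.swap) (simp add: mult.assoc)

lemma mvec_mmul: "mvec m (mmul n A B) x = mvec n A (mvec m B x)"
  unfolding mmul_def mvec_def sum_distrib_left sum_distrib_right
  by (intro ext, subst sum.swap) (simp add: mult.assoc)

lemma ip_commute: "ip n x y = ip n y x"
  by (simp add: ip_def mult.commute)

lemma ip_nonneg [simp]: "0 \<le> ip n x x"
  by (simp add: ip_def sum_nonneg)

lemma ip_diff_left: "ip n (\<lambda>i. x i - y i) z = ip n x z - ip n y z"
  by (simp add: ip_def algebra_simps sum_subtractf)

lemma ip_diff_right: "ip n z (\<lambda>i. x i - y i) = ip n z x - ip n z y"
  by (simp add: ip_def algebra_simps sum_subtractf)

lemma ip_scale_left: "ip n (\<lambda>i. c * x i) y = c * ip n x y"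
  by (simp add: ip_def sum_distrib_left mult_ac)

lemma ip_scale_right: "ip n x (\<lambda>i. c * y i) = c * ip n x y"
  by (simp add: ip_def sum_distrib_left mult_ac)

lemma ip_sum_left: "ip n (\<lambda>i. \<Sum>k\<in>I. c k * x k i) y = (\<Sum>k\<in>I. c k * ip n (x k) y)"
  unfolding ip_def sum_distrib_left sum_distrib_right by (subst sum.swap) (simp add: mult_ac)

lemma ip_sum_right: "ip n y (\<lambda>i. \<Sum>k\<in>I. c k * x k i) = (\<Sum>k\<in>I. c k * ip n y (x k))"
  using ip_sum_left[where n = n and I = I and c = c and x = x and y = y] by (simp add: ip_commute)

lemma ip_cong: "(\<And>i. i < n \<Longrightarrow> x i = x' i) \<Longrightarrow> (\<And>i. i < n \<Longrightarrow> y i = y' i) \<Longrightarrow> ip n x y = ip n x' y'"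
  by (simp add: ip_def)

lemma vnorm_ip: "vnorm n v = sqrt (ip n v v)"
  by (simp add: vnorm_def ip_def power2_eq_square)

lemma vnorm_nonneg [simp]: "0 \<le> vnorm n v"
  by (simp add: vnorm_ip)

lemma vnorm_sq: "(vnorm n v)\<^sup>2 = ip n v v"
  by (simp add: vnorm_ip)

lemma vnorm_eq_0: "vnorm n v = 0 \<Longrightarrow> i < n \<Longrightarrow> v i = 0"
  by (simp add: vnorm_def sum_nonneg_eq_0_iff)

lemma vnorm_scale: "vnorm n (\<lambda>i. c * v i) = \<bar>c\<bar> * vnorm n v"
  by (simp add: vnorm_ip ip_scale_left ip_scale_right real_sqrt_mult real_sqrt_abs2 mult.assoc[symmetric])

lemma abs_ip_le: "\<bar>ip n x y\<bar> \<le> vnorm n x * vnorm n y"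
proof -
  have "(ip n x y)\<^sup>2 \<le> (vnorm n x)\<^sup>2 * (vnorm n y)\<^sup>2"
    using Cauchy_Schwarz_ineq_sum[of x y "{..<n}"] unfolding vnorm_sq by (simp add: ip_def power2_eq_square)
  hence "\<bar>ip n x y\<bar>\<^sup>2 \<le> (vnorm n x * vnorm n y)\<^sup>2" by (simp add: power_mult_distrib)
  thus ?thesis by (rule power2_le_imp_le) simp
qed

lemma vnorm_cases:
  obtains "\<And>i. i < n \<Longrightarrow> v i = 0" "vnorm n v = 0"
  | "vnorm n v > 0" "(\<lambda>i. v i / vnorm n v) \<in> unit_vecs n"
proof (cases "vnorm n v = 0")
  case True
  thus ?thesis using that(1) vnorm_eq_0 by blast
next
  case False
  hence p: "vnorm n v > 0" using vnorm_nonneg[of n v] by linarith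
  have "vnorm n (\<lambda>i. (1 / vnorm n v) * v i) = 1" unfolding vnorm_scale using p by simp
  thus ?thesis using that(2) p by (simp add: unit_vecs_def)
qed

lemma ip_mvec_left: "ip m (mvec n A x) y = ip n x (mvec m (mtrans A) y)"
  unfolding ip_def mvec_def mtrans_def sum_distrib_left sum_distrib_right
  by (subst sum.swap) (simp add: mult_ac)

lemma ip_mvec_sym:
  assumes "\<And>i j. i < n \<Longrightarrow> j < n \<Longrightarrow> M i j = M j i"
  shows "ip n (mvec n M x) y = ip n x (mvec n M y)"
  unfolding ip_mvec_left by (rule ip_cong) (auto simp: mvec_def mtrans_def assms intro!: sum.cong)

lemma mvec_diff: "mvec n M (\<lambda>i. x i - y i) = (\<lambda>i. mvec n M x i - mvec n M y i)"
  by (simp add: mvec_def algebra_simps sum_subtractf)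

lemma mvec_scale: "mvec n M (\<lambda>i. c * x i) = (\<lambda>i. c * mvec n M x i)"
  by (simp add: mvec_def sum_distrib_left mult_ac)

lemma mvec_cong: "(\<And>i. i < n \<Longrightarrow> x i = y i) \<Longrightarrow> mvec n M x = mvec n M y"
  by (simp add: mvec_def)

lemma mvec_padded: "padded n M \<Longrightarrow> \<not> i < n \<Longrightarrow> mvec n M x i = 0"
  by (simp add: padded_def mvec_def)

lemma padded_mmul: "padded n A \<Longrightarrow> padded n B \<Longrightarrow> padded n (mmul n A B)"
  by (auto simp: padded_def mmul_def)

lemma padded_ext:
  assumes "padded n A" "padded n B" "\<And>i j. i < n \<Longrightarrow> j < n \<Longrightarrow> A i j = B i j"
  shows "A = B"
proof (intro ext)
  fix i j show "A i j = B i j"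
    using assms by (cases "i < n \<and> j < n") (auto simp: padded_def)
qed

lemma padded_spectral [simp]: "padded n (spectral n Q f)"
  by (simp add: padded_def spectral_def)

lemma spectral_sym: "spectral n Q f i j = spectral n Q f j i"
  by (simp add: spectral_def mult_ac)

lemma mtrans_spectral [simp]: "mtrans (spectral n Q f) = spectral n Q f"
  by (intro ext) (simp add: mtrans_def spectral_sym)

lemma mvec_spectral:
  "mvec n (spectral n Q f) x = (\<lambda>i. if i < n then \<Sum>k<n. (f k * ip n (\<lambda>a. Q a k) x) * Q i k else 0)"
proof (intro ext)
  fix i
  show "mvec n (spectral n Q f) x i = (if i < n then \<Sum>k<n. (f k * ip n (\<lambda>a. Q a k) x) * Q i k else 0)"
  proof (cases "i < n")
    case True
    have "mvec n (spectral n Q f) x i = (\<Sum>j<n. \<Sum>k<n. f k * Q i k * Q j k * x j)"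
      using True by (auto simp: mvec_def spectral_def sum_distrib_right intro!: sum.cong)
    also have "\<dots> = (\<Sum>k<n. (f k * ip n (\<lambda>a. Q a k) x) * Q i k)"
      by (subst sum.swap) (simp add: ip_def sum_distrib_left sum_distrib_right mult_ac)
    finally show ?thesis using True by simp
  qed (simp add: mvec_def spectral_def)
qed

lemma ip_columns:
  assumes "orthogonal_mat n Q" "k < n" "l < n"
  shows "ip n (\<lambda>a. Q a k) (\<lambda>a. Q a l) = of_bool (k = l)"
  using assms by (simp add: ip_def orthogonal_matD)

lemma mmul_spectral:
  assumes Q: "orthogonal_mat n Q"
  shows "mmul n (spectral n Q f) (spectral n Q g) = spectral n Q (\<lambda>k. f k * g k)"
proof (rule padded_ext[of n])
  fix i j assume ij: "i < n" "j < n"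
  have "mmul n (spectral n Q f) (spectral n Q g) i j = mvec n (spectral n Q f) (\<lambda>a. spectral n Q g a j) i"
    by (simp add: mmul_def mvec_def)
  also have "\<dots> = (\<Sum>k<n. f k * ip n (\<lambda>a. Q a k) (\<lambda>a. \<Sum>l<n. (g l * Q j l) * Q a l) * Q i k)"
  proof -
    have "ip n (\<lambda>a. Q a k) (\<lambda>a. spectral n Q g a j) = ip n (\<lambda>a. Q a k) (\<lambda>a. \<Sum>l<n. (g l * Q j l) * Q a l)" for k
      using ij by (intro ip_cong) (auto simp: spectral_def mult_ac)
    thus ?thesis unfolding mvec_spectral using ij by simp
  qed
  also have "\<dots> = (\<Sum>k<n. f k * (g k * Q j k) * Q i k)"
  proof (rule sum.cong, rule refl)
    fix k assume k: "k \<in> {..<n}"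
    have "ip n (\<lambda>a. Q a k) (\<lambda>a. \<Sum>l<n. (g l * Q j l) * Q a l) = (\<Sum>l<n. if l = k then g l * Q j l else 0)"
      unfolding ip_sum_right[where c = "\<lambda>l. g l * Q j l" and x = "\<lambda>l a. Q a l"] using k
      by (intro sum.cong) (auto simp: ip_columns[OF Q])
    thus "f k * ip n (\<lambda>a. Q a k) (\<lambda>a. \<Sum>l<n. (g l * Q j l) * Q a l) * Q i k = f k * (g k * Q j k) * Q i k"
      using k by simp
  qed
  finally show "mmul n (spectral n Q f) (spectral n Q g) i j = spectral n Q (\<lambda>k. f k * g k) i j"
    using ij by (simp add: spectral_def mult_ac)
qed (simp_all add: padded_mmul)

lemma spectral_form: "ip n x (mvec n (spectral n Q f) x) = (\<Sum>k<n. f k * (ip n (\<lambda>a. Q a k) x)\<^sup>2)"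
proof -
  have "ip n x (mvec n (spectral n Q f) x) = ip n x (\<lambda>i. \<Sum>k<n. (f k * ip n (\<lambda>a. Q a k) x) * Q i k)"
    by (rule ip_cong) (auto simp: mvec_spectral)
  also have "\<dots> = (\<Sum>k<n. f k * (ip n (\<lambda>a. Q a k) x)\<^sup>2)"
    unfolding ip_sum_right[where x = "\<lambda>k a. Q a k"] by (simp add: power2_eq_square ip_commute mult_ac)
  finally show ?thesis .
qed

lemma mvec_spectral_column:
  assumes Q: "orthogonal_mat n Q" and k: "k < n"
  shows "mvec n (spectral n Q f) (\<lambda>a. Q a k) = (\<lambda>i. if i < n then f k * Q i k else 0)"
  unfolding mvec_spectral using k
  by (intro ext) (simp add: ip_columns[OF Q] of_bool_def if_distrib if_distribR cong: if_cong)

lemma spectral_ev: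
  assumes Q: "orthogonal_mat n Q" and k: "k < n"
  shows "ip n (\<lambda>a. Q a k) (mvec n (spectral n Q f) (\<lambda>a. Q a k)) = f k"
proof -
  have "ip n (\<lambda>a. Q a k) (mvec n (spectral n Q f) (\<lambda>a. Q a k)) = ip n (\<lambda>a. Q a k) (\<lambda>i. f k * Q i k)"
    by (rule ip_cong) (auto simp: mvec_spectral_column[OF Q k])
  thus ?thesis by (simp add: ip_scale_right ip_columns[OF Q k k])
qed

lemma psd_iff_form: "psd n S \<longleftrightarrow> (\<forall>i<n. \<forall>j<n. S i j = S j i) \<and> (\<forall>v. 0 \<le> ip n v (mvec n S v))"
  by (simp add: psd_def ip_def mvec_def sum_distrib_left mult_ac)

lemma psd_spectral: "(\<And>k. k < n \<Longrightarrow> 0 \<le> f k) \<Longrightarrow> psd n (spectral n Q f)"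
  unfolding psd_iff_form spectral_form by (auto simp: spectral_sym intro!: sum_nonneg)

lemma spectral_cong: "(\<And>k. k < n \<Longrightarrow> f k = g k) \<Longrightarrow> spectral n Q f = spectral n Q g"
  by (auto simp: spectral_def fun_eq_iff)

text \<open>The convention \<open>inverse 0 = 0\<close> is the one of the pseudoinverse. Uniqueness
  is Penrose's argument: \<open>A H\<close> and \<open>A G\<close> are symmetric and absorb each
  other, hence agree, and so do \<open>H A\<close> and \<open>G A\<close>; then
  \<open>H = H A H = G A H = G A G = G\<close>.\<close>

lemma pinv_spectral:
  assumes Q: "orthogonal_mat n Q"
  shows "pinv n n (spectral n Q l) = spectral n Q (\<lambda>k. inverse (l k))"
proof -
  let ?A = "spectral n Q l" and ?G = "spectral n Q (\<lambda>k. inverse (l k))"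
  have inv: "(x :: real) * inverse x * x = x" for x by (cases "x = 0") auto
  have inv': "inverse (x :: real) * x * inverse x = inverse x" for x by (cases "x = 0") auto
  show ?thesis unfolding pinv_def
  proof (rule the_equality)
    show "(\<forall>i j. \<not> (i < n \<and> j < n) \<longrightarrow> ?G i j = 0) \<and>
      (\<forall>i<n. \<forall>j<n. mmul n (mmul n ?A ?G) ?A i j = ?A i j) \<and>
      (\<forall>i<n. \<forall>j<n. mmul n (mmul n ?G ?A) ?G i j = ?G i j) \<and>
      (\<forall>i<n. \<forall>j<n. mmul n ?A ?G i j = mmul n ?A ?G j i) \<and>
      (\<forall>i<n. \<forall>j<n. mmul n ?G ?A i j = mmul n ?G ?A j i)"
      unfolding mmul_spectral[OF Q] inv inv'
      by (intro conjI allI impI refl spectral_sym) (auto simp: spectral_def)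
  next
    fix H assume H: "(\<forall>i j. \<not> (i < n \<and> j < n) \<longrightarrow> H i j = 0) \<and>
      (\<forall>i<n. \<forall>j<n. mmul n (mmul n ?A H) ?A i j = ?A i j) \<and>
      (\<forall>i<n. \<forall>j<n. mmul n (mmul n H ?A) H i j = H i j) \<and>
      (\<forall>i<n. \<forall>j<n. mmul n ?A H i j = mmul n ?A H j i) \<and>
      (\<forall>i<n. \<forall>j<n. mmul n H ?A i j = mmul n H ?A j i)"
    have pH: "padded n H" using H by (simp add: padded_def)
    have AHA: "mmul n ?A (mmul n H ?A) = ?A"
      using H by (intro padded_ext[of n] padded_mmul pH padded_spectral) (auto simp: mmul_assoc)
    have HAH: "mmul n H (mmul n ?A H) = H"
      using H by (intro padded_ext[of n] padded_mmul pH padded_spectral) (auto simp: mmul_assoc)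
    have tr: "mtrans (mmul n X Y) = mmul n (mtrans Y) (mtrans X)" for X Y
      by (intro ext) (simp add: mtrans_def mmul_def mult_ac)
    have padt: "padded n X \<Longrightarrow> padded n (mtrans X)" for X by (auto simp: padded_def mtrans_def)
    have sAH: "mtrans (mmul n ?A H) = mmul n ?A H"
      using H by (intro padded_ext[of n] padt padded_mmul pH padded_spectral) (auto simp: mtrans_def)
    have sHA: "mtrans (mmul n H ?A) = mmul n H ?A"
      using H by (intro padded_ext[of n] padt padded_mmul pH padded_spectral) (auto simp: mtrans_def)
    have sAG: "mtrans (mmul n ?A ?G) = mmul n ?A ?G" "mtrans (mmul n ?G ?A) = mmul n ?G ?A"
      by (simp_all add: mmul_spectral[OF Q])
    have AGA: "mmul n ?A (mmul n ?G ?A) = ?A" and GAG: "mmul n ?G (mmul n ?A ?G) = ?G"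
      by (simp_all add: mmul_spectral[OF Q] inv inv' mult.assoc[symmetric])
    have AGA': "mmul n ?A (mmul n ?G (mmul n ?A X)) = mmul n ?A X" for X
      using AGA by (metis mmul_assoc)
    have AHA': "mmul n ?A (mmul n H (mmul n ?A X)) = mmul n ?A X" for X
      using AHA by (metis mmul_assoc)
    have AH: "mmul n ?A H = mmul n ?A ?G"
    proof -
      have "mmul n ?A H = mmul n (mmul n ?A ?G) (mmul n ?A H)" by (simp add: mmul_assoc AGA')
      also have "\<dots> = mtrans (mmul n (mmul n ?A H) (mmul n ?A ?G))" by (simp add: tr[of "mmul n ?A H"] sAG sAH)
      also have "\<dots> = mmul n ?A ?G" using sAG(1) by (simp add: mmul_assoc AHA')
      finally show ?thesis .
    qed
    have HA: "mmul n H ?A = mmul n ?G ?A"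
    proof -
      have "mmul n H ?A = mmul n (mmul n H ?A) (mmul n ?G ?A)" by (simp add: mmul_assoc AGA)
      also have "\<dots> = mtrans (mmul n (mmul n ?G ?A) (mmul n H ?A))" by (simp add: tr[of "mmul n ?G ?A"] sAG sHA)
      also have "\<dots> = mmul n ?G ?A" using sAG(2) by (simp add: mmul_assoc AHA)
      finally show ?thesis .
    qed
    have "H = mmul n (mmul n H ?A) H" by (simp add: mmul_assoc HAH)
    also have "\<dots> = mmul n ?G (mmul n ?A H)" by (simp add: HA mmul_assoc)
    also have "\<dots> = ?G" by (simp add: AH GAG)
    finally show "H = ?G" .
  qed
qed

lemma orthogonal_expand:
  assumes Q: "orthogonal_mat n Q" and i: "i < n"
  shows "x i = (\<Sum>k<n. ip n (\<lambda>a. Q a k) x * Q i k)"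
proof -
  have "(\<Sum>k<n. ip n (\<lambda>a. Q a k) x * Q i k) = (\<Sum>a<n. (\<Sum>k<n. Q a k * Q i k) * x a)"
    unfolding ip_def sum_distrib_left sum_distrib_right by (subst sum.swap) (simp add: mult_ac)
  also have "\<dots> = (\<Sum>a<n. if a = i then x a else 0)"
    by (intro sum.cong) (auto simp: orthogonal_matD[OF Q _ i])
  finally show ?thesis using i by simp
qed

text \<open>For uniqueness a second root is diagonalised in its own basis \<open>P\<close>. Its
  square has two spectral forms, so for eigenvectors with nonzero overlap
  \<open>(s k)\<^sup>2 = l m\<close>, and nonnegativity gives \<open>s k = sqrt (l m)\<close>. Thus
  the second root acts on each column of \<open>Q\<close> as multiplication by
  \<open>sqrt (l m)\<close>.\<close>

lemma psd_sqrt_spectral: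
  assumes Q: "orthogonal_mat n Q" and l: "\<And>k. k < n \<Longrightarrow> 0 \<le> l k"
  shows "psd_sqrt n (spectral n Q l) = spectral n Q (\<lambda>k. sqrt (l k))"
  unfolding psd_sqrt_def
proof (rule the_equality)
  have *: "mmul n (spectral n Q (\<lambda>k. sqrt (l k))) (spectral n Q (\<lambda>k. sqrt (l k))) = spectral n Q l"
    unfolding mmul_spectral[OF Q] by (rule spectral_cong) (simp add: l)
  show "(\<forall>i j. \<not> (i < n \<and> j < n) \<longrightarrow> spectral n Q (\<lambda>k. sqrt (l k)) i j = 0) \<and>
    psd n (spectral n Q (\<lambda>k. sqrt (l k))) \<and>
    (\<forall>i<n. \<forall>j<n. mmul n (spectral n Q (\<lambda>k. sqrt (l k))) (spectral n Q (\<lambda>k. sqrt (l k))) i j = spectral n Q l i j)"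
    unfolding * using l by (intro conjI allI impI refl psd_spectral) (auto simp: spectral_def)
next
  fix S assume S: "(\<forall>i j. \<not> (i < n \<and> j < n) \<longrightarrow> S i j = 0) \<and> psd n S \<and>
    (\<forall>i<n. \<forall>j<n. mmul n S S i j = spectral n Q l i j)"
  let ?T = "spectral n Q (\<lambda>k. sqrt (l k))"
  have pS: "padded n S" using S by (simp add: padded_def)
  obtain P s where P: "orthogonal_mat n P" and SP: "S = spectral n P s"
    using spectral_theorem[OF _ pS] S by (auto simp: psd_def)
  have s: "0 \<le> s k" if "k < n" for k
  proof -
    have "psd n S" using S by blast
    hence "0 \<le> ip n (\<lambda>a. P a k) (mvec n (spectral n P s) (\<lambda>a. P a k))" unfolding SP psd_iff_form by blast
    thus ?thesis using spectral_ev[OF P that] by simp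
  qed
  have SS: "spectral n P (\<lambda>k. s k * s k) = spectral n Q l"
    using S unfolding SP mmul_spectral[OF P] by (intro padded_ext[of n]) auto
  have key: "s k * ip n (\<lambda>a. P a k) (\<lambda>a. Q a m) = sqrt (l m) * ip n (\<lambda>a. P a k) (\<lambda>a. Q a m)"
    if km: "k < n" "m < n" for k m
  proof -
    let ?w = "ip n (\<lambda>a. P a k) (\<lambda>a. Q a m)"
    have "ip n (mvec n (spectral n P (\<lambda>k. s k * s k)) (\<lambda>a. P a k)) (\<lambda>a. Q a m)
        = ip n (\<lambda>a. P a k) (mvec n (spectral n Q l) (\<lambda>a. Q a m))"
      unfolding SS by (rule ip_mvec_sym) (rule spectral_sym)
    moreover have "ip n (mvec n (spectral n P (\<lambda>k. s k * s k)) (\<lambda>a. P a k)) (\<lambda>a. Q a m) = ip n (\<lambda>a. (s k * s k) * P a k) (\<lambda>a. Q a m)"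
      by (rule ip_cong) (auto simp: mvec_spectral_column[OF P km(1)])
    moreover have "ip n (\<lambda>a. P a k) (mvec n (spectral n Q l) (\<lambda>a. Q a m)) = ip n (\<lambda>a. P a k) (\<lambda>a. l m * Q a m)"
      by (rule ip_cong) (auto simp: mvec_spectral_column[OF Q km(2)])
    ultimately have "(s k * s k) * ?w = l m * ?w"
      by (simp add: ip_scale_left[where x = "\<lambda>a. P a k"] ip_scale_right[where y = "\<lambda>a. Q a m"])
    hence "?w = 0 \<or> (s k)\<^sup>2 = l m" by (auto simp: power2_eq_square)
    then consider "?w = 0" | "sqrt (l m) = s k" using real_sqrt_unique[OF _ s[OF km(1)]] by blast
    thus ?thesis by cases simp_all
  qed
  have mv: "mvec n S (\<lambda>a. Q a m) i = sqrt (l m) * Q i m" if "i < n" "m < n" for i m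
  proof -
    have "mvec n S (\<lambda>a. Q a m) i = (\<Sum>k<n. (s k * ip n (\<lambda>a. P a k) (\<lambda>a. Q a m)) * P i k)"
      unfolding SP mvec_spectral using that by simp
    also have "\<dots> = (\<Sum>k<n. (sqrt (l m) * ip n (\<lambda>a. P a k) (\<lambda>a. Q a m)) * P i k)"
    proof (rule sum.cong[OF refl])
      fix k assume "k \<in> {..<n}"
      hence "k < n" by simp
      show "s k * ip n (\<lambda>a. P a k) (\<lambda>a. Q a m) * P i k = sqrt (l m) * ip n (\<lambda>a. P a k) (\<lambda>a. Q a m) * P i k"
        unfolding key[OF \<open>k < n\<close> that(2)] ..
    qed
    also have "\<dots> = sqrt (l m) * (\<Sum>k<n. ip n (\<lambda>a. P a k) (\<lambda>a. Q a m) * P i k)"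
      by (simp add: sum_distrib_left mult_ac)
    also have "\<dots> = sqrt (l m) * Q i m"
      using orthogonal_expand[OF P that(1), of "\<lambda>a. Q a m"] by simp
    finally show ?thesis .
  qed
  show "S = ?T"
  proof (rule padded_ext[OF pS padded_spectral])
    fix i j assume ij: "i < n" "j < n"
    have "S i j = S j i" using S ij by (simp add: psd_def)
    also have "\<dots> = (\<Sum>m<n. ip n (\<lambda>a. Q a m) (\<lambda>a. S j a) * Q i m)"
      by (rule orthogonal_expand[OF Q ij(1)])
    also have "\<dots> = (\<Sum>m<n. mvec n S (\<lambda>a. Q a m) j * Q i m)"
      by (simp add: ip_def mvec_def mult_ac)
    also have "\<dots> = ?T i j" using ij by (auto simp: mv spectral_def mult_ac intro!: sum.cong)
    finally show "S i j = ?T i j" .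
  qed
qed

text \<open>If \<open>C\<close> consists of a maximal independent set of columns, the projection onto the range factors as
  \<open>C E\<close> with \<open>E C = 1\<close>, so that comparing traces yields the rank.\<close>

lemma mrank_spectral:
  assumes Q: "orthogonal_mat n Q"
  shows "mrank n n (spectral n Q l) = card {k. k < n \<and> l k \<noteq> 0}"
proof -
  let ?A = "spectral n Q l" and ?G = "spectral n Q (\<lambda>k. inverse (l k))"
  define indep where "indep S \<longleftrightarrow> (\<forall>c. (\<forall>i<n. (\<Sum>j\<in>S. c j * ?A i j) = 0) \<longrightarrow> (\<forall>j\<in>S. c j = 0))" for S :: "nat set"
  let ?C = "{card S | S. S \<subseteq> {..<n} \<and> indep S}"
  have "?C \<subseteq> card ` Pow {..<n}" by auto
  hence fin: "finite ?C" by (rule finite_subset) auto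
  have "card {} \<in> ?C" unfolding mem_Collect_eq by (intro exI[of _ "{}"]) (auto simp: indep_def)
  hence "?C \<noteq> {}" by blast
  with fin have "Max ?C \<in> ?C" by (rule Max_in)
  then obtain S where S: "S \<subseteq> {..<n}" "indep S" "Max ?C = card S" by auto
  have finS: "finite S" using S(1) finite_subset by blast
  have span: "\<exists>d. \<forall>i<n. ?A i j = (\<Sum>m\<in>S. d m * ?A i m)" if j: "j < n" for j
  proof (cases "j \<in> S")
    case True
    thus ?thesis using finS by (intro exI[of _ "\<lambda>m. of_bool (m = j)"]) (simp add: of_bool_def if_distrib if_distribR cong: if_cong)
  next
    case False
    have "\<not> indep (insert j S)"
    proof
      assume "indep (insert j S)"
      hence "card (insert j S) \<in> ?C" using S(1) j by blast
      hence "card (insert j S) \<le> Max ?C" using fin by simp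
      thus False using S(3) False finS by simp
    qed
    then obtain c where c: "\<forall>i<n. (\<Sum>m\<in>insert j S. c m * ?A i m) = 0" "\<not> (\<forall>m\<in>insert j S. c m = 0)"
      unfolding indep_def by blast
    have "c j \<noteq> 0"
    proof
      assume cj: "c j = 0"
      hence "\<forall>i<n. (\<Sum>m\<in>S. c m * ?A i m) = 0" using c(1) False finS by simp
      hence "\<forall>m\<in>S. c m = 0" using S(2) unfolding indep_def by blast
      thus False using c(2) cj by auto
    qed
    have "?A i j = (\<Sum>m\<in>S. (- c m / c j) * ?A i m)" if "i < n" for i
    proof -
      have "c j * ?A i j + (\<Sum>m\<in>S. c m * ?A i m) = 0" using c(1) that False finS by simp
      moreover have "y = - s / x" if "x * y + s = 0" "x \<noteq> 0" for x y s :: real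
        using that by (simp add: field_simps)
      ultimately have "?A i j = - (\<Sum>m\<in>S. c m * ?A i m) / c j" using \<open>c j \<noteq> 0\<close> by blast
      thus ?thesis by (simp add: sum_divide_distrib sum_negf)
    qed
    thus ?thesis by (intro exI[of _ "\<lambda>m. - c m / c j"]) blast
  qed
  hence "\<forall>j. \<exists>d. j < n \<longrightarrow> (\<forall>i<n. ?A i j = (\<Sum>m\<in>S. d m * ?A i m))" by blast
  from choice[OF this] obtain d where d: "\<And>i j. i < n \<Longrightarrow> j < n \<Longrightarrow> ?A i j = (\<Sum>m\<in>S. d j m * ?A i m)" by blast
  \<comment> \<open>The coefficients \<open>d\<close> write all columns of \<open>A\<close> through
    those in \<open>S\<close>, that is \<open>A = C d\<close>; hence the projection
    \<open>A G\<close> is \<open>C E\<close> with \<open>E = d G\<close>.\<close>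
  define E where "E m j = (\<Sum>a<n. d a m * ?G a j)" for m j
  let ?P = "mmul n ?A ?G"
  have PE: "?P i j = (\<Sum>m\<in>S. ?A i m * E m j)" if "i < n" "j < n" for i j
  proof -
    have "?P i j = (\<Sum>a<n. (\<Sum>m\<in>S. d a m * ?A i m) * ?G a j)"
      using that d[of i] unfolding mmul_def by (intro sum.cong) auto
    also have "\<dots> = (\<Sum>m\<in>S. ?A i m * E m j)"
      unfolding E_def sum_distrib_left sum_distrib_right by (subst sum.swap) (simp add: mult_ac)
    finally show ?thesis .
  qed
  have PA: "mmul n ?P ?A = ?A"
    unfolding mmul_spectral[OF Q]
  proof (rule spectral_cong)
    fix k show "l k * inverse (l k) * l k = l k" by (cases "l k = 0") auto
  qed
  \<comment> \<open>Since \<open>C E C = P C = C\<close>, independence of the columns of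
    \<open>C\<close> allows its cancellation on the left.\<close>
  have EC: "(\<Sum>i<n. E m i * ?A i b) = of_bool (m = b)" if mb: "m \<in> S" "b \<in> S" for m b
  proof -
    define c where "c m = (\<Sum>i<n. E m i * ?A i b) - of_bool (m = b)" for m
    have "(\<Sum>m\<in>S. c m * ?A i m) = 0" if i: "i < n" for i
    proof -
      have "(\<Sum>m\<in>S. c m * ?A i m) = (\<Sum>m\<in>S. (\<Sum>a<n. E m a * ?A a b) * ?A i m) - ?A i b"
      proof -
        have "(\<Sum>m\<in>S. c m * ?A i m) = (\<Sum>m\<in>S. (\<Sum>a<n. E m a * ?A a b) * ?A i m - (if m = b then ?A i b else 0))"
          by (intro sum.cong) (auto simp: c_def left_diff_distrib)
        thus ?thesis using mb finS by (simp add: sum_subtractf)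
      qed
      also have "(\<Sum>m\<in>S. (\<Sum>a<n. E m a * ?A a b) * ?A i m) = (\<Sum>a<n. (\<Sum>m\<in>S. ?A i m * E m a) * ?A a b)"
        unfolding sum_distrib_left sum_distrib_right by (subst sum.swap) (simp add: mult_ac)
      also have "\<dots> = mmul n ?P ?A i b" unfolding mmul_def[of n ?P] using PE i by (intro sum.cong) auto
      finally show ?thesis by (simp add: PA)
    qed
    hence "c m = 0" using S(2) mb unfolding indep_def by blast
    thus ?thesis by (simp add: c_def)
  qed
  have "real (card S) = (\<Sum>m\<in>S. \<Sum>i<n. E m i * ?A i m)" using EC by simp
  also have "\<dots> = (\<Sum>i<n. ?P i i)" using PE by (subst sum.swap) (simp add: mult_ac)
  also have "\<dots> = (\<Sum>i<n. \<Sum>k<n. (l k * inverse (l k)) * (Q i k * Q i k))"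
    unfolding mmul_spectral[OF Q] by (simp add: spectral_def mult_ac)
  also have "\<dots> = (\<Sum>k<n. (l k * inverse (l k)) * (\<Sum>i<n. Q i k * Q i k))"
    by (subst sum.swap) (simp add: sum_distrib_left)
  also have "\<dots> = (\<Sum>k<n. if l k \<noteq> 0 then 1 else 0)"
    by (intro sum.cong) (auto simp: orthogonal_matD[OF Q])
  also have "\<dots> = real (card {k. k < n \<and> l k \<noteq> 0})"
    by (simp add: sum.If_cases lessThan_def Int_def)
  finally have "card S = card {k. k < n \<and> l k \<noteq> 0}" by linarith
  thus ?thesis using S(3) unfolding mrank_def indep_def by simp
qed

section \<open>Reduction of the dimension to the number of linear forms involved\<close>

lemma gram_schmidt:
  fixes h :: "nat \<Rightarrow> nat \<Rightarrow> real"
  assumes "finite I"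
  shows "\<exists>g. (\<forall>i\<in>I. \<forall>j\<in>I. i \<noteq> j \<longrightarrow> ip d (g i) (g j) = 0) \<and> (\<forall>i\<in>I. ip d (g i) (g i) \<in> {0, 1}) \<and>
     (\<forall>k\<in>I. \<forall>m<d. h k m = (\<Sum>j\<in>I. ip d (h k) (g j) * g j m))"
  using assms
proof (induction I rule: finite_induct)
  case (insert k I)
  then obtain g where g: "\<And>i j. i \<in> I \<Longrightarrow> j \<in> I \<Longrightarrow> i \<noteq> j \<Longrightarrow> ip d (g i) (g j) = 0"
    "\<And>i. i \<in> I \<Longrightarrow> ip d (g i) (g i) \<in> {0, 1}"
    "\<And>k m. k \<in> I \<Longrightarrow> m < d \<Longrightarrow> h k m = (\<Sum>j\<in>I. ip d (h k) (g j) * g j m)" by blast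
  define p where "p = (\<lambda>m. h k m - (\<Sum>j\<in>I. ip d (h k) (g j) * g j m))"
  \<comment> \<open>A dependent vector leaves a remainder of norm 0, and division by 0 turns it into
    the zero vector. The new family therefore keeps the index set, with squared lengths 0 or
    1.\<close>
  define g' where "g' = (\<lambda>i. if i = k then (\<lambda>m. p m / vnorm d p) else g i)"
  have g'I: "g' i = g i" if "i \<in> I" for i using that insert(2) by (auto simp: g'_def)
  have zero: "ip d x (g j) = 0" if "ip d (g j) (g j) = 0" for x j
    using abs_ip_le[of d x "g j"] that by (simp add: vnorm_ip)
  have pg: "ip d p (g i) = 0" if i: "i \<in> I" for i
  proof -
    have "ip d p (g i) = ip d (h k) (g i) - (\<Sum>j\<in>I. ip d (h k) (g j) * ip d (g j) (g i))"
      unfolding p_def ip_diff_left ip_sum_left ..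
    also have "(\<Sum>j\<in>I. ip d (h k) (g j) * ip d (g j) (g i)) = (\<Sum>j\<in>I. if j = i then ip d (h k) (g i) * ip d (g i) (g i) else 0)"
      using g(1) i by (intro sum.cong) auto
    also have "\<dots> = ip d (h k) (g i) * ip d (g i) (g i)" using i insert(1) by simp
    also have "\<dots> = ip d (h k) (g i)" using g(2)[OF i] zero by auto
    finally show ?thesis by simp
  qed
  have g'k: "g' k = (\<lambda>m. (1 / vnorm d p) * p m)" by (simp add: g'_def)
  have 1: "ip d (g' k) (g i) = 0" if "i \<in> I" for i
    unfolding g'k ip_scale_left using pg[OF that] by simp
  have 2: "ip d (g' k) (g' k) \<in> {0, 1}"
    unfolding g'k ip_scale_left ip_scale_right
    by (cases "vnorm d p = 0") (auto simp: vnorm_sq[symmetric] power2_eq_square)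
  have pp: "ip d p (h k) = ip d p p"
  proof -
    have "ip d p p = ip d p (h k) - (\<Sum>j\<in>I. ip d (h k) (g j) * ip d p (g j))"
      by (subst (2) p_def) (simp only: ip_diff_right ip_sum_right)
    thus ?thesis using pg by simp
  qed
  have 3: "h k m = (\<Sum>j\<in>I. ip d (h k) (g j) * g j m) + ip d (h k) (g' k) * g' k m" if "m < d" for m
  proof -
    have "ip d (h k) (g' k) * g' k m = p m"
    proof (cases "vnorm d p = 0")
      case True
      thus ?thesis using vnorm_eq_0[OF True that] by (simp add: g'k)
    next
      case False
      have "ip d (h k) (g' k) = vnorm d p"
        unfolding g'k ip_scale_right ip_commute[of d "h k"] pp vnorm_sq[symmetric] using False by (simp add: power2_eq_square)
      thus ?thesis using False by (simp add: g'k)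
    qed
    thus ?thesis by (simp add: p_def)
  qed
  have 4: "h i m = (\<Sum>j\<in>I. ip d (h i) (g j) * g j m) + ip d (h i) (g' k) * g' k m" if "m < d" "i \<in> I" for i m
  proof -
    have "ip d (h i) (g' k) = ip d (\<lambda>m. \<Sum>j\<in>I. ip d (h i) (g j) * g j m) (g' k)"
      using g(3) that by (intro ip_cong) auto
    also have "\<dots> = 0" unfolding ip_sum_left using 1 by (simp add: ip_commute)
    finally show ?thesis using g(3) that by simp
  qed
  have sum': "(\<Sum>j\<in>insert k I. ip d x (g' j) * g' j m) = (\<Sum>j\<in>I. ip d x (g j) * g j m) + ip d x (g' k) * g' k m" for x m
    using insert(1,2) g'I by simp
  show ?case
  proof (intro exI[of _ g'] conjI ballI allI impI)
    fix i j assume "i \<in> insert k I" "j \<in> insert k I" "i \<noteq> j"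
    then consider "i = k" "j \<in> I" | "j = k" "i \<in> I" | "i \<in> I" "j \<in> I" "i \<noteq> j" by blast
    thus "ip d (g' i) (g' j) = 0"
      using 1 g(1) by cases (simp_all add: g'I ip_commute[of d _ "g' k"])
  next
    fix i assume "i \<in> insert k I"
    thus "ip d (g' i) (g' i) \<in> {0, 1}" using 2 g(2)[of i] g'I[of i] by (cases "i = k") simp_all
  next
    fix i m assume i: "i \<in> insert k I" and m: "m < d"
    show "h i m = (\<Sum>j\<in>insert k I. ip d (h i) (g' j) * g' j m)"
      unfolding sum' using i 3[OF m] 4[OF m] by blast
  qed
qed auto

text \<open>The forms given by \<open>h k\<close> see only the projection of \<open>v\<close> to the
  span of the \<open>h k\<close>. Its coefficients are no longer than \<open>v\<close>, and
  conversely short coefficient vectors give short vectors. A supremum over the unit sphere in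
  dimension \<open>d\<close> thus becomes one over a ball in dimension \<open>card I\<close>,
  whatever \<open>d\<close> is.\<close>

lemma reduce_dim:
  fixes h :: "nat \<Rightarrow> nat \<Rightarrow> real"
  assumes I: "finite I"
  obtains g where
    "\<And>c. ip d (\<lambda>m. \<Sum>j\<in>I. c j * g j m) (\<lambda>m. \<Sum>j\<in>I. c j * g j m) \<le> (\<Sum>j\<in>I. (c j)\<^sup>2)"
    "\<And>v. \<exists>c. (\<Sum>j\<in>I. (c j)\<^sup>2) \<le> ip d v v \<and> (\<forall>k\<in>I. ip d (h k) v = ip d (h k) (\<lambda>m. \<Sum>j\<in>I. c j * g j m))"
proof -
  obtain g where g: "\<And>i j. i \<in> I \<Longrightarrow> j \<in> I \<Longrightarrow> i \<noteq> j \<Longrightarrow> ip d (g i) (g j) = 0"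
    "\<And>i. i \<in> I \<Longrightarrow> ip d (g i) (g i) \<in> {0, 1}"
    "\<And>k m. k \<in> I \<Longrightarrow> m < d \<Longrightarrow> h k m = (\<Sum>j\<in>I. ip d (h k) (g j) * g j m)"
    using gram_schmidt[OF I, of d h] by blast
  have nrm: "ip d (\<lambda>m. \<Sum>j\<in>I. c j * g j m) (\<lambda>m. \<Sum>j\<in>I. c j * g j m) = (\<Sum>j\<in>I. (c j)\<^sup>2 * ip d (g j) (g j))" for c
  proof -
    have "ip d (\<lambda>m. \<Sum>j\<in>I. c j * g j m) (\<lambda>m. \<Sum>j\<in>I. c j * g j m) = (\<Sum>i\<in>I. c i * (\<Sum>j\<in>I. c j * ip d (g i) (g j)))"
      unfolding ip_sum_left ip_sum_right ..
    also have "\<dots> = (\<Sum>i\<in>I. c i * (\<Sum>j\<in>I. if j = i then c i * ip d (g i) (g i) else 0))"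
      using g(1) by (intro sum.cong arg_cong2[where f = "(*)"]) auto
    finally show ?thesis using I by (simp add: power2_eq_square mult_ac)
  qed
  have le: "(\<Sum>j\<in>I. (c j)\<^sup>2 * ip d (g j) (g j)) \<le> (\<Sum>j\<in>I. (c j)\<^sup>2)" for c
  proof (rule sum_mono)
    fix j assume "j \<in> I"
    thus "(c j)\<^sup>2 * ip d (g j) (g j) \<le> (c j)\<^sup>2" using g(2)[of j] by auto
  qed
  show ?thesis
  proof (rule that[of g])
    fix c show "ip d (\<lambda>m. \<Sum>j\<in>I. c j * g j m) (\<lambda>m. \<Sum>j\<in>I. c j * g j m) \<le> (\<Sum>j\<in>I. (c j)\<^sup>2)"
      unfolding nrm by (rule le)
  next
    fix v
    define c where "c j = ip d v (g j)" for j
    let ?w = "\<lambda>m. \<Sum>j\<in>I. c j * g j m"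
    have vw: "ip d v ?w = (\<Sum>j\<in>I. (c j)\<^sup>2)"
      unfolding ip_sum_right by (simp add: c_def power2_eq_square)
    \<comment> \<open>Bessel's inequality, from the squared length of the remainder.\<close>
    have "0 \<le> ip d (\<lambda>m. v m - ?w m) (\<lambda>m. v m - ?w m)" by simp
    also have "\<dots> = ip d v v - 2 * ip d v ?w + ip d ?w ?w"
      unfolding ip_diff_left ip_diff_right by (simp add: ip_commute)
    also have "\<dots> \<le> ip d v v - (\<Sum>j\<in>I. (c j)\<^sup>2)"
      using le[of c] unfolding vw nrm by linarith
    finally have "(\<Sum>j\<in>I. (c j)\<^sup>2) \<le> ip d v v" by simp
    moreover have "ip d (h k) v = ip d (h k) ?w" if k: "k \<in> I" for k
    proof -
      have "ip d (h k) v = ip d (\<lambda>m. \<Sum>j\<in>I. ip d (h k) (g j) * g j m) v"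
        using g(3)[OF k] by (intro ip_cong) auto
      also have "\<dots> = ip d (h k) ?w"
        unfolding ip_sum_left ip_sum_right by (simp add: c_def ip_commute mult_ac)
      finally show ?thesis .
    qed
    ultimately show "\<exists>c. (\<Sum>j\<in>I. (c j)\<^sup>2) \<le> ip d v v \<and> (\<forall>k\<in>I. ip d (h k) v = ip d (h k) (\<lambda>m. \<Sum>j\<in>I. c j * g j m))"
      by blast
  qed
qed

section \<open>Perturbation of the pseudoinverse\<close>

lemma mvec_spectral_comp:
  assumes "orthogonal_mat n Q"
  shows "mvec n (spectral n Q f) (mvec n (spectral n Q g) x) = mvec n (spectral n Q (\<lambda>k. f k * g k)) x"
  by (simp add: mvec_mmul[symmetric] mmul_spectral[OF assms])

lemma ip_mvec_spectral: "ip n (mvec n (spectral n Q f) x) y = ip n x (mvec n (spectral n Q f) y)"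
  by (rule ip_mvec_sym) (rule spectral_sym)

lemma vnorm_le_of_ip:
  assumes "\<And>v. v \<in> unit_vecs n \<Longrightarrow> \<bar>ip n v x\<bar> \<le> b" "0 \<le> b"
  shows "vnorm n x \<le> b"
proof (cases rule: vnorm_cases[of n x])
  case 2
  have "ip n (\<lambda>i. x i / vnorm n x) x = vnorm n x"
    using ip_scale_left[of n "1 / vnorm n x" x x] 2(1) by (simp add: vnorm_sq[symmetric] power2_eq_square)
  thus ?thesis using assms(1)[OF 2(2)] by simp
qed (use assms in auto)

text \<open>Here \<open>S = spectral n Q l\<close>, and \<open>S'\<close> and \<open>R'\<close> stand for its pseudoinverse and the square root of
  the latter. That \<open>T\<close> and \<open>S\<close> have the same range follows from \<open>T \<ge> S / 2\<close> and the inclusion of the range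
  of \<open>T\<close> in that of \<open>S\<close>.\<close>

lemma pinv_perturbation:
  fixes l :: "nat \<Rightarrow> real"
  assumes Q: "orthogonal_mat n Q" and l: "\<And>k. k < n \<Longrightarrow> 0 \<le> l k"
    and T: "padded n T" "\<And>i j. i < n \<Longrightarrow> j < n \<Longrightarrow> T i j = T j i"
  defines "sp \<equiv> \<lambda>f. mvec n (spectral n Q f)"
  defines "E \<equiv> \<lambda>x i. mvec n T x i - sp l x i"
    and "S' \<equiv> sp (\<lambda>k. inverse (l k))" and "R' \<equiv> sp (\<lambda>k. sqrt (inverse (l k)))"
  assumes range: "\<And>x. sp (\<lambda>k. of_bool (l k \<noteq> 0)) (mvec n T x) = mvec n T x"
    and half: "\<And>z. \<bar>ip n (R' z) (E (R' z))\<bar> \<le> 1 / 2 * ip n z z"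
  shows "\<bar>ip n a (\<lambda>i. mvec n (pinv n n T) b i - S' b i)\<bar>
    \<le> \<bar>ip n (S' a) (E (S' b))\<bar> + 2 * vnorm n (R' (E (S' a))) * vnorm n (R' (E (S' b)))"
proof -
  obtain V t where V: "orthogonal_mat n V" and TV: "T = spectral n V t"
    using spectral_theorem[of n T] T by metis
  define g where "g = mvec n (pinv n n T)"
  define tt where "tt = mvec n T"
  define P where "P = sp (\<lambda>k. of_bool (l k \<noteq> 0))"
  define R where "R = sp (\<lambda>k. sqrt (l k))"
  have gV: "g = mvec n (spectral n V (\<lambda>k. inverse (t k)))"
    unfolding g_def TV pinv_spectral[OF V] ..
  have ttV: "tt = mvec n (spectral n V t)" unfolding tt_def TV ..
  have gt: "g (tt x) = tt (g x)" for x unfolding gV ttV mvec_spectral_comp[OF V] by (simp add: mult.commute)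
  have inv: "(x :: real) * (inverse x * x) = x" "inverse x * (x * inverse x) = inverse x" for x
    by (cases "x = 0"; simp)+
  have tgt: "tt (g (tt x)) = tt x" for x unfolding gV ttV mvec_spectral_comp[OF V] inv ..
  have gtg: "g (tt (g x)) = g x" for x unfolding gV ttV mvec_spectral_comp[OF V] inv ..
  have tip: "ip n (tt x) y = ip n x (tt y)" "ip n (g x) y = ip n x (g y)" for x y
    unfolding gV ttV by (rule ip_mvec_spectral)+
  have spip: "ip n (sp f x) y = ip n x (sp f y)" for f x y unfolding sp_def by (rule ip_mvec_spectral)
  have spc: "sp f (sp h x) = sp (\<lambda>k. f k * h k) x" for f h x
    unfolding sp_def by (rule mvec_spectral_comp[OF Q])
  have spcong: "(\<And>k. k < n \<Longrightarrow> f k = h k) \<Longrightarrow> sp f = sp h" for f h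
    unfolding sp_def by (metis spectral_cong)
  have Pt: "P (tt x) = tt x" for x using range by (simp add: P_def tt_def)
  have SS': "sp l (S' x) = P x" for x unfolding S'_def P_def spc by (rule fun_cong[OF spcong]) auto
  have S'P: "S' (P x) = S' x" "P (S' x) = S' x" for x
    unfolding S'_def P_def spc by (rule fun_cong[OF spcong]; auto)+
  have PP: "P (P x) = P x" for x unfolding P_def spc by (rule fun_cong[OF spcong]) auto
  have RR: "R (R x) = sp l x" for x unfolding R_def spc using l by (intro fun_cong[OF spcong]) auto
  have sqi: "sqrt y * sqrt (inverse y) = of_bool (y \<noteq> 0)" for y :: real
    by (simp flip: real_sqrt_mult)
  have R'R: "R' (R x) = P x" for x unfolding R_def R'_def P_def spc using sqi
    by (intro fun_cong[OF spcong]) (simp add: mult.commute)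
  have ttd: "tt (\<lambda>i. x i - y i) = (\<lambda>i. tt x i - tt y i)" "g (\<lambda>i. x i - y i) = (\<lambda>i. g x i - g y i)" for x y
    unfolding tt_def g_def by (rule mvec_diff)+
  have spd: "sp f (\<lambda>i. x i - y i) = (\<lambda>i. sp f x i - sp f y i)" for f x y
    unfolding sp_def by (rule mvec_diff)
  have E: "E x = (\<lambda>i. tt x i - sp l x i)" for x unfolding E_def tt_def ..
  \<comment> \<open>On the range of \<open>S\<close> every \<open>z\<close> is
    \<open>R' (R z)\<close>, and \<open>half\<close> at \<open>R z\<close> bounds the form of
    \<open>E\<close> by half the form of \<open>S\<close>; this is
    \<open>T \<ge> S / 2\<close>.\<close>
  have lower: "ip n z (sp l z) \<le> 2 * ip n z (tt z)" if "P z = z" for z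
  proof -
    have "R' (R z) = z" using R'R that by simp
    hence "\<bar>ip n z (E z)\<bar> \<le> 1 / 2 * ip n (R z) (R z)" using half[of "R z"] by simp
    also have "ip n (R z) (R z) = ip n z (sp l z)" using RR[of z] spip unfolding R_def by metis
    also have "ip n z (E z) = ip n z (tt z) - ip n z (sp l z)" unfolding E ip_diff_right ..
    finally show ?thesis by linarith
  qed
  \<comment> \<open>The difference \<open>?x\<close> lies in the range of \<open>S\<close>. It is
    annihilated by \<open>T\<close>, because \<open>P T = T\<close> transposes to
    \<open>T T\<^sup>\<dagger> P = T T\<^sup>\<dagger>\<close>. Then \<open>lower\<close> forces
    \<open>R ?x\<close> to vanish, and with it \<open>?x\<close>.\<close>
  have tg: "tt (g y) = P y" for y
  proof -
    let ?x = "\<lambda>i. P y i - tt (g y) i"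
    have Px: "P ?x = ?x" unfolding P_def spd unfolding P_def[symmetric] PP Pt ..
    have tx: "tt ?x = (\<lambda>_. 0)"
    proof -
      have "tt (g (P z)) = tt (g z)" for z
      proof -
        have "ip n (tt (g (P z))) w = ip n (tt (g z)) w" for w
        proof -
          have "ip n (tt (g (P z))) w = ip n z (P (g (tt w)))"
            unfolding tip P_def spip ..
          also have "\<dots> = ip n z (g (tt w))" using Pt gt by metis
          also have "\<dots> = ip n (tt (g z)) w" unfolding tip ..
          finally show ?thesis .
        qed
        hence "ip n (\<lambda>i. tt (g (P z)) i - tt (g z) i) (\<lambda>i. tt (g (P z)) i - tt (g z) i) = 0"
          unfolding ip_diff_left by simp
        hence "vnorm n (\<lambda>i. tt (g (P z)) i - tt (g z) i) = 0" by (simp add: vnorm_ip)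
        hence "tt (g (P z)) i = tt (g z) i" for i
          using vnorm_eq_0[of n "\<lambda>i. tt (g (P z)) i - tt (g z) i" i] mvec_padded[OF T(1)]
          by (cases "i < n") (auto simp: tt_def)
        thus ?thesis by blast
      qed
      hence "tt (tt (g (P y))) = tt (tt (g y))" by simp
      moreover have "tt (tt (g z)) = tt z" for z using tgt gt by metis
      ultimately show ?thesis unfolding ttd by auto
    qed
    have "ip n ?x (sp l ?x) \<le> 2 * ip n ?x (tt ?x)" using lower[OF Px] .
    also have "\<dots> = 0" unfolding tx by (simp add: ip_def)
    also have "ip n ?x (sp l ?x) = ip n (R ?x) (R ?x)" using RR[of ?x] spip unfolding R_def by metis
    finally have "vnorm n (R ?x) = 0" by (simp add: vnorm_ip antisym)
    hence "R' (R ?x) = R' (\<lambda>_. 0)" unfolding R'_def sp_def using vnorm_eq_0 by (intro mvec_cong) blast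
    also have "\<dots> = (\<lambda>_. 0)" unfolding R'_def sp_def mvec_def by simp
    finally have "?x = (\<lambda>_. 0)" unfolding R'R Px .
    thus ?thesis by (simp add: fun_eq_iff)
  qed
  have gT: "g (tt y) = P y" for y using tg gt by simp
  have Pg: "P (g x) = g x" for x using gtg gT by metis
  have gP: "g (P x) = g x" for x using gtg tg by metis
  \<comment> \<open>This is \<open>T\<^sup>\<dagger> \<le> 2 S\<^sup>\<dagger>\<close>. Inversion
    reverses the order by Cauchy-Schwarz: the form at \<open>x\<close> is \<open>R' x\<close>
    against \<open>R (g x)\<close>, and the squared length of the latter is at most twice that
    form.\<close>
  have quad: "ip n x (g x) \<le> 2 * (vnorm n (R' x))\<^sup>2" and
    Rg: "(vnorm n (R (g x)))\<^sup>2 \<le> 2 * ip n x (g x)" for x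
  proof -
    have "(vnorm n (R (g x)))\<^sup>2 = ip n (g x) (sp l (g x))"
      using RR[of "g x"] spip unfolding vnorm_sq R_def by metis
    also have "\<dots> \<le> 2 * ip n (g x) (tt (g x))" by (rule lower[OF Pg])
    also have "ip n (g x) (tt (g x)) = ip n x (g x)" unfolding tip gtg ..
    finally show b: "(vnorm n (R (g x)))\<^sup>2 \<le> 2 * ip n x (g x)" .
    have "ip n x (g x) = ip n x (R' (R (g x)))" unfolding R'R Pg ..
    also have "\<dots> = ip n (R' x) (R (g x))" unfolding R'_def spip ..
    also have "\<dots> \<le> vnorm n (R' x) * vnorm n (R (g x))" using abs_ip_le abs_le_D1 by blast
    finally have c: "ip n x (g x) \<le> vnorm n (R' x) * vnorm n (R (g x))" .
    let ?r = "vnorm n (R' x)" and ?s = "vnorm n (R (g x))"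
    have "?s * ?s \<le> (2 * ?r) * ?s" using b c by (simp add: power2_eq_square)
    hence "?s \<le> 2 * ?r" by (cases "?s = 0") (auto simp: mult_le_cancel_right less_le)
    hence "?r * ?s \<le> ?r * (2 * ?r)" by (intro mult_left_mono) auto
    thus "ip n x (g x) \<le> 2 * ?r\<^sup>2" using c by (simp add: power2_eq_square)
  qed
  have cross: "\<bar>ip n y (g x)\<bar> \<le> 2 * vnorm n (R' y) * vnorm n (R' x)" for x y
  proof -
    have "(vnorm n (R (g x)))\<^sup>2 \<le> (2 * vnorm n (R' x))\<^sup>2"
      using Rg[of x] quad[of x] by (simp add: power_mult_distrib)
    hence s: "vnorm n (R (g x)) \<le> 2 * vnorm n (R' x)" by (rule power2_le_imp_le) simp
    have "ip n y (g x) = ip n y (R' (R (g x)))" unfolding R'R Pg ..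
    also have "\<dots> = ip n (R' y) (R (g x))" unfolding R'_def spip ..
    finally have "\<bar>ip n y (g x)\<bar> \<le> vnorm n (R' y) * vnorm n (R (g x))" using abs_ip_le by simp
    also have "\<dots> \<le> vnorm n (R' y) * (2 * vnorm n (R' x))" using s by (intro mult_left_mono) auto
    finally show ?thesis by simp
  qed
  have ES: "E (S' x) = (\<lambda>i. tt (S' x) i - P x i)" for x unfolding E SS' ..
  have gE: "g (E (S' b)) = (\<lambda>i. S' b i - g b i)" unfolding ES ttd gT S'P gP ..
  have Eip: "ip n (E (S' a)) y = ip n (S' a) (E y)" for y
    unfolding E ip_diff_left ip_diff_right tip spip ..
  \<comment> \<open>The identity is verified as one between bilinear forms, using
    \<open>E S\<^sup>\<dagger> = T S\<^sup>\<dagger> - P\<close> on the left and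
    \<open>T\<^sup>\<dagger> E S\<^sup>\<dagger> = S\<^sup>\<dagger> - T\<^sup>\<dagger>\<close> on
    the right.\<close>
  have "ip n (E (S' a)) (g (E (S' b))) = ip n (E (S' a)) (S' b) - ip n (E (S' a)) (g b)"
    unfolding gE ip_diff_right ..
  also have "ip n (E (S' a)) (g b) = ip n (S' a) (tt (g b)) - ip n (P a) (g b)"
    unfolding ES ip_diff_left tip ..
  also have "ip n (S' a) (tt (g b)) = ip n a (S' b)"
    unfolding tg using S'P(1)[of b] spip unfolding S'_def by metis
  also have "ip n (P a) (g b) = ip n a (g b)" using Pg[of b] spip unfolding P_def by metis
  also have "ip n (E (S' a)) (S' b) = ip n (S' a) (E (S' b))" by (rule Eip)
  finally have "ip n a (\<lambda>i. g b i - S' b i) = ip n (E (S' a)) (g (E (S' b))) - ip n (S' a) (E (S' b))"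
    unfolding ip_diff_right by simp
  thus ?thesis using cross[of "E (S' a)" "E (S' b)"] unfolding g_def[symmetric] by linarith
qed

section \<open>A net of the unit ball\<close>

text \<open>Each point gets the weight 2 to the power \<open>L\<close> minus its l1 norm, which is
  at least 1. The total weight factorises over the coordinates, and each factor is a two-sided
  geometric sum, at most 3.\<close>

lemma card_int_l1_ball:
  assumes "finite I"
  shows "finite {z \<in> I \<rightarrow>\<^sub>E {- int L..int L}. (\<Sum>i\<in>I. \<bar>z i\<bar>) \<le> int L}" (is "finite ?Z")
    and "real (card {z \<in> I \<rightarrow>\<^sub>E {- int L..int L}. (\<Sum>i\<in>I. \<bar>z i\<bar>) \<le> int L}) \<le> 2 ^ L * 3 ^ card I"
proof -
  have fin: "finite (I \<rightarrow>\<^sub>E {- int L..int L})" using assms by (intro finite_PiE) auto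
  thus "finite ?Z" by simp
  let ?w = "\<lambda>m :: int. (1/2 :: real) ^ nat \<bar>m\<bar>"
  have geo: "(\<Sum>m\<in>{- int L..int L}. ?w m) \<le> 3"
  proof -
    have "{- int L..int L} = {0} \<union> (int ` {1..L} \<union> (\<lambda>k. - int k) ` {1..L})"
    proof (intro equalityI subsetI)
      fix x assume "x \<in> {- int L..int L}"
      thus "x \<in> {0} \<union> (int ` {1..L} \<union> (\<lambda>k. - int k) ` {1..L})"
        by (cases x) (auto simp: image_iff Bex_def intro: exI[of _ "nat \<bar>x\<bar>"])
    qed auto
    hence "(\<Sum>m\<in>{- int L..int L}. ?w m) = 1 + ((\<Sum>m\<in>int ` {1..L}. ?w m) + (\<Sum>m\<in>(\<lambda>k. - int k) ` {1..L}. ?w m))"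
      by (simp add: image_iff, subst sum.union_disjoint) auto
    also have "\<dots> = 1 + 2 * (\<Sum>k=1..L. (1/2) ^ k)"
      by (simp add: sum.reindex inj_on_def)
    also have "(\<Sum>k=1..L. (1/2 :: real) ^ k) = 1 - (1/2) ^ L" by (induction L) auto
    finally show ?thesis by simp
  qed
  have "real (card ?Z) = (\<Sum>z\<in>?Z. 1)" by simp
  also have "\<dots> \<le> (\<Sum>z\<in>?Z. 2 ^ L * (\<Prod>i\<in>I. ?w (z i)))"
  proof (rule sum_mono)
    fix z assume z: "z \<in> ?Z"
    have "(\<Sum>i\<in>I. nat \<bar>z i\<bar>) \<le> L"
    proof -
      have "int (\<Sum>i\<in>I. nat \<bar>z i\<bar>) \<le> int L" using z by simp
      thus ?thesis by (simp only: of_nat_le_iff)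
    qed
    hence "(1/2 :: real) ^ L \<le> (1/2) ^ (\<Sum>i\<in>I. nat \<bar>z i\<bar>)" by (intro power_decreasing) auto
    also have "\<dots> = (\<Prod>i\<in>I. ?w (z i))" by (rule power_sum)
    finally show "1 \<le> 2 ^ L * (\<Prod>i\<in>I. ?w (z i))" by (simp add: power_divide field_simps)
  qed
  also have "\<dots> \<le> (\<Sum>z\<in>I \<rightarrow>\<^sub>E {- int L..int L}. 2 ^ L * (\<Prod>i\<in>I. ?w (z i)))"
    using fin by (intro sum_mono2) (auto intro!: mult_nonneg_nonneg prod_nonneg zero_le_power)
  also have "\<dots> = 2 ^ L * (\<Prod>i\<in>I. \<Sum>m\<in>{- int L..int L}. ?w m)"
    using assms by (subst prod_sum_PiE) (auto simp: sum_distrib_left)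
  also have "\<dots> \<le> 2 ^ L * 3 ^ card I"
    using geo by (simp add: power_mono sum_nonneg)
  finally show "real (card ?Z) \<le> 2 ^ L * 3 ^ card I" .
qed

text \<open>The net consists of the points of a cubic grid of mesh \<open>1 / (4 * sqrt (card I))\<close>;
  truncating the coordinates towards zero keeps a point inside the ball.\<close>

lemma ball_net:
  fixes I :: "'i set"
  assumes I: "finite I" "I \<noteq> {}"
  obtains Net :: "('i \<Rightarrow> real) set" where "finite Net" "real (card Net) \<le> 2 ^ (18 * card I)"
    "\<And>c. c \<in> Net \<Longrightarrow> (\<Sum>i\<in>I. (c i)\<^sup>2) \<le> 1"
    "\<And>c. (\<Sum>i\<in>I. (c i)\<^sup>2) \<le> 1 \<Longrightarrow> \<exists>c'\<in>Net. (\<Sum>i\<in>I. (c i - c' i)\<^sup>2) \<le> 1 / 16"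
proof -
  define R where "R = card I"
  have R: "R > 0" using I by (simp add: R_def card_gt_0_iff)
  define s where "s = 4 * sqrt (real R)"
  have s: "s > 0" "s\<^sup>2 = 16 * real R" using R by (auto simp: s_def power_mult_distrib)
  \<comment> \<open>The radius is \<open>16 * R\<close>: for integers |z| \<le> z^2, so the l1 norm
    of a scaled point is at most its sum of squares, hence at most \<open>s\<^sup>2\<close>. With 3
    \<le> 2^2 the count becomes \<open>2 ^ (16 * R + 2 * R)\<close>.\<close>
  define Z where "Z = {z \<in> I \<rightarrow>\<^sub>E {- int (16 * R)..int (16 * R)}. (\<Sum>i\<in>I. \<bar>z i\<bar>) \<le> int (16 * R)}"
  define emb where "emb z = (\<lambda>i. real_of_int (z i) / s)" for z :: "'i \<Rightarrow> int"
  define Net where "Net = emb ` Z \<inter> {c. (\<Sum>i\<in>I. (c i)\<^sup>2) \<le> 1}"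
  note Zc = card_int_l1_ball[OF I(1), of "16 * R", folded Z_def R_def]
  have "finite Net" using Zc(1) by (simp add: Net_def)
  moreover have "real (card Net) \<le> 2 ^ (18 * R)"
  proof -
    have "card Net \<le> card Z" unfolding Net_def
      by (rule order_trans[OF card_mono card_image_le]) (use Zc(1) in auto)
    hence "real (card Net) \<le> real (card Z)" by simp
    also have "\<dots> \<le> 2 ^ (16 * R) * 3 ^ R" by (rule Zc(2))
    also have "\<dots> \<le> 2 ^ (16 * R) * 4 ^ R" by (intro mult_left_mono power_mono) auto
    also have "(4 :: real) ^ R = 2 ^ (2 * R)" by (simp add: power_mult)
    also have "(2 :: real) ^ (16 * R) * 2 ^ (2 * R) = 2 ^ (18 * R)" by (simp flip: power_add)
    finally show ?thesis .
  qed
  moreover have "(\<Sum>i\<in>I. (c i)\<^sup>2) \<le> 1" if "c \<in> Net" for c using that by (simp add: Net_def)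
  moreover have "\<exists>c'\<in>Net. (\<Sum>i\<in>I. (c i - c' i)\<^sup>2) \<le> 1 / 16" if c: "(\<Sum>i\<in>I. (c i)\<^sup>2) \<le> 1" for c
  proof -
    define z where "z = (\<lambda>i\<in>I. if c i \<ge> 0 then \<lfloor>s * c i\<rfloor> else - \<lfloor>s * (- c i)\<rfloor>)"
    have z1: "\<bar>real_of_int (z i)\<bar> \<le> s * \<bar>c i\<bar>" and z2: "\<bar>s * c i - real_of_int (z i)\<bar> \<le> 1" if "i \<in> I" for i
    proof -
      let ?m = "real_of_int \<lfloor>s * \<bar>c i\<bar>\<rfloor>"
      have m: "0 \<le> ?m" "?m \<le> s * \<bar>c i\<bar>" "s * \<bar>c i\<bar> \<le> ?m + 1" using s by simp_all
      have "(c i \<ge> 0 \<and> real_of_int (z i) = ?m \<and> s * c i = s * \<bar>c i\<bar>) \<or>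
            (c i < 0 \<and> real_of_int (z i) = - ?m \<and> s * c i = - (s * \<bar>c i\<bar>))"
        using that by (auto simp: z_def)
      thus "\<bar>real_of_int (z i)\<bar> \<le> s * \<bar>c i\<bar>" "\<bar>s * c i - real_of_int (z i)\<bar> \<le> 1"
        using m by linarith+
    qed
    have sq: "(real_of_int (z i))\<^sup>2 \<le> 16 * real R * (c i)\<^sup>2" if "i \<in> I" for i
      using power_mono[OF z1[OF that], of 2] s by (simp add: power_mult_distrib)
    have "(\<Sum>i\<in>I. (real_of_int (z i))\<^sup>2) \<le> (\<Sum>i\<in>I. 16 * real R * (c i)\<^sup>2)"
      using sq by (rule sum_mono)
    also have "\<dots> \<le> 16 * real R" using c R by (simp flip: sum_distrib_left)
    finally have S: "(\<Sum>i\<in>I. (real_of_int (z i))\<^sup>2) \<le> 16 * real R" .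
    have "real_of_int (\<Sum>i\<in>I. \<bar>z i\<bar>) \<le> real_of_int (\<Sum>i\<in>I. (z i)\<^sup>2)"
    proof (unfold of_int_le_iff, rule sum_mono)
      fix i show "\<bar>z i\<bar> \<le> (z i)\<^sup>2"
        using mult_left_mono[of 1 "\<bar>z i\<bar>" "\<bar>z i\<bar>"] by (cases "z i = 0") (auto simp: power2_eq_square)
    qed
    also have "\<dots> \<le> real_of_int (int (16 * R))" using S by simp
    finally have l1: "(\<Sum>i\<in>I. \<bar>z i\<bar>) \<le> int (16 * R)" by linarith
    have "\<bar>z i\<bar> \<le> int (16 * R)" if "i \<in> I" for i
      using member_le_sum[of i I "\<lambda>i. \<bar>z i\<bar>"] that I l1 by auto
    hence "z \<in> Z" using l1 by (auto simp: Z_def z_def abs_le_iff minus_le_iff)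
    moreover have "(\<Sum>i\<in>I. (emb z i)\<^sup>2) \<le> 1"
      using S s R by (simp add: emb_def power_divide flip: sum_divide_distrib)
    ultimately have "emb z \<in> Net" by (simp add: Net_def)
    moreover have "(\<Sum>i\<in>I. (c i - emb z i)\<^sup>2) \<le> 1 / 16"
    proof -
      have "(c i - emb z i)\<^sup>2 \<le> 1 / (16 * real R)" if "i \<in> I" for i
      proof -
        have "(c i - emb z i)\<^sup>2 = (s * c i - real_of_int (z i))\<^sup>2 / s\<^sup>2"
          using s(1) by (simp add: emb_def field_simps power2_eq_square)
        also have "\<dots> \<le> 1 / s\<^sup>2" using z2[OF that] by (intro divide_right_mono) (auto simp: abs_square_le_1)
        finally show ?thesis using s by simp
      qed
      hence "(\<Sum>i\<in>I. (c i - emb z i)\<^sup>2) \<le> (\<Sum>i\<in>I. 1 / (16 * real R))" by (rule sum_mono)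
      thus ?thesis using R by (simp add: R_def)
    qed
    ultimately show ?thesis by blast
  qed
  ultimately show ?thesis using that by (simp add: R_def)
qed

text \<open>The error of a net point has length at most 1/4, so four times the error is again in the
  ball. Replacing both arguments costs two quarters of the supremum, which is absorbed on the left.
  This needs the supremum to be finite, so boundedness comes first.\<close>

lemma bilinear_net_bound:
  fixes f :: "'i \<Rightarrow> 'i \<Rightarrow> real"
  assumes I: "finite I"
  defines "F \<equiv> \<lambda>c d. \<Sum>i\<in>I. \<Sum>j\<in>I. c i * d j * f i j"
  assumes net: "\<And>c. c \<in> Net \<Longrightarrow> (\<Sum>i\<in>I. (c i)\<^sup>2) \<le> 1"
    "\<And>c. (\<Sum>i\<in>I. (c i)\<^sup>2) \<le> 1 \<Longrightarrow> \<exists>c'\<in>Net. (\<Sum>i\<in>I. (c i - c' i)\<^sup>2) \<le> 1 / 16"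
    and B: "\<And>c d. c \<in> Net \<Longrightarrow> d \<in> Net \<Longrightarrow> \<bar>F c d\<bar> \<le> B"
    and c: "(\<Sum>i\<in>I. (c i)\<^sup>2) \<le> 1" and d: "(\<Sum>i\<in>I. (d i)\<^sup>2) \<le> 1"
  shows "\<bar>F c d\<bar> \<le> 2 * B"
proof -
  define ball where "ball = {c :: 'i \<Rightarrow> real. (\<Sum>i\<in>I. (c i)\<^sup>2) \<le> 1}"
  let ?X = "(\<lambda>(c, d). \<bar>F c d\<bar>) ` (ball \<times> ball)"
  have le1: "\<bar>c i\<bar> \<le> 1" if "c \<in> ball" "i \<in> I" for c i
  proof -
    have "(c i)\<^sup>2 \<le> (\<Sum>i\<in>I. (c i)\<^sup>2)" using that I by (intro member_le_sum) auto
    also have "\<dots> \<le> 1" using that by (simp add: ball_def)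
    finally show ?thesis by (simp add: abs_square_le_1)
  qed
  have "\<bar>F c d\<bar> \<le> (\<Sum>i\<in>I. \<Sum>j\<in>I. \<bar>f i j\<bar>)" if "c \<in> ball" "d \<in> ball" for c d
  proof -
    have "\<bar>c i * d j * f i j\<bar> \<le> \<bar>f i j\<bar>" if "i \<in> I" "j \<in> I" for i j
      using mult_mono[OF le1[OF \<open>c \<in> ball\<close> that(1)] le1[OF \<open>d \<in> ball\<close> that(2)]]
      by (simp add: abs_mult mult_left_le_one_le)
    thus ?thesis unfolding F_def
      by (intro order_trans[OF sum_abs] sum_mono) (auto intro: order_trans[OF sum_abs] sum_mono)
  qed
  hence bdd: "bdd_above ?X" by (intro bdd_aboveI) auto
  have zero: "(\<lambda>_. 0) \<in> ball" by (simp add: ball_def)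
  have Fsub: "F (\<lambda>i. c i - c' i) d = F c d - F c' d" "F c (\<lambda>i. d i - d' i) = F c d - F c d'" for c c' d d'
    unfolding F_def by (simp_all add: algebra_simps sum_subtractf)
  have Fscale: "F (\<lambda>i. 4 * c i) d = 4 * F c d" "F c (\<lambda>i. 4 * d i) = 4 * F c d" for c d
    unfolding F_def by (simp_all add: sum_distrib_left mult_ac)
  have scale: "(\<lambda>i. 4 * (c i - c' i)) \<in> ball" if "(\<Sum>i\<in>I. (c i - c' i)\<^sup>2) \<le> 1 / 16" for c c'
  proof -
    have "(\<Sum>i\<in>I. (4 * (c i - c' i))\<^sup>2) = 16 * (\<Sum>i\<in>I. (c i - c' i)\<^sup>2)"
      unfolding sum_distrib_left by (intro sum.cong) (simp_all only: power_mult_distrib, simp_all)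
    thus ?thesis using that by (simp add: ball_def)
  qed
  have up: "\<bar>F c d\<bar> \<le> Sup ?X" if "c \<in> ball" "d \<in> ball" for c d
    using that by (intro cSup_upper bdd) auto
  have "\<bar>F c d\<bar> \<le> B + Sup ?X / 2" if cd: "c \<in> ball" "d \<in> ball" for c d
  proof -
    obtain c' where c': "c' \<in> Net" "(\<Sum>i\<in>I. (c i - c' i)\<^sup>2) \<le> 1 / 16" using net(2) cd by (auto simp: ball_def)
    obtain d' where d': "d' \<in> Net" "(\<Sum>i\<in>I. (d i - d' i)\<^sup>2) \<le> 1 / 16" using net(2) cd by (auto simp: ball_def)
    have c'b: "c' \<in> ball" using net(1) c' by (simp add: ball_def)
    have tri: "\<bar>x\<bar> \<le> B + S / 2" if "4 * \<bar>x - y\<bar> \<le> S" "4 * \<bar>y - z\<bar> \<le> S" "\<bar>z\<bar> \<le> B" for x y z S :: real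
      using that by (smt (verit) field_sum_of_halves)
    have "4 * \<bar>F c d - F c' d\<bar> \<le> Sup ?X"
      using up[OF scale[OF c'(2)] cd(2)] unfolding Fscale Fsub by linarith
    moreover have "4 * \<bar>F c' d - F c' d'\<bar> \<le> Sup ?X"
      using up[OF c'b scale[OF d'(2)]] unfolding Fscale Fsub by linarith
    moreover have "\<bar>F c' d'\<bar> \<le> B" using B c' d' by blast
    ultimately show ?thesis by (rule tri)
  qed
  hence "Sup ?X \<le> B + Sup ?X / 2" using zero by (intro cSup_least) auto
  moreover have "\<bar>F c d\<bar> \<le> Sup ?X" using up c d by (simp add: ball_def)
  ultimately show ?thesis by linarith
qed

section \<open>Sub-Gaussian variables and deviation of sample means\<close>

lemma exp_le_quadratic:
  fixes w l :: real
  assumes "\<bar>l\<bar> \<le> 1 / 2"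
  shows "exp (l * w) \<le> 1 + l * w + 4 * l\<^sup>2 * exp \<bar>w\<bar>"
proof -
  obtain t where t: "\<bar>t\<bar> \<le> \<bar>l * w\<bar>" "exp (l * w) = (\<Sum>m<2. (l * w) ^ m / fact m) + exp t / fact 2 * (l * w) ^ 2"
    using Maclaurin_exp_le[of "l * w" 2] by blast
  have "\<bar>l * w\<bar> \<le> \<bar>w\<bar> / 2" using mult_right_mono[OF assms, of "\<bar>w\<bar>"] by (simp add: abs_mult)
  hence e: "exp t \<le> exp (\<bar>w\<bar> / 2)" using t(1) by simp
  have "w\<^sup>2 \<le> 8 * exp (\<bar>w\<bar> / 2)"
    using exp_lower_Taylor_quadratic[of "\<bar>w\<bar> / 2"] by (simp add: power_divide)
  hence "exp t * w\<^sup>2 \<le> exp (\<bar>w\<bar> / 2) * (8 * exp (\<bar>w\<bar> / 2))" using e by (intro mult_mono) auto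
  also have "\<dots> = 8 * exp \<bar>w\<bar>" by (simp flip: exp_add)
  finally have "l\<^sup>2 / 2 * (exp t * w\<^sup>2) \<le> l\<^sup>2 / 2 * (8 * exp \<bar>w\<bar>)" by (intro mult_left_mono) auto
  thus ?thesis using t(2) by (simp add: numeral_2_eq_2 power_mult_distrib mult_ac)
qed

context prob_space
begin

lemma exp_moment_integrable:
  assumes [measurable]: "W \<in> borel_measurable M" and W: "(\<integral>\<^sup>+x. ennreal (exp \<bar>W x\<bar>) \<partial>M) \<le> 2"
  shows "integrable M (\<lambda>x. exp \<bar>W x\<bar>)" "integrable M W" "(\<integral>x. exp \<bar>W x\<bar> \<partial>M) \<le> 2"
proof -
  show i: "integrable M (\<lambda>x. exp \<bar>W x\<bar>)"
    by (rule integrableI_bounded) (use W in \<open>auto intro: le_less_trans\<close>)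
  show "integrable M W"
  proof (rule Bochner_Integration.integrable_bound[OF i])
    have "\<bar>W x\<bar> \<le> exp \<bar>W x\<bar>" for x using exp_ge_add_one_self[of "\<bar>W x\<bar>"] by linarith
    thus "AE x in M. norm (W x) \<le> norm (exp \<bar>W x\<bar>)" by simp
  qed simp
  have "ennreal (\<integral>x. exp \<bar>W x\<bar> \<partial>M) \<le> ennreal 2" using W nn_integral_eq_integral[OF i] by simp
  thus "(\<integral>x. exp \<bar>W x\<bar> \<partial>M) \<le> 2" by (subst (asm) ennreal_le_iff) auto
qed

text \<open>The 8 is 4 times the bound 2 of the exponential moment; 1 + x \<le> e^x produces the
  linear term that the centring cancels.\<close>

lemma centered_mgf:
  assumes [measurable]: "W \<in> borel_measurable M" and W: "(\<integral>\<^sup>+x. ennreal (exp \<bar>W x\<bar>) \<partial>M) \<le> 2"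
    and l: "\<bar>l\<bar> \<le> 1 / 2"
  shows "(\<integral>\<^sup>+x. ennreal (exp (l * (W x - expectation W))) \<partial>M) \<le> ennreal (exp (8 * l\<^sup>2))"
proof -
  note i = exp_moment_integrable[OF assms(1,2)]
  let ?e = "expectation W"
  let ?h = "\<lambda>x. exp (- l * ?e) * (1 + l * W x + 4 * l\<^sup>2 * exp \<bar>W x\<bar>)"
  have h: "exp (l * (W x - ?e)) \<le> ?h x" for x
    using mult_left_mono[OF exp_le_quadratic[OF l, of "W x"], of "exp (- l * ?e)"]
    by (simp add: right_diff_distrib exp_diff exp_minus field_simps)
  have "(\<integral>\<^sup>+x. ennreal (exp (l * (W x - ?e))) \<partial>M) \<le> (\<integral>\<^sup>+x. ennreal (?h x) \<partial>M)"
    using h by (intro nn_integral_mono ennreal_leI)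
  also have "\<dots> = ennreal (\<integral>x. ?h x \<partial>M)"
    using i h by (intro nn_integral_eq_integral AE_I2 order_trans[OF exp_ge_zero h]) auto
  also have "(\<integral>x. ?h x \<partial>M) = exp (- l * ?e) * (1 + l * ?e + 4 * l\<^sup>2 * (\<integral>x. exp \<bar>W x\<bar> \<partial>M))"
    using i by (simp add: prob_space)
  also have "\<dots> \<le> exp (- l * ?e) * exp (l * ?e + 8 * l\<^sup>2)"
  proof (intro mult_left_mono)
    have "4 * l\<^sup>2 * (\<integral>x. exp \<bar>W x\<bar> \<partial>M) \<le> 4 * l\<^sup>2 * 2" using i(3) by (intro mult_left_mono) auto
    thus "1 + l * ?e + 4 * l\<^sup>2 * (\<integral>x. exp \<bar>W x\<bar> \<partial>M) \<le> exp (l * ?e + 8 * l\<^sup>2)"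
      using exp_ge_add_one_self[of "l * ?e + 8 * l\<^sup>2"] by linarith
  qed simp
  also have "\<dots> = exp (8 * l\<^sup>2)" by (simp flip: exp_add)
  finally show ?thesis by (simp add: ennreal_leI)
qed

text \<open>Chernoff's bound with parameter \<open>e / 2\<close>, admissible since
  \<open>e \<le> 1\<close>: the exponent is \<open>real N * e\<^sup>2\<close> times
  \<open>- K / 2 + 8 / 4\<close>. The factor \<open>K\<close> is free and is later chosen to beat
  the size of the net.\<close>

lemma sum_upper_tail:
  assumes [measurable]: "W \<in> borel_measurable M" and W: "(\<integral>\<^sup>+x. ennreal (exp \<bar>W x\<bar>) \<partial>M) \<le> 2"
    and e: "0 < e" "e \<le> 1"
  shows "measure (PiM {..<N} (\<lambda>_. M)) {Xs \<in> space (PiM {..<N} (\<lambda>_. M)).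
     (\<Sum>k<N. W (Xs k) - expectation W) \<ge> real N * (K * e)} \<le> exp (- (K / 2 - 2) * (real N * e\<^sup>2))"
proof -
  let ?P = "PiM {..<N} (\<lambda>_. M)"
  interpret P: product_prob_space "\<lambda>_. M" "{..<N}"
    by (rule product_prob_spaceI) (rule prob_space_axioms)
  let ?S = "\<lambda>Xs. \<Sum>k<N. W (Xs k) - expectation W"
  have "emeasure ?P {Xs \<in> space ?P. ?S Xs \<ge> real N * (K * e)}
     \<le> ennreal (exp (- (e / 2) * (real N * (K * e)))) * (\<integral>\<^sup>+Xs. ennreal (exp (e / 2 * ?S Xs)) * indicator (space ?P) Xs \<partial>?P)"
    using e by (intro Chernoff_ineq_nn_integral_ge) auto
  also have "(\<integral>\<^sup>+Xs. ennreal (exp (e / 2 * ?S Xs)) * indicator (space ?P) Xs \<partial>?P)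
     = (\<integral>\<^sup>+Xs. (\<Prod>k<N. ennreal (exp (e / 2 * (W (Xs k) - expectation W)))) \<partial>?P)"
    by (intro nn_integral_cong) (simp add: prod_ennreal sum_distrib_left exp_sum)
  also have "\<dots> = (\<Prod>k<N. \<integral>\<^sup>+x. ennreal (exp (e / 2 * (W x - expectation W))) \<partial>M)"
    by (rule P.product_nn_integral_prod) auto
  also have "\<dots> \<le> (\<Prod>k<N. ennreal (exp (8 * (e / 2)\<^sup>2)))"
    using e by (intro prod_mono_ennreal centered_mgf[OF assms(1,2)]) auto
  also have "\<dots> = ennreal (exp (real N * (8 * (e / 2)\<^sup>2)))"
    by (simp add: ennreal_power exp_of_nat_mult)
  also have "ennreal (exp (- (e / 2) * (real N * (K * e)))) * \<dots> = ennreal (exp (- (K / 2 - 2) * (real N * e\<^sup>2)))"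
    by (simp add: ennreal_mult'[symmetric] exp_add[symmetric] algebra_simps power2_eq_square)
  finally have "emeasure ?P {Xs \<in> space ?P. ?S Xs \<ge> real N * (K * e)} \<le> ennreal (exp (- (K / 2 - 2) * (real N * e\<^sup>2)))"
    by (simp add: mult_left_mono)
  thus ?thesis by (simp add: P.P.emeasure_eq_measure)
qed

lemma mean_deviation:
  assumes [measurable]: "W \<in> borel_measurable M" and W: "(\<integral>\<^sup>+x. ennreal (exp \<bar>W x\<bar>) \<partial>M) \<le> 2"
    and e: "0 < e" "e \<le> 1" and N: "0 < N"
  shows "measure (PiM {..<N} (\<lambda>_. M)) {Xs \<in> space (PiM {..<N} (\<lambda>_. M)).
     \<bar>(\<Sum>k<N. W (Xs k)) / real N - expectation W\<bar> \<ge> K * e} \<le> 2 * exp (- (K / 2 - 2) * (real N * e\<^sup>2))"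
proof -
  let ?P = "PiM {..<N} (\<lambda>_. M)"
  interpret P: product_prob_space "\<lambda>_. M" "{..<N}"
    by (rule product_prob_spaceI) (rule prob_space_axioms)
  let ?A = "{Xs \<in> space ?P. (\<Sum>k<N. W (Xs k) - expectation W) \<ge> real N * (K * e)}"
  let ?B = "{Xs \<in> space ?P. (\<Sum>k<N. - W (Xs k) - expectation (\<lambda>x. - W x)) \<ge> real N * (K * e)}"
  have "{Xs \<in> space ?P. \<bar>(\<Sum>k<N. W (Xs k)) / real N - expectation W\<bar> \<ge> K * e} \<subseteq> ?A \<union> ?B"
  proof (intro subsetI)
    fix Xs assume "Xs \<in> {Xs \<in> space ?P. \<bar>(\<Sum>k<N. W (Xs k)) / real N - expectation W\<bar> \<ge> K * e}"
    hence X: "Xs \<in> space ?P" "K * e \<le> \<bar>(\<Sum>k<N. W (Xs k)) / real N - expectation W\<bar>" by auto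
    from X(2) have "real N * (K * e) \<le> real N * \<bar>(\<Sum>k<N. W (Xs k)) / real N - expectation W\<bar>"
      by (intro mult_left_mono) auto
    also have "\<dots> = \<bar>(\<Sum>k<N. W (Xs k)) - real N * expectation W\<bar>"
    proof -
      have "real N * ((\<Sum>k<N. W (Xs k)) / real N - expectation W) = (\<Sum>k<N. W (Xs k)) - real N * expectation W"
        using N by (simp add: field_simps)
      thus ?thesis by (metis abs_mult abs_of_nat)
    qed
    finally show "Xs \<in> ?A \<union> ?B" using X(1) by (auto simp: sum_subtractf sum_negf abs_if split: if_splits)
  qed
  hence "measure ?P {Xs \<in> space ?P. \<bar>(\<Sum>k<N. W (Xs k)) / real N - expectation W\<bar> \<ge> K * e} \<le> measure ?P (?A \<union> ?B)"
    by (intro P.P.finite_measure_mono) auto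
  also have "\<dots> \<le> measure ?P ?A + measure ?P ?B"
    by (intro measure_Un_le) auto
  also have "\<dots> \<le> exp (- (K / 2 - 2) * (real N * e\<^sup>2)) + exp (- (K / 2 - 2) * (real N * e\<^sup>2))"
    using W by (intro add_mono sum_upper_tail e) auto
  finally show ?thesis by simp
qed

lemma uniform_mean_deviation:
  assumes fin: "finite \<W>" and meas: "\<And>W. W \<in> \<W> \<Longrightarrow> W \<in> borel_measurable M"
    and W: "\<And>W. W \<in> \<W> \<Longrightarrow> (\<integral>\<^sup>+x. ennreal (exp \<bar>W x\<bar>) \<partial>M) \<le> 2"
    and e: "0 < e" "e \<le> 1" and N: "0 < N"
  obtains E where "E \<in> sets (PiM {..<N} (\<lambda>_. M))"
    "measure (PiM {..<N} (\<lambda>_. M)) E \<ge> 1 - real (card \<W>) * (2 * exp (- (K / 2 - 2) * (real N * e\<^sup>2)))"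
    "\<And>Xs W. Xs \<in> E \<Longrightarrow> W \<in> \<W> \<Longrightarrow> \<bar>(\<Sum>k<N. W (Xs k)) / real N - expectation W\<bar> \<le> K * e"
proof -
  let ?P = "PiM {..<N} (\<lambda>_. M)"
  interpret P: product_prob_space "\<lambda>_. M" "{..<N}"
    by (rule product_prob_spaceI) (rule prob_space_axioms)
  define B where "B W = {Xs \<in> space ?P. \<bar>(\<Sum>k<N. W (Xs k)) / real N - expectation W\<bar> \<ge> K * e}" for W
  have B: "B W \<in> sets ?P" if "W \<in> \<W>" for W
  proof -
    note [measurable] = meas[OF that]
    show ?thesis unfolding B_def by measurable
  qed
  have "measure ?P (\<Union>W\<in>\<W>. B W) \<le> (\<Sum>W\<in>\<W>. measure ?P (B W))"
    using fin B by (intro P.P.finite_measure_subadditive_finite) auto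
  also have "\<dots> \<le> (\<Sum>W\<in>\<W>. 2 * exp (- (K / 2 - 2) * (real N * e\<^sup>2)))"
    unfolding B_def using W meas by (intro sum_mono mean_deviation e N) auto
  finally have le: "measure ?P (\<Union>W\<in>\<W>. B W) \<le> real (card \<W>) * (2 * exp (- (K / 2 - 2) * (real N * e\<^sup>2)))" by simp
  have U: "(\<Union>W\<in>\<W>. B W) \<in> sets ?P" using fin B by (intro sets.finite_UN) auto
  show ?thesis
  proof (rule that[of "space ?P - (\<Union>W\<in>\<W>. B W)"])
    show "measure ?P (space ?P - (\<Union>W\<in>\<W>. B W)) \<ge> 1 - real (card \<W>) * (2 * exp (- (K / 2 - 2) * (real N * e\<^sup>2)))"
      unfolding P.P.prob_compl[OF U] using le by simp
  qed (use U in \<open>auto simp: B_def\<close>)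
qed

end

section \<open>Sub-Gaussian scales, their moments and products\<close>

lemma integrable_mult_square:
  fixes f g :: "'a \<Rightarrow> real"
  assumes [measurable]: "f \<in> borel_measurable M" "g \<in> borel_measurable M"
    and "integrable M (\<lambda>x. (f x)\<^sup>2)" "integrable M (\<lambda>x. (g x)\<^sup>2)"
  shows "integrable M (\<lambda>x. f x * g x)"
proof (rule Bochner_Integration.integrable_bound)
  show "integrable M (\<lambda>x. (f x)\<^sup>2 + (g x)\<^sup>2)" using assms by simp
  have "\<bar>f x * g x\<bar> \<le> (f x)\<^sup>2 + (g x)\<^sup>2" for x
    using sum_squares_bound[of "\<bar>f x\<bar>" "\<bar>g x\<bar>"] abs_ge_zero[of "f x * g x"]
    unfolding power2_abs abs_mult by linarith
  thus "AE x in M. norm (f x * g x) \<le> norm ((f x)\<^sup>2 + (g x)\<^sup>2)" by simp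
qed simp

text \<open>These are the scales over which \<open>psi2\<close> takes the infimum. Estimates are
  carried out with an explicit scale, so that attainment of the infimum never matters.\<close>

definition subgauss_bound :: "'a measure \<Rightarrow> real \<Rightarrow> ('a \<Rightarrow> real) \<Rightarrow> bool" where
  "subgauss_bound M s Z \<longleftrightarrow> 0 < s \<and> (\<integral>\<^sup>+ x. ennreal (exp ((Z x / s)\<^sup>2)) \<partial>M) \<le> 2"

lemma psi2_eq: "psi2 M Z = Inf {s. subgauss_bound M s Z}"
  by (simp only: psi2_def subgauss_bound_def power2_abs)

lemma subgauss_bound_mono:
  assumes "subgauss_bound M s Z" "s \<le> t" "\<And>x. \<bar>Y x\<bar> \<le> \<bar>Z x\<bar>"
  shows "subgauss_bound M t Y"
proof -
  have s: "0 < s" using assms(1) by (simp add: subgauss_bound_def)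
  have "(Y x / t)\<^sup>2 \<le> (Z x / s)\<^sup>2" for x
  proof -
    have "\<bar>Y x\<bar> / t \<le> \<bar>Z x\<bar> / s" using s assms(2,3) by (intro frac_le) auto
    hence "\<bar>Y x / t\<bar> \<le> \<bar>Z x / s\<bar>" using s assms(2) by simp
    thus ?thesis by (simp only: abs_le_square_iff)
  qed
  hence "(\<integral>\<^sup>+ x. ennreal (exp ((Y x / t)\<^sup>2)) \<partial>M) \<le> (\<integral>\<^sup>+ x. ennreal (exp ((Z x / s)\<^sup>2)) \<partial>M)"
    by (intro nn_integral_mono ennreal_leI) auto
  thus ?thesis using assms(1,2) s by (auto simp: subgauss_bound_def intro: order_trans)
qed

lemma subgauss_bound_scale:
  assumes "subgauss_bound M s Z" "c > 0"
  shows "subgauss_bound M (c * s) (\<lambda>x. c * Z x)"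
  using assms by (simp add: subgauss_bound_def)

text \<open>The scale \<open>s0\<close> guarantees a nonempty set, because \<open>Inf\<close> of the
  empty set carries no information.\<close>

lemma subgauss_bound_gt_psi2:
  assumes "subgauss_bound M s0 Z" "psi2 M Z < s"
  shows "subgauss_bound M s Z"
proof -
  have "{s. subgauss_bound M s Z} \<noteq> {}" using assms(1) by blast
  then obtain s' where "subgauss_bound M s' Z" "s' < s"
    using assms(2) unfolding psi2_eq by (metis (no_types, lifting) cInf_lessD mem_Collect_eq)
  thus ?thesis using subgauss_bound_mono by fastforce
qed

lemma psi2_le: "subgauss_bound M s Z \<Longrightarrow> psi2 M Z \<le> s"
  unfolding psi2_eq by (intro cInf_lower bdd_belowI[of _ 0]) (auto simp: subgauss_bound_def)

lemma nn_integral_lincomb_le: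
  assumes [measurable]: "f \<in> borel_measurable M" "g \<in> borel_measurable M"
    and "\<And>x. 0 \<le> f x" "\<And>x. 0 \<le> g x" "0 \<le> a" "0 \<le> b" "0 \<le> c" "0 \<le> d"
    and le: "(\<integral>\<^sup>+x. ennreal (f x) \<partial>M) \<le> ennreal c" "(\<integral>\<^sup>+x. ennreal (g x) \<partial>M) \<le> ennreal d"
  shows "(\<integral>\<^sup>+x. ennreal (a * f x + b * g x) \<partial>M) \<le> ennreal (a * c + b * d)"
proof -
  have "(\<integral>\<^sup>+x. ennreal (a * f x + b * g x) \<partial>M) =
     ennreal a * (\<integral>\<^sup>+x. ennreal (f x) \<partial>M) + ennreal b * (\<integral>\<^sup>+x. ennreal (g x) \<partial>M)"
    using assms(3-6) by (simp add: ennreal_mult nn_integral_add nn_integral_cmult)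
  also have "\<dots> \<le> ennreal a * ennreal c + ennreal b * ennreal d"
    by (intro add_mono mult_left_mono le) auto
  also have "\<dots> = ennreal (a * c + b * d)" using assms(5-8) by (simp add: ennreal_mult)
  finally show ?thesis .
qed

context prob_space
begin

text \<open>By x \<le> e^x - 1 at the square of \<open>Z x / s\<close>, the second moment is at most
  \<open>s\<^sup>2 * (2 - 1)\<close>; nonnegativity of the variance then bounds the mean.\<close>

lemma subgauss_moments:
  assumes [measurable]: "Z \<in> borel_measurable M" and Z: "subgauss_bound M s Z"
  shows "integrable M (\<lambda>x. (Z x)\<^sup>2)" "integrable M Z" "expectation (\<lambda>x. (Z x)\<^sup>2) \<le> s\<^sup>2" "\<bar>expectation Z\<bar> \<le> s"
proof -
  have s: "0 < s" and n: "(\<integral>\<^sup>+ x. ennreal (exp ((Z x / s)\<^sup>2)) \<partial>M) \<le> 2" using Z by (auto simp: subgauss_bound_def)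
  have i: "integrable M (\<lambda>x. exp ((Z x / s)\<^sup>2))"
    by (rule integrableI_bounded) (use n in \<open>auto intro: le_less_trans\<close>)
  have "ennreal (\<integral>x. exp ((Z x / s)\<^sup>2) \<partial>M) \<le> ennreal 2" using n nn_integral_eq_integral[OF i] by simp
  hence le2: "(\<integral>x. exp ((Z x / s)\<^sup>2) \<partial>M) \<le> 2" by (subst (asm) ennreal_le_iff) auto
  have pt: "(Z x)\<^sup>2 \<le> s\<^sup>2 * (exp ((Z x / s)\<^sup>2) - 1)" for x
  proof -
    have "(Z x)\<^sup>2 = s\<^sup>2 * (Z x / s)\<^sup>2" using s by (simp add: power_divide)
    also have "\<dots> \<le> s\<^sup>2 * (exp ((Z x / s)\<^sup>2) - 1)"
    proof (rule mult_left_mono)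
      show "(Z x / s)\<^sup>2 \<le> exp ((Z x / s)\<^sup>2) - 1" using exp_ge_add_one_self[of "(Z x / s)\<^sup>2"] by linarith
    qed simp
    finally show ?thesis .
  qed
  have i': "integrable M (\<lambda>x. s\<^sup>2 * (exp ((Z x / s)\<^sup>2) - 1))" using i by simp
  show i2: "integrable M (\<lambda>x. (Z x)\<^sup>2)"
    by (rule Bochner_Integration.integrable_bound[OF i'])
       (use pt in \<open>auto intro!: AE_I2 order_trans[OF _ abs_ge_self]\<close>)
  show i1: "integrable M Z" by (rule square_integrable_imp_integrable[OF _ i2]) simp
  have "expectation (\<lambda>x. (Z x)\<^sup>2) \<le> (\<integral>x. s\<^sup>2 * (exp ((Z x / s)\<^sup>2) - 1) \<partial>M)"
    using i2 i' pt by (intro integral_mono) auto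
  also have "\<dots> = s\<^sup>2 * ((\<integral>x. exp ((Z x / s)\<^sup>2) \<partial>M) - 1)" using i by (simp add: prob_space)
  also have "\<dots> \<le> s\<^sup>2 * 1" using le2 by (intro mult_left_mono) auto
  finally show e2: "expectation (\<lambda>x. (Z x)\<^sup>2) \<le> s\<^sup>2" by simp
  have "(expectation Z)\<^sup>2 \<le> expectation (\<lambda>x. (Z x)\<^sup>2)"
    using variance_positive[of Z] variance_eq[OF i1 i2] by simp
  hence "\<bar>expectation Z\<bar>\<^sup>2 \<le> s\<^sup>2" using e2 by simp
  thus "\<bar>expectation Z\<bar> \<le> s" using s by (intro power2_le_imp_le[of "\<bar>expectation Z\<bar>" s]) auto
qed

text \<open>A common source for the linear exponential moment and for centring. The numbers meet the
  threshold exactly: 8/5 bounds exp(1/4), and 8/5 * (3/4 + 2/4) = 2.\<close>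

lemma subgauss_quarter:
  assumes [measurable]: "Z \<in> borel_measurable M" and Z: "subgauss_bound M s Z"
    and le: "\<And>x. q x \<le> 1 / 4 + (Z x / s)\<^sup>2 / 4"
  shows "(\<integral>\<^sup>+ x. ennreal (exp (q x)) \<partial>M) \<le> 2"
proof -
  have n: "(\<integral>\<^sup>+ x. ennreal (exp ((Z x / s)\<^sup>2)) \<partial>M) \<le> 2" using Z by (auto simp: subgauss_bound_def)
  have e: "exp (1 / 4 :: real) \<le> 8 / 5" using exp_bound[of "1 / 4 :: real"] by (simp add: power2_eq_square)
  \<comment> \<open>Convexity of exp between 0 and \<open>y\<close>, as t^4 - 4 t + 3 = (t - 1)^2
    (t^2 + 2 t + 3) for t = exp(y/4).\<close>
  have conv: "exp (y / 4) \<le> 3 / 4 + exp y / 4" for y :: real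
  proof -
    let ?t = "exp (y / 4)"
    have "0 \<le> (?t - 1)\<^sup>2 * (?t\<^sup>2 + 2 * ?t + 3)" by (intro mult_nonneg_nonneg add_nonneg_nonneg) auto
    also have "\<dots> = ?t ^ 4 - 4 * ?t + 3" by (simp add: algebra_simps power2_eq_square power4_eq_xxxx)
    also have "?t ^ 4 = exp y" by (simp flip: exp_of_nat_mult)
    finally show ?thesis by simp
  qed
  have "exp (q x) \<le> 8 / 5 * (3 / 4 + exp ((Z x / s)\<^sup>2) / 4)" for x
  proof -
    have "exp (q x) \<le> exp (1 / 4) * exp ((Z x / s)\<^sup>2 / 4)" using le[of x] by (simp flip: exp_add)
    also have "\<dots> \<le> 8 / 5 * (3 / 4 + exp ((Z x / s)\<^sup>2) / 4)" by (intro mult_mono e conv) auto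
    finally show ?thesis .
  qed
  hence "(\<integral>\<^sup>+ x. ennreal (exp (q x)) \<partial>M) \<le> (\<integral>\<^sup>+ x. ennreal (6 / 5 + 2 / 5 * exp ((Z x / s)\<^sup>2)) \<partial>M)"
    by (intro nn_integral_mono ennreal_leI) (simp add: algebra_simps)
  also have "\<dots> \<le> ennreal (6 / 5 * 1 + 2 / 5 * 2)"
    using nn_integral_lincomb_le[of "\<lambda>_. 1" M "\<lambda>x. exp ((Z x / s)\<^sup>2)" "6 / 5" "2 / 5" 1 2] n
    by (simp add: emeasure_space_1)
  finally show ?thesis by simp
qed

lemma subgauss_exp_moment:
  assumes [measurable]: "Z \<in> borel_measurable M" and Z: "subgauss_bound M s Z"
  shows "(\<integral>\<^sup>+ x. ennreal (exp \<bar>Z x / (2 * s)\<bar>) \<partial>M) \<le> 2"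
proof (rule subgauss_quarter[OF assms])
  fix x
  have "2 * \<bar>Z x / s\<bar> \<le> 1 + (Z x / s)\<^sup>2"
    using sum_squares_bound[of 1 "\<bar>Z x / s\<bar>"] unfolding power2_abs by simp
  thus "\<bar>Z x / (2 * s)\<bar> \<le> 1 / 4 + (Z x / s)\<^sup>2 / 4" by (simp add: abs_mult)
qed

text \<open>The 3 is enough because (Z - m)^2 \<le> 2 Z^2 + 2 s^2 and 2 \<le> 9/4.\<close>

lemma subgauss_center:
  assumes [measurable]: "Z \<in> borel_measurable M" and Z: "subgauss_bound M s Z"
  shows "subgauss_bound M (3 * s) (\<lambda>x. Z x - expectation Z)"
proof -
  have s: "0 < s" using Z by (auto simp: subgauss_bound_def)
  let ?m = "expectation Z"
  have "(\<integral>\<^sup>+ x. ennreal (exp (((Z x - ?m) / (3 * s))\<^sup>2)) \<partial>M) \<le> 2"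
  proof (rule subgauss_quarter[OF assms])
    fix x
    have "\<bar>?m\<bar>\<^sup>2 \<le> s\<^sup>2" using subgauss_moments(4)[OF assms] by (intro power_mono) auto
    moreover have "0 \<le> (Z x + ?m)\<^sup>2" by simp
    ultimately have "(Z x - ?m)\<^sup>2 \<le> 2 * (Z x)\<^sup>2 + 2 * s\<^sup>2" by (simp add: power2_diff power2_sum)
    also have "\<dots> \<le> 9 * s\<^sup>2 * (1 / 4 + (Z x / s)\<^sup>2 / 4)"
      using s by (simp add: field_simps power_divide)
    finally show "((Z x - ?m) / (3 * s))\<^sup>2 \<le> 1 / 4 + (Z x / s)\<^sup>2 / 4"
      using s by (simp add: power_divide power_mult_distrib pos_divide_le_eq mult_ac)
  qed
  thus ?thesis using s by (simp add: subgauss_bound_def)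
qed

text \<open>The inequality between geometric and arithmetic mean enters twice: for the product in
  the exponent, then for the product of the two exponentials.\<close>

lemma subgauss_product:
  assumes [measurable]: "Z \<in> borel_measurable M" "Y \<in> borel_measurable M"
    and Z: "subgauss_bound M s Z" and Y: "subgauss_bound M t Y"
  shows "(\<integral>\<^sup>+ x. ennreal (exp \<bar>Z x * Y x / (s * t)\<bar>) \<partial>M) \<le> 2"
proof -
  have "exp \<bar>Z x * Y x / (s * t)\<bar> \<le> 1 / 2 * exp ((Z x / s)\<^sup>2) + 1 / 2 * exp ((Y x / t)\<^sup>2)" for x
  proof -
    let ?a = "\<bar>Z x / s\<bar>" and ?b = "\<bar>Y x / t\<bar>"
    have "2 * (?a * ?b) \<le> (Z x / s)\<^sup>2 + (Y x / t)\<^sup>2"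
      using sum_squares_bound[of ?a ?b] unfolding power2_abs by simp
    hence "exp (?a * ?b) \<le> exp ((Z x / s)\<^sup>2 / 2) * exp ((Y x / t)\<^sup>2 / 2)" by (simp flip: exp_add)
    also have "\<dots> \<le> ((exp ((Z x / s)\<^sup>2 / 2))\<^sup>2 + (exp ((Y x / t)\<^sup>2 / 2))\<^sup>2) / 2"
    proof -
      have "0 \<le> (exp ((Z x / s)\<^sup>2 / 2) - exp ((Y x / t)\<^sup>2 / 2))\<^sup>2" by simp
      thus ?thesis by (simp add: power2_diff)
    qed
    finally show ?thesis by (simp add: abs_mult flip: exp_of_nat_mult)
  qed
  hence "(\<integral>\<^sup>+ x. ennreal (exp \<bar>Z x * Y x / (s * t)\<bar>) \<partial>M) \<le>
      (\<integral>\<^sup>+ x. ennreal (1 / 2 * exp ((Z x / s)\<^sup>2) + 1 / 2 * exp ((Y x / t)\<^sup>2)) \<partial>M)"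
    by (intro nn_integral_mono ennreal_leI)
  also have "\<dots> \<le> ennreal (1 / 2 * 2 + 1 / 2 * 2)"
    using Z Y by (intro nn_integral_lincomb_le) (auto simp: subgauss_bound_def)
  finally show ?thesis by simp
qed

end

text \<open>The origin of 86: the factor 3 * 2 * 4 = 24 fits into \<open>2 ^ (5 * R)\<close> and the
  pairs of net points into \<open>2 ^ (36 * R)\<close>, so a rate of 41 = 86/2 - 2 is needed, with 2
  \<le> e.\<close>

lemma failure_probability_le:
  fixes r u :: real
  assumes "1 \<le> R" "real R \<le> r" "0 < u"
  shows "3 * (2 ^ (18 * R))\<^sup>2 * (2 * exp (- (86 / 2 - 2) * (r + u))) \<le> exp (- u) / 4"
proof -
  have "(24 :: real) \<le> 2 ^ (5 * R)"
    using power_increasing[of 5 "5 * R" "2 :: real"] assms(1) by simp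
  hence "24 * (2 :: real) ^ (36 * R) \<le> 2 ^ (5 * R) * 2 ^ (36 * R)" by (intro mult_right_mono) auto
  also have "\<dots> = 2 ^ (41 * R)" by (simp flip: power_add)
  also have "\<dots> \<le> exp 1 ^ (41 * R)"
    using exp_ge_add_one_self[of "1 :: real"] by (intro power_mono) auto
  also have "\<dots> = exp (41 * real R)" by (simp flip: exp_of_nat_mult)
  also have "\<dots> \<le> exp (41 * r + 40 * u)" using assms by simp
  finally have "24 * 2 ^ (36 * R) * exp (- 41 * (r + u)) \<le> exp (41 * r + 40 * u) * exp (- 41 * (r + u))"
    by (intro mult_right_mono) auto
  also have "\<dots> = exp (- u)" by (simp flip: exp_add add: algebra_simps)
  finally show ?thesis by (simp add: power_mult[symmetric] mult.commute)
qed

text \<open>Centring at the sample mean adds a product of two sample means to the empirical product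
  moment. On the net, therefore, the linear statistics are controlled besides their products; both
  means are of order \<open>e\<close>, and \<open>r + u \<le> real N\<close> makes the product of
  order \<open>e\<close> too. The whole deviation is bilinear in \<open>c\<close> and
  \<open>d\<close>, which carries the bound to the ball.\<close>

lemma (in prob_space) empirical_covariance_deviation:
  fixes X Y :: "'i \<Rightarrow> 'a \<Rightarrow> real" and r u :: real
  assumes I: "finite I" "I \<noteq> {}"
    and meas: "\<And>i. i \<in> I \<Longrightarrow> X i \<in> borel_measurable M" "\<And>i. i \<in> I \<Longrightarrow> Y i \<in> borel_measurable M"
    and centered: "\<And>i. i \<in> I \<Longrightarrow> expectation (X i) = 0" "\<And>i. i \<in> I \<Longrightarrow> expectation (Y i) = 0"
    and sgX: "\<And>c. (\<Sum>i\<in>I. (c i)\<^sup>2) \<le> 1 \<Longrightarrow> subgauss_bound M s (\<lambda>x. \<Sum>i\<in>I. c i * X i x)"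
    and sgY: "\<And>c. (\<Sum>i\<in>I. (c i)\<^sup>2) \<le> 1 \<Longrightarrow> subgauss_bound M t (\<lambda>x. \<Sum>i\<in>I. c i * Y i x)"
    and r: "real (card I) \<le> r" and u: "0 < u" and N: "r + u \<le> real N"
  obtains E where "E \<in> sets (PiM {..<N} (\<lambda>_. M))"
    "measure (PiM {..<N} (\<lambda>_. M)) E \<ge> 1 - exp (- u) / 4"
    "\<And>Xs c d. Xs \<in> E \<Longrightarrow> (\<Sum>i\<in>I. (c i)\<^sup>2) \<le> 1 \<Longrightarrow> (\<Sum>i\<in>I. (d i)\<^sup>2) \<le> 1 \<Longrightarrow>
       \<bar>(\<Sum>k<N. (\<Sum>i\<in>I. c i * X i (Xs k)) * (\<Sum>i\<in>I. d i * Y i (Xs k))) / real N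
         - (\<Sum>k<N. \<Sum>i\<in>I. c i * X i (Xs k)) / real N * ((\<Sum>k<N. \<Sum>i\<in>I. d i * Y i (Xs k)) / real N)
         - expectation (\<lambda>x. (\<Sum>i\<in>I. c i * X i x) * (\<Sum>i\<in>I. d i * Y i x))\<bar>
       \<le> 60000 * (s * t * sqrt ((r + u) / real N))"
proof -
  define R where "R = card I"
  have R: "1 \<le> R" using I by (simp add: R_def Suc_le_eq card_gt_0_iff)
  have r1: "1 \<le> r" using R r by (simp add: R_def)
  have N0: "0 < N" using r1 u N by (cases N) auto
  define e where "e = sqrt ((r + u) / real N)"
  have e: "0 < e" "e \<le> 1" "real N * e\<^sup>2 = r + u"
    using r1 u N N0 by (auto simp: e_def)
  have st: "0 < s" "0 < t" using sgX[of "\<lambda>_. 0"] sgY[of "\<lambda>_. 0"] by (auto simp: subgauss_bound_def)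
  define Z where "Z c x = (\<Sum>i\<in>I. c i * X i x)" for c x
  define V where "V c x = (\<Sum>i\<in>I. c i * Y i x)" for c x
  note [measurable] = meas
  have Zm [measurable]: "Z c \<in> borel_measurable M" and Vm [measurable]: "V c \<in> borel_measurable M" for c
    unfolding Z_def V_def by measurable
  \<comment> \<open>Indicator vectors lie in the ball, so the assumption on combinations yields the
    moments of each single variable.\<close>
  have sq_unit: "(\<Sum>j\<in>I. (of_bool (j = i) :: real)\<^sup>2) \<le> 1" if "i \<in> I" for i
    using I that by (simp add: of_bool_def if_distrib if_distribR power2_eq_square cong: if_cong)
  have Zi: "Z (\<lambda>j. of_bool (j = i)) = X i" "V (\<lambda>j. of_bool (j = i)) = Y i" if "i \<in> I" for i
    using I that by (auto simp: Z_def V_def fun_eq_iff of_bool_def if_distrib if_distribR cong: if_cong)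
  have iX: "integrable M (X i)" "integrable M (\<lambda>x. (X i x)\<^sup>2)" if "i \<in> I" for i
    using subgauss_moments[OF meas(1)[OF that]] sgX[OF sq_unit[OF that], folded Z_def, unfolded Zi[OF that]] by auto
  have iY: "integrable M (Y i)" "integrable M (\<lambda>x. (Y i x)\<^sup>2)" if "i \<in> I" for i
    using subgauss_moments[OF meas(2)[OF that]] sgY[OF sq_unit[OF that], folded V_def, unfolded Zi[OF that]] by auto
  have iXY: "integrable M (\<lambda>x. X i x * Y j x)" if "i \<in> I" "j \<in> I" for i j
    by (rule integrable_mult_square) (use iX iY that meas in auto)
  have EZ: "expectation (Z c) = 0" "expectation (V c) = 0" for c
    unfolding Z_def V_def using iX iY centered by (auto simp: integral_sum)
  define f where "f Xs i j = (\<Sum>k<N. X i (Xs k) * Y j (Xs k)) / real N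
     - (\<Sum>k<N. X i (Xs k)) / real N * ((\<Sum>k<N. Y j (Xs k)) / real N) - expectation (\<lambda>x. X i x * Y j x)" for Xs i j
  have prod: "Z c x * V d x = (\<Sum>i\<in>I. \<Sum>j\<in>I. c i * d j * (X i x * Y j x))" for c d x
    unfolding Z_def V_def sum_product by (simp add: mult_ac)
  have F: "(\<Sum>i\<in>I. \<Sum>j\<in>I. c i * d j * f Xs i j) = (\<Sum>k<N. Z c (Xs k) * V d (Xs k)) / real N
     - (\<Sum>k<N. Z c (Xs k)) / real N * ((\<Sum>k<N. V d (Xs k)) / real N) - expectation (\<lambda>x. Z c x * V d x)" for c d Xs
  proof -
    have "(\<Sum>k<N. Z c (Xs k) * V d (Xs k)) = (\<Sum>i\<in>I. \<Sum>j\<in>I. c i * d j * (\<Sum>k<N. X i (Xs k) * Y j (Xs k)))"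
      unfolding prod sum_distrib_left by (simp only: sum.swap[of _ I "{..<N}"])
    moreover have "(\<Sum>k<N. Z c (Xs k)) * (\<Sum>k<N. V d (Xs k)) = (\<Sum>i\<in>I. \<Sum>j\<in>I. c i * d j * ((\<Sum>k<N. X i (Xs k)) * (\<Sum>k<N. Y j (Xs k))))"
    proof -
      have "(\<Sum>i\<in>I. c i * x i) * (\<Sum>j\<in>I. d j * y j) = (\<Sum>i\<in>I. \<Sum>j\<in>I. c i * d j * (x i * y j))" for x y :: "'i \<Rightarrow> real"
        unfolding sum_product by (simp add: mult_ac)
      thus ?thesis unfolding Z_def V_def sum.swap[of _ I "{..<N}"] sum_distrib_left[symmetric] .
    qed
    moreover have "expectation (\<lambda>x. Z c x * V d x) = (\<Sum>i\<in>I. \<Sum>j\<in>I. c i * d j * expectation (\<lambda>x. X i x * Y j x))"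
      unfolding prod using iXY by (simp add: integral_sum)
    moreover have "(\<Sum>i\<in>I. \<Sum>j\<in>I. c i * d j * (p i j / n - q i / n * (w j / n) - E i j)) =
      (\<Sum>i\<in>I. \<Sum>j\<in>I. c i * d j * p i j) / n - (\<Sum>i\<in>I. \<Sum>j\<in>I. c i * d j * (q i * w j)) / (n * n)
        - (\<Sum>i\<in>I. \<Sum>j\<in>I. c i * d j * E i j)" for p E :: "'i \<Rightarrow> 'i \<Rightarrow> real" and q w n
      by (simp add: right_diff_distrib sum_subtractf sum_divide_distrib)
    ultimately show ?thesis
      unfolding f_def by (simp only: times_divide_times_eq)
  qed
  obtain Net :: "('i \<Rightarrow> real) set" where Net: "finite Net" "real (card Net) \<le> 2 ^ (18 * R)"
    "\<And>c. c \<in> Net \<Longrightarrow> (\<Sum>i\<in>I. (c i)\<^sup>2) \<le> 1"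
    "\<And>c. (\<Sum>i\<in>I. (c i)\<^sup>2) \<le> 1 \<Longrightarrow> \<exists>c'\<in>Net. (\<Sum>i\<in>I. (c i - c' i)\<^sup>2) \<le> 1 / 16"
    using ball_net[OF I] unfolding R_def by blast
  define WZ where "WZ c x = Z c x / (2 * s)" for c x
  define WV where "WV c x = V c x / (2 * t)" for c x
  define WP where "WP = (\<lambda>(c, d) x. Z c x * V d x / (s * t))"
  define \<W> where "\<W> = WZ ` Net \<union> WV ` Net \<union> WP ` (Net \<times> Net)"
  have "card \<W> \<le> card Net + card Net + card (Net \<times> Net)"
    unfolding \<W>_def using Net(1)
    by (intro order_trans[OF card_Un_le] add_mono card_image_le finite_cartesian_product)
  also have "\<dots> \<le> 3 * (card Net * card Net)" using le_square[of "card Net"] unfolding card_cartesian_product by linarith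
  finally have "real (card \<W>) \<le> real (3 * (card Net * card Net))" by (simp only: of_nat_le_iff)
  also have "\<dots> \<le> 3 * (2 ^ (18 * R))\<^sup>2"
    using mult_mono[OF Net(2) Net(2)] by (simp add: power2_eq_square)
  finally have card: "real (card \<W>) \<le> 3 * (2 ^ (18 * R))\<^sup>2" .
  have 1: "finite \<W>" unfolding \<W>_def using Net(1) by auto
  have 2: "W \<in> borel_measurable M" if "W \<in> \<W>" for W
    using that unfolding \<W>_def by (auto simp: WZ_def[abs_def] WV_def[abs_def] WP_def)
  have 3: "(\<integral>\<^sup>+x. ennreal (exp \<bar>W x\<bar>) \<partial>M) \<le> 2" if "W \<in> \<W>" for W
    using that unfolding \<W>_def WZ_def[abs_def] WV_def[abs_def] WP_def
    using subgauss_exp_moment[OF Zm sgX[folded Z_def]] subgauss_exp_moment[OF Vm sgY[folded V_def]]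
      subgauss_product[OF Zm Vm sgX[folded Z_def] sgY[folded V_def]] Net(3) by auto
  obtain E where E: "E \<in> sets (PiM {..<N} (\<lambda>_. M))"
    "measure (PiM {..<N} (\<lambda>_. M)) E \<ge> 1 - real (card \<W>) * (2 * exp (- (86 / 2 - 2) * (real N * e\<^sup>2)))"
    "\<And>Xs W. Xs \<in> E \<Longrightarrow> W \<in> \<W> \<Longrightarrow> \<bar>(\<Sum>k<N. W (Xs k)) / real N - expectation W\<bar> \<le> 86 * e"
    using uniform_mean_deviation[OF 1 2 3 e(1,2) N0, where K = 86] by blast
  have "real (card \<W>) * (2 * exp (- (86 / 2 - 2) * (real N * e\<^sup>2))) \<le> exp (- u) / 4"
    unfolding e(3) by (rule order_trans[OF mult_right_mono[OF card] failure_probability_le])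
      (use R r u in \<open>auto simp: R_def\<close>)
  hence prob: "measure (PiM {..<N} (\<lambda>_. M)) E \<ge> 1 - exp (- u) / 4" using E(2) by linarith
  have net: "\<bar>\<Sum>i\<in>I. \<Sum>j\<in>I. c i * d j * f Xs i j\<bar> \<le> 30000 * (s * t * e)"
    if Xs: "Xs \<in> E" and cd: "c \<in> Net" "d \<in> Net" for Xs c d
  proof -
    have gen: "x \<le> 172 * (p * e)" if "x / (2 * p) \<le> 86 * e" "0 < p" for x p :: real
      using that by (simp add: field_simps)
    have mZ: "\<bar>(\<Sum>k<N. Z c (Xs k)) / real N\<bar> \<le> 172 * (s * e)"
    proof -
      have "\<bar>(\<Sum>k<N. WZ c (Xs k)) / real N - expectation (WZ c)\<bar> \<le> 86 * e"
        using E(3)[OF Xs] cd by (simp add: \<W>_def)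
      hence "\<bar>(\<Sum>k<N. Z c (Xs k)) / real N\<bar> / (2 * s) \<le> 86 * e"
        using st EZ by (simp add: WZ_def[abs_def] sum_divide_distrib[symmetric] abs_mult mult_ac)
      thus ?thesis by (rule gen[OF _ st(1)])
    qed
    have mV: "\<bar>(\<Sum>k<N. V d (Xs k)) / real N\<bar> \<le> 172 * (t * e)"
    proof -
      have "\<bar>(\<Sum>k<N. WV d (Xs k)) / real N - expectation (WV d)\<bar> \<le> 86 * e"
        using E(3)[OF Xs] cd by (simp add: \<W>_def)
      hence "\<bar>(\<Sum>k<N. V d (Xs k)) / real N\<bar> / (2 * t) \<le> 86 * e"
        using st EZ by (simp add: WV_def[abs_def] sum_divide_distrib[symmetric] abs_mult mult_ac)
      thus ?thesis by (rule gen[OF _ st(2)])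
    qed
    have mP: "\<bar>(\<Sum>k<N. Z c (Xs k) * V d (Xs k)) / real N - expectation (\<lambda>x. Z c x * V d x)\<bar> \<le> 86 * (s * t * e)"
    proof -
      have "\<bar>(\<Sum>k<N. WP (c, d) (Xs k)) / real N - expectation (WP (c, d))\<bar> \<le> 86 * e"
        using E(3)[OF Xs] cd by (simp add: \<W>_def)
      moreover have "(\<Sum>k<N. WP (c, d) (Xs k)) / real N - expectation (WP (c, d))
         = ((\<Sum>k<N. Z c (Xs k) * V d (Xs k)) / real N - expectation (\<lambda>x. Z c x * V d x)) / (s * t)"
        by (simp add: WP_def sum_divide_distrib[symmetric] diff_divide_distrib)
      ultimately have "\<bar>(\<Sum>k<N. Z c (Xs k) * V d (Xs k)) / real N - expectation (\<lambda>x. Z c x * V d x)\<bar> / (s * t) \<le> 86 * e"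
        using st by simp
      thus ?thesis using st by (simp add: pos_divide_le_eq mult_ac)
    qed
    \<comment> \<open>Each mean carries 172 = 2 * 86 because linear statistics are scaled by
      \<open>2 * s\<close> and \<open>2 * t\<close>. Then 172^2 = 29584, one factor \<open>e\<close>
      is dropped, and 29584 + 86 \<le> 30000.\<close>
    have "\<bar>(\<Sum>k<N. Z c (Xs k)) / real N * ((\<Sum>k<N. V d (Xs k)) / real N)\<bar> \<le> (172 * (s * e)) * (172 * (t * e))"
      unfolding abs_mult using st e by (intro mult_mono mZ mV) auto
    also have "\<dots> = 29584 * (s * t * e) * e" by simp
    also have "\<dots> \<le> 29584 * (s * t * e) * 1" using st e by (intro mult_left_mono) auto
    finally have "\<bar>(\<Sum>k<N. Z c (Xs k)) / real N * ((\<Sum>k<N. V d (Xs k)) / real N)\<bar> \<le> 29584 * (s * t * e)" by simp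
    moreover have "0 \<le> s * t * e" using st e by simp
    moreover have "\<bar>a - b - w\<bar> \<le> 30000 * k" if "\<bar>b\<bar> \<le> 29584 * k" "0 \<le> k" "\<bar>a - w\<bar> \<le> 86 * k" for a b w k :: real
      using that by linarith
    ultimately show ?thesis using mP unfolding F by blast
  qed
  show ?thesis
  proof (rule that[OF E(1) prob])
    fix Xs and c d :: "'i \<Rightarrow> real" assume a: "Xs \<in> E" "(\<Sum>i\<in>I. (c i)\<^sup>2) \<le> 1" "(\<Sum>i\<in>I. (d i)\<^sup>2) \<le> 1"
    have "\<bar>\<Sum>i\<in>I. \<Sum>j\<in>I. c i * d j * f Xs i j\<bar> \<le> 2 * (30000 * (s * t * e))"
      by (rule bilinear_net_bound[OF I(1) Net(3,4) net[OF a(1)] a(2,3)])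
    thus "\<bar>(\<Sum>k<N. (\<Sum>i\<in>I. c i * X i (Xs k)) * (\<Sum>i\<in>I. d i * Y i (Xs k))) / real N
         - (\<Sum>k<N. \<Sum>i\<in>I. c i * X i (Xs k)) / real N * ((\<Sum>k<N. \<Sum>i\<in>I. d i * Y i (Xs k)) / real N)
         - expectation (\<lambda>x. (\<Sum>i\<in>I. c i * X i x) * (\<Sum>i\<in>I. d i * Y i x))\<bar>
       \<le> 60000 * (s * t * sqrt ((r + u) / real N))"
      unfolding F unfolding Z_def V_def e_def by simp
  qed
qed

section \<open>The sample covariance of a sub-Gaussian vector\<close>

lemma mtrans_mmul: "mtrans (mmul n X Y) = mmul n (mtrans Y) (mtrans X)"
  by (intro ext) (simp add: mtrans_def mmul_def mult.commute)

lemma mvec_sum: "mvec n A (\<lambda>m. \<Sum>j\<in>I. c j * x j m) = (\<lambda>i. \<Sum>j\<in>I. c j * mvec n A (x j) i)"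
  unfolding mvec_def sum_distrib_left by (subst sum.swap) (simp add: mult_ac)

lemma mvec_zero: "(\<And>i. i < n \<Longrightarrow> x i = 0) \<Longrightarrow> mvec n A x = (\<lambda>_. 0)"
  by (simp add: mvec_def)

lemma mvec_diff_mat: "mvec n (\<lambda>i j. A i j - B i j) x = (\<lambda>i. mvec n A x i - mvec n B x i)"
  by (simp add: mvec_def algebra_simps sum_subtractf)

lemma padded_sample_cov: "padded n (sample_cov n N Xs)"
  by (auto simp: padded_def sample_cov_def)

lemma sample_cov_sym: "sample_cov n N Xs i j = sample_cov n N Xs j i"
  by (simp add: sample_cov_def mult.commute)

text \<open>The sample covariance is invariant under translation, so any centre \<open>m\<close> may
  be subtracted; the true mean is the useful one, as the statistics then have expectation 0.\<close>

lemma sample_cov_form: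
  fixes n N :: nat and Xs :: "nat \<Rightarrow> nat \<Rightarrow> real" and m :: "nat \<Rightarrow> real"
  assumes N: "0 < N"
  defines "p \<equiv> \<lambda>a k. ip n a (\<lambda>i. Xs k i - m i)"
  shows "ip n a (mvec n (sample_cov n N Xs) b) =
    (\<Sum>k<N. p a k * p b k) / real N - (\<Sum>k<N. p a k) / real N * ((\<Sum>k<N. p b k) / real N)"
proof -
  define y where "y k i = Xs k i - sample_mean n N Xs i" for k i
  have ipy: "ip n c (y k) = p c k - (\<Sum>k<N. p c k) / real N" for c k
  proof -
    have "y k i = (Xs k i - m i) - (1 / real N) * (\<Sum>j<N. 1 * (Xs j i - m i))" if "i < n" for i
      using N that by (simp add: y_def sample_mean_def sum_subtractf field_simps)
    hence "ip n c (y k) = ip n c (\<lambda>i. (Xs k i - m i) - (1 / real N) * (\<Sum>j<N. 1 * (Xs j i - m i)))"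
      by (intro ip_cong) auto
    also have "\<dots> = p c k - (1 / real N) * (\<Sum>j<N. 1 * p c j)"
      by (simp only: p_def ip_diff_right[of n c "\<lambda>i. Xs k i - m i"] ip_scale_right
          ip_sum_right[where c = "\<lambda>_. 1" and x = "\<lambda>j i. Xs j i - m i"])
    finally show ?thesis by simp
  qed
  have "ip n a (mvec n (sample_cov n N Xs) b) = (\<Sum>i<n. \<Sum>j<n. \<Sum>k<N. a i * (y k i * y k j / real N) * b j)"
    unfolding ip_def mvec_def
    by (auto simp: sample_cov_def y_def sum_distrib_left sum_distrib_right sum_divide_distrib mult.assoc intro!: sum.cong)
  also have "\<dots> = (\<Sum>k<N. \<Sum>i<n. \<Sum>j<n. a i * (y k i * y k j / real N) * b j)"
    by (simp only: sum.swap[of _ "{..<N}" "{..<n}"])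
  also have "\<dots> = (\<Sum>k<N. ip n a (y k) * ip n b (y k)) / real N"
    unfolding ip_def sum_product sum_divide_distrib by (simp add: mult_ac)
  also have "(\<Sum>k<N. ip n a (y k) * ip n b (y k)) = (\<Sum>k<N. p a k * p b k) - (\<Sum>k<N. p a k) * (\<Sum>k<N. p b k) / real N"
  proof -
    let ?a = "(\<Sum>k<N. p a k) / real N" and ?b = "(\<Sum>k<N. p b k) / real N"
    have "(\<Sum>k<N. ip n a (y k) * ip n b (y k)) = (\<Sum>k<N. p a k * p b k - p a k * ?b - ?a * p b k + ?a * ?b)"
      unfolding ipy by (intro sum.cong) (auto simp: algebra_simps)
    also have "\<dots> = (\<Sum>k<N. p a k * p b k) - (\<Sum>k<N. p a k) * ?b - ?a * (\<Sum>k<N. p b k) + real N * (?a * ?b)"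
      by (simp only: sum.distrib sum_subtractf sum_distrib_left[symmetric] sum_distrib_right[symmetric]
          sum_constant card_lessThan) (simp add: mult.left_commute)
    also have "\<dots> = (\<Sum>k<N. p a k * p b k) - (\<Sum>k<N. p a k) * (\<Sum>k<N. p b k) / real N"
      using N by simp
    finally show ?thesis .
  qed
  finally show ?thesis by (simp add: diff_divide_distrib)
qed

lemma subgauss_bound_zero:
  assumes "prob_space M" "0 < s"
  shows "subgauss_bound M s (\<lambda>_. 0)"
proof -
  interpret prob_space M by fact
  show ?thesis using assms(2) by (simp add: subgauss_bound_def emeasure_space_1)
qed

section \<open>Linear statistics of a sub-Gaussian vector\<close>

locale subgaussian_vector = prob_space M for M :: "(nat \<Rightarrow> real) measure" +
  fixes D :: nat
  assumes sets_M: "sets M = sets (PiM {..<D} (\<lambda>_. borel))"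
    and subgaussian: "subgaussian M D (\<lambda>x. x)"
begin

definition dev :: "(nat \<Rightarrow> real) \<Rightarrow> (nat \<Rightarrow> real) \<Rightarrow> real" where
  "dev a x = ip D a (\<lambda>i. x i - mean_vec M D i)"

lemma measurable_coord [measurable]: "i < D \<Longrightarrow> (\<lambda>x. x i) \<in> borel_measurable M"
  unfolding measurable_cong_sets[OF sets_M refl] by (rule measurable_component_singleton) simp

lemma measurable_ip [measurable]: "(\<lambda>x. ip D a x) \<in> borel_measurable M"
  unfolding ip_def by (intro borel_measurable_sum borel_measurable_times borel_measurable_const measurable_coord) simp

lemma measurable_dev [measurable]: "dev a \<in> borel_measurable M"
  unfolding dev_def[abs_def] ip_diff_right by measurable

lemma ip_subgauss:
  obtains K where "0 < K" "\<And>a. a \<in> unit_vecs D \<Longrightarrow> subgauss_bound M K (\<lambda>x. ip D a x)"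
proof -
  obtain K where K: "\<And>v. v \<in> unit_vecs D \<Longrightarrow> \<exists>s. 0 < s \<and> s \<le> K \<and>
      (\<integral>\<^sup>+ x. ennreal (exp ((\<bar>(\<Sum>i<D. v i * x i) / s\<bar>)^2)) \<partial>M) \<le> 2"
    using subgaussian unfolding subgaussian_def by blast
  show ?thesis
  \<comment> \<open>For \<open>D = 0\<close> there are no unit vectors, and \<open>K\<close> itself
    need not be positive.\<close>
  proof (rule that[of "max K 1"])
    fix a assume "a \<in> unit_vecs D"
    from K[OF this] obtain s where s: "0 < s" "s \<le> K"
      "(\<integral>\<^sup>+ x. ennreal (exp ((\<bar>(\<Sum>i<D. a i * x i) / s\<bar>)^2)) \<partial>M) \<le> 2" by blast
    hence "subgauss_bound M s (\<lambda>x. ip D a x)"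
      unfolding subgauss_bound_def ip_def power2_abs by blast
    thus "subgauss_bound M (max K 1) (\<lambda>x. ip D a x)" by (rule subgauss_bound_mono) (use s in auto)
  qed simp
qed

lemma ip_unit: "i < D \<Longrightarrow> ip D (\<lambda>j. of_bool (j = i)) x = x i"
  unfolding ip_def by (subst sum.cong[OF refl, of _ _ "\<lambda>j. if j = i then x i else 0"]) auto

lemma unit_vec: "i < D \<Longrightarrow> (\<lambda>j. of_bool (j = i)) \<in> unit_vecs D"
  by (simp add: unit_vecs_def vnorm_ip ip_unit)

lemma integrable_coord:
  assumes "i < D"
  shows "integrable M (\<lambda>x. x i)"
proof -
  obtain K where K: "\<And>a. a \<in> unit_vecs D \<Longrightarrow> subgauss_bound M K (\<lambda>x. ip D a x)"
    using ip_subgauss by blast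
  have "integrable M (\<lambda>x. ip D (\<lambda>j. of_bool (j = i)) x)"
    by (rule subgauss_moments(2)[OF measurable_ip K[OF unit_vec[OF assms]]])
  thus ?thesis unfolding ip_unit[OF assms] .
qed

lemma dev_eq: "dev a = (\<lambda>x. ip D a x - expectation (\<lambda>x. ip D a x))"
proof
  fix x
  have "expectation (\<lambda>x. ip D a x) = (\<Sum>i<D. a i * expectation (\<lambda>x. x i))"
    unfolding ip_def using integrable_coord by (subst Bochner_Integration.integral_sum) auto
  thus "dev a x = ip D a x - expectation (\<lambda>x. ip D a x)"
    unfolding dev_def ip_diff_right by (simp add: ip_def mean_vec_def)
qed

lemma dev_scale: "dev (\<lambda>i. c * a i) x = c * dev a x"
  unfolding dev_def by (rule ip_scale_left)

lemma dev_sum: "dev (\<lambda>i. \<Sum>j\<in>I. c j * a j i) x = (\<Sum>j\<in>I. c j * dev (a j) x)"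
  unfolding dev_def by (rule ip_sum_left)

text \<open>The scale is proportional to a positive bound \<open>B\<close> of the length, so that
  the zero vector also gets a positive scale.\<close>

lemma dev_subgauss:
  obtains K where "0 < K" "\<And>a B. vnorm D a \<le> B \<Longrightarrow> 0 < B \<Longrightarrow> subgauss_bound M (K * B) (dev a)"
proof -
  obtain K where K: "0 < K" "\<And>a. a \<in> unit_vecs D \<Longrightarrow> subgauss_bound M K (\<lambda>x. ip D a x)"
    using ip_subgauss by blast
  show ?thesis
  proof (rule that[of "3 * K"])
    fix a B assume B: "vnorm D a \<le> B" "0 < B"
    show "subgauss_bound M (3 * K * B) (dev a)"
    proof (cases rule: vnorm_cases[of D a])
      case 1
      hence "dev a = (\<lambda>_. 0)" by (intro ext) (simp add: dev_def ip_def)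
      thus ?thesis using K(1) B subgauss_bound_zero[OF prob_space_axioms] by simp
    next
      case 2
      let ?a = "\<lambda>i. a i / vnorm D a"
      have "subgauss_bound M (3 * K) (dev ?a)"
        unfolding dev_eq by (rule subgauss_center[OF measurable_ip K(2)[OF 2(2)]])
      from subgauss_bound_scale[OF this 2(1)]
      have "subgauss_bound M (vnorm D a * (3 * K)) (\<lambda>x. dev (\<lambda>i. vnorm D a * ?a i) x)"
        unfolding dev_scale .
      moreover have "(\<lambda>i. vnorm D a * ?a i) = a" using 2(1) by (intro ext) simp
      moreover have "vnorm D a * (3 * K) \<le> 3 * K * B" using B K(1) by (simp add: mult.commute)
      ultimately show ?thesis using subgauss_bound_mono by fastforce
    qed
  qed (use K in simp)
qed

lemma dev_moments:
  "integrable M (\<lambda>x. (dev a x)\<^sup>2)" "integrable M (dev a)" "expectation (dev a) = 0"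
proof -
  obtain K where K: "0 < K" "\<And>a B. vnorm D a \<le> B \<Longrightarrow> 0 < B \<Longrightarrow> subgauss_bound M (K * B) (dev a)"
    using dev_subgauss by blast
  have s: "subgauss_bound M (K * (vnorm D a + 1)) (dev a)" by (rule K(2)) (simp_all add: add_nonneg_pos)
  show "integrable M (\<lambda>x. (dev a x)\<^sup>2)" "integrable M (dev a)"
    using subgauss_moments[OF measurable_dev s] by auto
  have "integrable M (\<lambda>x. ip D a x)" unfolding ip_def using integrable_coord by auto
  thus "expectation (dev a) = 0" unfolding dev_eq by (simp add: prob_space)
qed

lemma cov_form: "expectation (\<lambda>x. dev a x * dev b x) = ip D a (mvec D (cov_mat M D) b)"
proof -
  let ?c = "\<lambda>i j x. (x i - mean_vec M D i) * (x j - mean_vec M D j)"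
  have int: "integrable M (?c i j)" if "i < D" "j < D" for i j
  proof -
    have "integrable M (\<lambda>x. dev (\<lambda>k. of_bool (k = i)) x * dev (\<lambda>k. of_bool (k = j)) x)"
      by (intro integrable_mult_square measurable_dev dev_moments(1))
    thus ?thesis unfolding dev_def ip_unit[OF that(1)] ip_unit[OF that(2)] .
  qed
  have "expectation (\<lambda>x. dev a x * dev b x) = expectation (\<lambda>x. \<Sum>i<D. \<Sum>j<D. a i * b j * ?c i j x)"
    unfolding dev_def ip_def sum_product by (simp add: mult_ac)
  also have "\<dots> = (\<Sum>i<D. \<Sum>j<D. a i * b j * expectation (?c i j))"
  proof -
    have "expectation (\<lambda>x. \<Sum>i<D. \<Sum>j<D. a i * b j * ?c i j x) = (\<Sum>i<D. expectation (\<lambda>x. \<Sum>j<D. a i * b j * ?c i j x))"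
      by (rule Bochner_Integration.integral_sum) (auto intro!: integrable_mult_right int)
    also have "\<dots> = (\<Sum>i<D. \<Sum>j<D. expectation (\<lambda>x. a i * b j * ?c i j x))"
      by (intro sum.cong refl Bochner_Integration.integral_sum) (auto intro!: integrable_mult_right int)
    finally show ?thesis by simp
  qed
  also have "\<dots> = ip D a (mvec D (cov_mat M D) b)"
    unfolding ip_def mvec_def by (auto simp: cov_mat_def sum_distrib_left mult_ac intro!: sum.cong)
  finally show ?thesis .
qed

text \<open>\<open>Sup\<close> is informative only on a bounded set. By Cauchy-Schwarz, a multiple
  of the Frobenius norm of \<open>L\<close> plus 1 bounds all the \<open>psi2\<close>
  values.\<close>

lemma vpsi2_facts:
  defines "F \<equiv> \<lambda>L x. mvec D L (\<lambda>i. x i - mean_vec M D i)"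
  shows "0 \<le> vpsi2 M d (F L)"
    and "v \<in> unit_vecs d \<Longrightarrow> vpsi2 M d (F L) < s \<Longrightarrow> subgauss_bound M s (dev (mvec d (mtrans L) v))"
proof -
  have eq: "(\<lambda>x. \<Sum>i<d. v i * F L x i) = dev (mvec d (mtrans L) v)" for v
  proof
    fix x
    have "(\<Sum>i<d. v i * F L x i) = ip d (mvec D L (\<lambda>i. x i - mean_vec M D i)) v"
      by (simp add: ip_def F_def mult.commute)
    also have "\<dots> = dev (mvec d (mtrans L) v) x"
      unfolding dev_def by (subst ip_mvec_left) (rule ip_commute)
    finally show "(\<Sum>i<d. v i * F L x i) = dev (mvec d (mtrans L) v) x" .
  qed
  obtain K where K: "0 < K" "\<And>a B. vnorm D a \<le> B \<Longrightarrow> 0 < B \<Longrightarrow> subgauss_bound M (K * B) (dev a)"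
    using dev_subgauss by blast
  define B where "B = sqrt (\<Sum>i<D. \<Sum>j<d. (L j i)\<^sup>2) + 1"
  have B: "0 < B" unfolding B_def by (intro add_nonneg_pos real_sqrt_ge_zero sum_nonneg) auto
  have sg: "subgauss_bound M (K * B) (dev (mvec d (mtrans L) v))" if v: "v \<in> unit_vecs d" for v
  proof (rule K(2)[OF _ B])
    have "(\<Sum>j<d. (v j)\<^sup>2) = 1" using v by (simp add: unit_vecs_def vnorm_def)
    hence "(mvec d (mtrans L) v i)\<^sup>2 \<le> (\<Sum>j<d. (L j i)\<^sup>2)" for i
      using Cauchy_Schwarz_ineq_sum[of "\<lambda>j. L j i" v "{..<d}"] by (simp add: mvec_def mtrans_def)
    hence "vnorm D (mvec d (mtrans L) v) \<le> sqrt (\<Sum>i<D. \<Sum>j<d. (L j i)\<^sup>2)"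
      unfolding vnorm_def by (intro real_sqrt_le_mono sum_mono)
    thus "vnorm D (mvec d (mtrans L) v) \<le> B" by (simp add: B_def)
  qed
  let ?S = "insert 0 ((\<lambda>v. psi2 M (\<lambda>x. \<Sum>i<d. v i * F L x i)) ` unit_vecs d)"
  have bdd: "bdd_above ?S"
  proof (rule bdd_aboveI)
    fix t assume "t \<in> ?S"
    thus "t \<le> K * B" using psi2_le[OF sg] K(1) B unfolding eq by auto
  qed
  show "0 \<le> vpsi2 M d (F L)" unfolding vpsi2_def by (rule cSup_upper[OF _ bdd]) simp
  assume v: "v \<in> unit_vecs d" and s: "vpsi2 M d (F L) < s"
  have "psi2 M (dev (mvec d (mtrans L) v)) \<le> vpsi2 M d (F L)"
    unfolding vpsi2_def by (rule cSup_upper[OF _ bdd]) (use v in \<open>auto simp: eq\<close>)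
  thus "subgauss_bound M s (dev (mvec d (mtrans L) v))"
    using subgauss_bound_gt_psi2[OF sg[OF v]] s by simp
qed

end

section \<open>Covariance deviation in the eigenbasis\<close>

locale spectral_covariance = subgaussian_vector +
  fixes Q :: "nat \<Rightarrow> nat \<Rightarrow> real" and l :: "nat \<Rightarrow> real"
  assumes Q: "orthogonal_mat D Q" and cov: "cov_mat M D = spectral D Q l"
begin

abbreviation "col k \<equiv> (\<lambda>a. Q a k)"

lemma l_eq: "k < D \<Longrightarrow> l k = expectation (\<lambda>x. (dev (col k) x)\<^sup>2)"
  unfolding power2_eq_square cov_form cov by (rule spectral_ev[OF Q, symmetric])

lemma l_nonneg: "k < D \<Longrightarrow> 0 \<le> l k"
  by (simp add: l_eq)

lemma AE_dev_null:
  assumes "k < D" "l k = 0"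
  shows "AE x in M. dev (col k) x = 0"
proof -
  have "expectation (\<lambda>x. (dev (col k) x)\<^sup>2) = 0" using l_eq assms by simp
  hence "AE x in M. (dev (col k) x)\<^sup>2 = 0"
    by (subst (asm) integral_nonneg_eq_0_iff_AE[OF dev_moments(1)]) auto
  thus ?thesis by simp
qed

definition dagger :: "nat \<Rightarrow> nat \<Rightarrow> real" where
  "dagger = spectral D Q (\<lambda>k. inverse (l k))"

text \<open>\<open>pull d A v\<close> is \<open>\<Sigma>\<^sup>\<dagger> A\<^sup>T v\<close>, and \<open>vpsi d A\<close> below is the \<open>\<psi>\<^sub>2\<close> norm of \<open>A \<Sigma>\<^sup>\<dagger> (X - \<E>X)\<close>.\<close>

definition pull :: "nat \<Rightarrow> (nat \<Rightarrow> nat \<Rightarrow> real) \<Rightarrow> (nat \<Rightarrow> real) \<Rightarrow> nat \<Rightarrow> real" where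
  "pull d A v = mvec D dagger (mvec d (mtrans A) v)"

definition vpsi :: "nat \<Rightarrow> (nat \<Rightarrow> nat \<Rightarrow> real) \<Rightarrow> real" where
  "vpsi d A = vpsi2 M d (\<lambda>x. mvec D (mmul D A dagger) (\<lambda>i. x i - mean_vec M D i))"

lemma vpsi_nonneg: "0 \<le> vpsi d A"
  unfolding vpsi_def by (rule vpsi2_facts)

lemma pull_eq: "pull d A v = mvec d (mtrans (mmul D A dagger)) v"
  by (simp add: pull_def mtrans_mmul mvec_mmul dagger_def)

lemma pull_padded: "\<not> i < D \<Longrightarrow> pull d A v i = 0"
  unfolding pull_def dagger_def by (rule mvec_padded) simp

text \<open>\<open>v\<close> enters only through its products with \<open>A\<close> applied to
  eigenvectors, and those with \<open>l k = 0\<close> drop out as \<open>inverse 0 = 0\<close>. This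
  leaves as many linear forms as the rank.\<close>

lemma pull_coords:
  "pull d A v = (\<lambda>i. if i < D then \<Sum>k<D. (inverse (l k) * ip d (mvec D A (col k)) v) * Q i k else 0)"
  unfolding pull_def dagger_def mvec_spectral ip_mvec_left ..

text \<open>The strict inequality avoids the question whether the infimum defining \<open>psi2\<close> is attained.\<close>

lemma pull_subgauss:
  assumes v: "ip d v v \<le> 1" and s: "vpsi d A < s"
  shows "subgauss_bound M s (dev (pull d A v))"
proof (cases rule: vnorm_cases[of d v])
  case 1
  have "pull d A v = (\<lambda>_. 0)" unfolding pull_eq by (rule mvec_zero) (rule 1)
  hence "dev (pull d A v) = (\<lambda>_. 0)" by (simp add: dev_def[abs_def] ip_def)
  moreover have "0 < s" using s vpsi_nonneg[of d A] by linarith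
  ultimately show ?thesis using subgauss_bound_zero[OF prob_space_axioms] by simp
next
  case 2
  let ?v = "\<lambda>i. v i / vnorm d v"
  have sg: "subgauss_bound M s (dev (pull d A ?v))"
    unfolding pull_eq by (rule vpsi2_facts(2)[OF 2(2)]) (use s in \<open>simp add: vpsi_def\<close>)
  have "v = (\<lambda>i. vnorm d v * ?v i)" using 2(1) by (intro ext) simp
  hence "pull d A v = (\<lambda>i. vnorm d v * pull d A ?v i)"
    unfolding pull_eq by (metis mvec_scale)
  hence "dev (pull d A v) x = vnorm d v * dev (pull d A ?v) x" for x by (simp add: dev_scale)
  moreover have "vnorm d v \<le> 1" using v by (simp add: vnorm_ip)
  ultimately have "\<bar>dev (pull d A v) x\<bar> \<le> \<bar>dev (pull d A ?v) x\<bar>" for x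
    by (simp add: abs_mult mult_left_le_one_le)
  thus ?thesis using subgauss_bound_mono[OF sg order_refl] by blast
qed

text \<open>Arbitrarily small scales force variance 0, which puts the vector into the kernel of the
  covariance. As a value of the pseudoinverse it is also orthogonal to that kernel.\<close>

lemma pull_degenerate:
  assumes "vpsi d A = 0" "v \<in> unit_vecs d"
  shows "pull d A v = (\<lambda>_. 0)"
proof -
  let ?z = "pull d A v"
  have v1: "ip d v v \<le> 1" using assms(2) by (simp add: unit_vecs_def vnorm_ip)
  have "expectation (\<lambda>x. (dev ?z x)\<^sup>2) \<le> 0"
  proof (rule field_le_epsilon)
    fix e :: real assume e: "0 < e"
    have "subgauss_bound M (sqrt e) (dev ?z)" by (rule pull_subgauss[OF v1]) (use assms e in simp)
    thus "expectation (\<lambda>x. (dev ?z x)\<^sup>2) \<le> 0 + e" using subgauss_moments(3)[OF measurable_dev] e by fastforce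
  qed
  hence "ip D ?z (mvec D (spectral D Q l) ?z) \<le> 0"
    unfolding power2_eq_square cov_form cov .
  hence "(\<Sum>k<D. l k * (ip D (col k) ?z)\<^sup>2) = 0"
    unfolding spectral_form by (intro antisym sum_nonneg) (auto simp: l_nonneg)
  hence 0: "l k * (ip D (col k) ?z)\<^sup>2 = 0" if "k < D" for k
    using that by (subst (asm) sum_nonneg_eq_0_iff) (auto simp: l_nonneg)
  have "ip D (col k) ?z = 0" if k: "k < D" for k
  proof (cases "l k = 0")
    case True
    have "ip D (col k) ?z = ip D (mvec D dagger (col k)) (mvec d (mtrans A) v)"
      unfolding pull_def dagger_def by (rule ip_mvec_spectral[symmetric])
    also have "\<dots> = 0" using True unfolding dagger_def mvec_spectral_column[OF Q k] by (simp add: ip_def)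
    finally show ?thesis .
  next
    case False
    thus ?thesis using 0[OF k] by simp
  qed
  hence "?z i = 0" if "i < D" for i using orthogonal_expand[OF Q that, of ?z] by simp
  thus ?thesis using pull_padded by blast
qed

lemma covariance_deviation:
  fixes A B :: "nat \<Rightarrow> nat \<Rightarrow> real" and N :: nat and u :: real
  defines "r \<equiv> real (mrank D D (cov_mat M D))"
  assumes u: "0 < u" and N: "0 < N" "r \<noteq> 0 \<Longrightarrow> r + u \<le> real N"
  obtains E where "E \<in> sets (PiM {..<N} (\<lambda>_. M))" "measure (PiM {..<N} (\<lambda>_. M)) E \<ge> 1 - exp (- u) / 4"
    "\<And>Xs v w. Xs \<in> E \<Longrightarrow> v \<in> unit_vecs d1 \<Longrightarrow> w \<in> unit_vecs d2 \<Longrightarrow>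
       \<bar>ip D (pull d1 A v) (\<lambda>i. mvec D (sample_cov D N Xs) (pull d2 B w) i - mvec D (cov_mat M D) (pull d2 B w) i)\<bar>
       \<le> 240000 * (vpsi d1 A * vpsi d2 B * sqrt ((r + u) / real N))"
proof -
  let ?P = "PiM {..<N} (\<lambda>_. M)"
  interpret P: product_prob_space "\<lambda>_. M" "{..<N}"
    by (rule product_prob_spaceI) (rule prob_space_axioms)
  define I where "I = {k. k < D \<and> l k \<noteq> 0}"
  have I: "finite I" by (simp add: I_def)
  have rI: "r = real (card I)" unfolding r_def cov mrank_spectral[OF Q] I_def ..
  have r0: "0 \<le> r" by (simp add: rI)
  show ?thesis
  \<comment> \<open>In the first case one of the two vectors is always 0, and the whole space serves
    as the event. The other case has the positive scales and the nonempty index set that the net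
    argument requires.\<close>
  proof (cases "I = {} \<or> vpsi d1 A = 0 \<or> vpsi d2 B = 0")
    case True
    have 0: "ip D (pull d1 A v) (\<lambda>i. mvec D S (pull d2 B w) i - mvec D T (pull d2 B w) i) = 0"
      if "v \<in> unit_vecs d1" "w \<in> unit_vecs d2" for S T v w
    proof -
      have "pull d1 A v = (\<lambda>_. 0) \<or> pull d2 B w = (\<lambda>_. 0)"
        using True
      proof (elim disjE)
        assume "I = {}"
        hence "pull d1 A v = (\<lambda>_. 0)" unfolding pull_coords by (intro ext) (auto simp: I_def intro!: sum.neutral)
        thus ?thesis ..
      qed (use pull_degenerate that in auto)
      thus ?thesis by (auto simp: ip_def mvec_def)
    qed
    show ?thesis
    proof (rule that[of "space ?P"])
      show "measure ?P (space ?P) \<ge> 1 - exp (- u) / 4" by (simp add: P.P.prob_space)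
    qed (use 0 vpsi_nonneg u r0 in auto)
  next
    case False
    hence ne: "I \<noteq> {}" and a: "0 < vpsi d1 A" and b: "0 < vpsi d2 B"
      using vpsi_nonneg[of d1 A] vpsi_nonneg[of d2 B] by auto
    have rN: "r + u \<le> real N" using N(2) ne I by (simp add: rI)
    \<comment> \<open>The scale \<open>2 * vpsi d A\<close> is strictly above the norm, as
      \<open>pull_subgauss\<close> demands; two such scales turn 60000 into 240000.\<close>
    have reduce: "\<exists>g. (\<forall>c. (\<Sum>j\<in>I. (c j)\<^sup>2) \<le> 1 \<longrightarrow> subgauss_bound M (2 * vpsi d A) (\<lambda>x. \<Sum>j\<in>I. c j * dev (pull d A (g j)) x))
       \<and> (\<forall>v\<in>unit_vecs d. \<exists>c. (\<Sum>j\<in>I. (c j)\<^sup>2) \<le> 1 \<and> pull d A v = (\<lambda>i. \<Sum>j\<in>I. c j * pull d A (g j) i))"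
      if pos: "0 < vpsi d A" for d A
    proof -
      obtain g where g: "\<And>c. ip d (\<lambda>m. \<Sum>j\<in>I. c j * g j m) (\<lambda>m. \<Sum>j\<in>I. c j * g j m) \<le> (\<Sum>j\<in>I. (c j)\<^sup>2)"
        "\<And>v. \<exists>c. (\<Sum>j\<in>I. (c j)\<^sup>2) \<le> ip d v v \<and>
           (\<forall>k\<in>I. ip d (mvec D A (col k)) v = ip d (mvec D A (col k)) (\<lambda>m. \<Sum>j\<in>I. c j * g j m))"
        using reduce_dim[OF I, of d "\<lambda>k. mvec D A (col k)"] by blast
      have lin: "pull d A (\<lambda>m. \<Sum>j\<in>I. c j * g j m) = (\<lambda>i. \<Sum>j\<in>I. c j * pull d A (g j) i)" for c
        unfolding pull_eq by (rule mvec_sum)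
      show ?thesis
      proof (intro exI[of _ g] conjI allI impI ballI)
        fix c :: "nat \<Rightarrow> real" assume c: "(\<Sum>j\<in>I. (c j)\<^sup>2) \<le> 1"
        have "subgauss_bound M (2 * vpsi d A) (dev (pull d A (\<lambda>m. \<Sum>j\<in>I. c j * g j m)))"
          by (rule pull_subgauss[OF order_trans[OF g(1) c]]) (use pos in simp)
        thus "subgauss_bound M (2 * vpsi d A) (\<lambda>x. \<Sum>j\<in>I. c j * dev (pull d A (g j)) x)"
          unfolding lin dev_sum[symmetric] .
      next
        fix v assume v: "v \<in> unit_vecs d"
        hence v1: "ip d v v = 1" by (simp add: unit_vecs_def vnorm_ip)
        obtain c where c: "(\<Sum>j\<in>I. (c j)\<^sup>2) \<le> ip d v v"
          "\<And>k. k \<in> I \<Longrightarrow> ip d (mvec D A (col k)) v = ip d (mvec D A (col k)) (\<lambda>m. \<Sum>j\<in>I. c j * g j m)"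
          using g(2)[of v] by blast
        have "inverse (l k) * ip d (mvec D A (col k)) v = inverse (l k) * ip d (mvec D A (col k)) (\<lambda>m. \<Sum>j\<in>I. c j * g j m)"
          if "k < D" for k using c(2)[of k] that by (cases "l k = 0") (auto simp: I_def)
        hence "pull d A v = pull d A (\<lambda>m. \<Sum>j\<in>I. c j * g j m)"
          unfolding pull_coords by (intro ext if_cong sum.cong refl) auto
        thus "\<exists>c. (\<Sum>j\<in>I. (c j)\<^sup>2) \<le> 1 \<and> pull d A v = (\<lambda>i. \<Sum>j\<in>I. c j * pull d A (g j) i)"
          using c(1) v1 lin by auto
      qed
    qed
    obtain g where g: "\<And>c. (\<Sum>j\<in>I. (c j)\<^sup>2) \<le> 1 \<Longrightarrow> subgauss_bound M (2 * vpsi d1 A) (\<lambda>x. \<Sum>j\<in>I. c j * dev (pull d1 A (g j)) x)"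
      "\<And>v. v \<in> unit_vecs d1 \<Longrightarrow> \<exists>c. (\<Sum>j\<in>I. (c j)\<^sup>2) \<le> 1 \<and> pull d1 A v = (\<lambda>i. \<Sum>j\<in>I. c j * pull d1 A (g j) i)"
      using reduce[OF a] by blast
    obtain h where h: "\<And>c. (\<Sum>j\<in>I. (c j)\<^sup>2) \<le> 1 \<Longrightarrow> subgauss_bound M (2 * vpsi d2 B) (\<lambda>x. \<Sum>j\<in>I. c j * dev (pull d2 B (h j)) x)"
      "\<And>v. v \<in> unit_vecs d2 \<Longrightarrow> \<exists>c. (\<Sum>j\<in>I. (c j)\<^sup>2) \<le> 1 \<and> pull d2 B v = (\<lambda>i. \<Sum>j\<in>I. c j * pull d2 B (h j) i)"
      using reduce[OF b] by blast
    obtain E where E: "E \<in> sets ?P" "measure ?P E \<ge> 1 - exp (- u) / 4"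
      "\<And>Xs c d. Xs \<in> E \<Longrightarrow> (\<Sum>i\<in>I. (c i)\<^sup>2) \<le> 1 \<Longrightarrow> (\<Sum>i\<in>I. (d i)\<^sup>2) \<le> 1 \<Longrightarrow>
       \<bar>(\<Sum>k<N. (\<Sum>i\<in>I. c i * dev (pull d1 A (g i)) (Xs k)) * (\<Sum>i\<in>I. d i * dev (pull d2 B (h i)) (Xs k))) / real N
         - (\<Sum>k<N. \<Sum>i\<in>I. c i * dev (pull d1 A (g i)) (Xs k)) / real N * ((\<Sum>k<N. \<Sum>i\<in>I. d i * dev (pull d2 B (h i)) (Xs k)) / real N)
         - expectation (\<lambda>x. (\<Sum>i\<in>I. c i * dev (pull d1 A (g i)) x) * (\<Sum>i\<in>I. d i * dev (pull d2 B (h i)) x))\<bar>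
       \<le> 60000 * (2 * vpsi d1 A * (2 * vpsi d2 B) * sqrt ((r + u) / real N))"
      using empirical_covariance_deviation[where X = "\<lambda>j. dev (pull d1 A (g j))" and Y = "\<lambda>j. dev (pull d2 B (h j))",
          OF I ne measurable_dev measurable_dev dev_moments(3) dev_moments(3) g(1) h(1) _ u rN] rI
      by blast
    show ?thesis
    proof (rule that[OF E(1,2)])
      fix Xs v w assume Xs: "Xs \<in> E" and v: "v \<in> unit_vecs d1" and w: "w \<in> unit_vecs d2"
      obtain c where c: "(\<Sum>j\<in>I. (c j)\<^sup>2) \<le> 1" "pull d1 A v = (\<lambda>i. \<Sum>j\<in>I. c j * pull d1 A (g j) i)"
        using g(2)[OF v] by blast
      obtain d where d: "(\<Sum>j\<in>I. (d j)\<^sup>2) \<le> 1" "pull d2 B w = (\<lambda>i. \<Sum>j\<in>I. d j * pull d2 B (h j) i)"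
        using h(2)[OF w] by blast
      have "\<bar>ip D (pull d1 A v) (mvec D (sample_cov D N Xs) (pull d2 B w)) - ip D (pull d1 A v) (mvec D (cov_mat M D) (pull d2 B w))\<bar>
         \<le> 60000 * (2 * vpsi d1 A * (2 * vpsi d2 B) * sqrt ((r + u) / real N))"
        using E(3)[OF Xs c(1) d(1)]
        unfolding sample_cov_form[OF N(1), where m = "mean_vec M D"] cov_form[symmetric]
        unfolding dev_def[symmetric] c(2) d(2) dev_sum .
      thus "\<bar>ip D (pull d1 A v) (\<lambda>i. mvec D (sample_cov D N Xs) (pull d2 B w) i - mvec D (cov_mat M D) (pull d2 B w) i)\<bar>
       \<le> 240000 * (vpsi d1 A * vpsi d2 B * sqrt ((r + u) / real N))"
        unfolding ip_diff_right by simp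
    qed
  qed
qed

end

section \<open>Intersection of the events and deviation of the pseudoinverse\<close>

lemma (in prob_space) prob_Int_ge:
  assumes [measurable]: "A \<in> events" "B \<in> events" and "prob A \<ge> 1 - a" "prob B \<ge> 1 - b"
  shows "prob (A \<inter> B) \<ge> 1 - (a + b)"
proof -
  have "prob (space M - A \<inter> B) = prob ((space M - A) \<union> (space M - B))"
    by (rule arg_cong[where f = prob]) auto
  also have "\<dots> \<le> prob (space M - A) + prob (space M - B)" by (rule measure_Un_le) auto
  finally show ?thesis using assms by (simp add: prob_compl)
qed

context spectral_covariance
begin

abbreviation "err N Xs x \<equiv> (\<lambda>i. mvec D (sample_cov D N Xs) x i - mvec D (cov_mat M D) x i)"

text \<open>An eigenvector with eigenvalue 0 gives a linear statistic of variance 0. Finitely many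
  such statistics at finitely many samples vanish simultaneously almost surely, and then no image
  under the sample covariance has a component along these eigenvectors.\<close>

lemma range_event:
  assumes N: "0 < N"
  obtains E where "E \<in> sets (PiM {..<N} (\<lambda>_. M))" "measure (PiM {..<N} (\<lambda>_. M)) E = 1"
    "\<And>Xs x. Xs \<in> E \<Longrightarrow> mvec D (spectral D Q (\<lambda>k. of_bool (l k \<noteq> 0))) (mvec D (sample_cov D N Xs) x)
       = mvec D (sample_cov D N Xs) x"
proof -
  let ?P = "PiM {..<N} (\<lambda>_. M)"
  interpret P: product_prob_space "\<lambda>_. M" "{..<N}"
    by (rule product_prob_spaceI) (rule prob_space_axioms)
  define J where "J = {k. k < D \<and> l k = 0}"
  have [measurable]: "finite J" "finite {..<N}" by (simp_all add: J_def)
  define E where "E = {Xs \<in> space ?P. \<forall>i\<in>{..<N}. \<forall>k\<in>J. dev (col k) (Xs i) = 0}"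
  have E: "E \<in> sets ?P" unfolding E_def by measurable
  have "AE x in M. \<forall>k\<in>J. dev (col k) x = 0"
    by (intro eventually_ball_finite) (auto simp: J_def AE_dev_null)
  hence "AE Xs in ?P. \<forall>i\<in>{..<N}. \<forall>k\<in>J. dev (col k) (Xs i) = 0"
    by (intro eventually_ball_finite[OF finite_lessThan] ballI
        AE_PiM_component[where P = "\<lambda>x. \<forall>k\<in>J. dev (col k) x = 0"] prob_space_axioms)
  hence prob: "measure ?P E = 1"
    unfolding E_def by (subst P.P.prob_Collect_eq_1) (use E in \<open>auto simp: E_def\<close>)
  show ?thesis
  proof (rule that[OF E prob])
    fix Xs x assume Xs: "Xs \<in> E"
    let ?y = "mvec D (sample_cov D N Xs) x"
    have null: "ip D (col k) ?y = 0" if k: "k < D" "l k = 0" for k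
    proof -
      have "ip D (col k) (\<lambda>i. Xs j i - mean_vec M D i) = 0" if "j < N" for j
        using Xs k that by (auto simp: E_def J_def dev_def)
      thus ?thesis unfolding sample_cov_form[OF N, where m = "mean_vec M D"] by simp
    qed
    show "mvec D (spectral D Q (\<lambda>k. of_bool (l k \<noteq> 0))) ?y = ?y"
    proof
      fix i
      show "mvec D (spectral D Q (\<lambda>k. of_bool (l k \<noteq> 0))) ?y i = ?y i"
      proof (cases "i < D")
        case True
        have "mvec D (spectral D Q (\<lambda>k. of_bool (l k \<noteq> 0))) ?y i = (\<Sum>k<D. ip D (col k) ?y * Q i k)"
          unfolding mvec_spectral using True null by (auto intro!: sum.cong)
        also have "\<dots> = ?y i" by (rule orthogonal_expand[OF Q True, symmetric])
        finally show ?thesis .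
      qed (simp add: mvec_padded[OF padded_spectral] mvec_padded[OF padded_sample_cov])
    qed
  qed
qed

text \<open>As the matrix \<open>A\<close> this root reproduces the whitened vector: its product
  with the pseudoinverse is \<open>sqrt (inverse (l k))\<close> on eigenvalues, so
  \<open>vpsi D cov_root\<close> is the norm in the assumption on \<open>N\<close>.\<close>

definition cov_root :: "nat \<Rightarrow> nat \<Rightarrow> real" where
  "cov_root = spectral D Q (\<lambda>k. sqrt (l k))"

lemma sqrt_inverse: "0 \<le> (y :: real) \<Longrightarrow> sqrt y * inverse y = sqrt (inverse y)"
  using sqrt_divide_self_eq[of y] by (simp add: real_sqrt_inverse divide_inverse)

lemma cov_root_dagger: "mmul D cov_root dagger = spectral D Q (\<lambda>k. sqrt (inverse (l k)))"
  unfolding cov_root_def dagger_def mmul_spectral[OF Q]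
  by (rule spectral_cong) (simp add: sqrt_inverse l_nonneg)

lemma dagger_eq: "dagger = pinv D D (cov_mat M D)"
  unfolding dagger_def cov pinv_spectral[OF Q] ..

lemma psd_sqrt_dagger: "psd_sqrt D dagger = mmul D cov_root dagger"
  unfolding cov_root_dagger unfolding dagger_def by (rule psd_sqrt_spectral[OF Q]) (simp add: l_nonneg)

lemma pull_cov_root: "pull D cov_root v = mvec D (spectral D Q (\<lambda>k. sqrt (inverse (l k)))) v"
  unfolding pull_eq cov_root_dagger by simp

lemma pinv_deviation:
  fixes A B :: "nat \<Rightarrow> nat \<Rightarrow> real" and N :: nat and u :: real
  defines "r \<equiv> real (mrank D D (cov_mat M D))"
  defines "e \<equiv> sqrt ((r + u) / real N)"
  assumes u: "0 < u" and N: "0 < N" "r \<noteq> 0 \<Longrightarrow> r + u \<le> real N"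
    and small: "240000 * ((vpsi D cov_root)\<^sup>2 * e) \<le> 1 / 2"
  obtains E where "E \<in> sets (PiM {..<N} (\<lambda>_. M))" "measure (PiM {..<N} (\<lambda>_. M)) E \<ge> 1 - exp (- u)"
    "\<And>Xs. Xs \<in> E \<Longrightarrow> spec_norm d1 d2 (mmul D (mmul D A (\<lambda>i j. pinv D D (sample_cov D N Xs) i j - dagger i j)) (mtrans B))
       \<le> 480000 * vpsi d1 A * vpsi d2 B * e"
proof -
  let ?P = "PiM {..<N} (\<lambda>_. M)"
  interpret P: product_prob_space "\<lambda>_. M" "{..<N}"
    by (rule product_prob_spaceI) (rule prob_space_axioms)
  let ?K = "vpsi D cov_root" and ?a = "vpsi d1 A" and ?b = "vpsi d2 B"
  have e0: "0 \<le> e" using u by (simp add: e_def r_def)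
  note dev = covariance_deviation[OF u N(1) N(2)[unfolded r_def], folded r_def, folded e_def]
  obtain E0 where E0: "E0 \<in> sets ?P" "measure ?P E0 = 1"
    "\<And>Xs x. Xs \<in> E0 \<Longrightarrow> mvec D (spectral D Q (\<lambda>k. of_bool (l k \<noteq> 0))) (mvec D (sample_cov D N Xs) x)
       = mvec D (sample_cov D N Xs) x" using range_event[OF N(1)] by blast
  obtain E1 where E1: "E1 \<in> sets ?P" "measure ?P E1 \<ge> 1 - exp (- u) / 4"
    "\<And>Xs v w. Xs \<in> E1 \<Longrightarrow> v \<in> unit_vecs D \<Longrightarrow> w \<in> unit_vecs D \<Longrightarrow>
      \<bar>ip D (pull D cov_root v) (err N Xs (pull D cov_root w))\<bar> \<le> 240000 * (?K * ?K * e)"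
    using dev[where ?d1.0 = D and A = cov_root and ?d2.0 = D and B = cov_root] by blast
  obtain E2 where E2: "E2 \<in> sets ?P" "measure ?P E2 \<ge> 1 - exp (- u) / 4"
    "\<And>Xs v w. Xs \<in> E2 \<Longrightarrow> v \<in> unit_vecs D \<Longrightarrow> w \<in> unit_vecs d1 \<Longrightarrow>
      \<bar>ip D (pull D cov_root v) (err N Xs (pull d1 A w))\<bar> \<le> 240000 * (?K * ?a * e)"
    using dev[where ?d1.0 = D and A = cov_root and ?d2.0 = d1 and B = A] by blast
  obtain E3 where E3: "E3 \<in> sets ?P" "measure ?P E3 \<ge> 1 - exp (- u) / 4"
    "\<And>Xs v w. Xs \<in> E3 \<Longrightarrow> v \<in> unit_vecs D \<Longrightarrow> w \<in> unit_vecs d2 \<Longrightarrow>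
      \<bar>ip D (pull D cov_root v) (err N Xs (pull d2 B w))\<bar> \<le> 240000 * (?K * ?b * e)"
    using dev[where ?d1.0 = D and A = cov_root and ?d2.0 = d2 and B = B] by blast
  obtain E4 where E4: "E4 \<in> sets ?P" "measure ?P E4 \<ge> 1 - exp (- u) / 4"
    "\<And>Xs v w. Xs \<in> E4 \<Longrightarrow> v \<in> unit_vecs d1 \<Longrightarrow> w \<in> unit_vecs d2 \<Longrightarrow>
      \<bar>ip D (pull d1 A v) (err N Xs (pull d2 B w))\<bar> \<le> 240000 * (?a * ?b * e)"
    using dev[where ?d1.0 = d1 and A = A and ?d2.0 = d2 and B = B] by blast
  define E where "E = E0 \<inter> (E1 \<inter> E2 \<inter> (E3 \<inter> E4))"
  have sets: "E1 \<inter> E2 \<in> sets ?P" "E3 \<inter> E4 \<in> sets ?P" "E \<in> sets ?P"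
    using E0 E1 E2 E3 E4 by (auto simp: E_def)
  have four: "measure ?P (E1 \<inter> E2 \<inter> (E3 \<inter> E4)) \<ge> 1 - ((exp (- u) / 4 + exp (- u) / 4) + (exp (- u) / 4 + exp (- u) / 4))"
    by (intro P.P.prob_Int_ge sets E1 E2 E3 E4)
  have prob: "measure ?P E \<ge> 1 - (0 + ((exp (- u) / 4 + exp (- u) / 4) + (exp (- u) / 4 + exp (- u) / 4)))"
    unfolding E_def by (intro P.P.prob_Int_ge[OF E0(1) sets.Int[OF sets(1,2)] _ four]) (simp add: E0(2))
  show ?thesis
  proof (rule that[OF sets(3)])
    show "measure ?P E \<ge> 1 - exp (- u)" using prob by simp
  next
    fix Xs assume "Xs \<in> E"
    hence Xs: "Xs \<in> E0" "Xs \<in> E1" "Xs \<in> E2" "Xs \<in> E3" "Xs \<in> E4" by (auto simp: E_def)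
    let ?T = "sample_cov D N Xs"
    let ?R = "mvec D (spectral D Q (\<lambda>k. sqrt (inverse (l k))))"
    \<comment> \<open>From the pair of two roots, extended beyond unit vectors by homogeneity of
      degree 2; \<open>small\<close> supplies the 1/2.\<close>
    have half: "\<bar>ip D (?R z) (err N Xs (?R z))\<bar> \<le> 1 / 2 * ip D z z" for z
    proof (cases rule: vnorm_cases[of D z])
      case 1
      hence "?R z = (\<lambda>_. 0)" by (intro mvec_zero)
      thus ?thesis by (simp add: ip_def sum_nonneg)
    next
      case 2
      let ?z = "\<lambda>i. z i / vnorm D z" and ?t = "vnorm D z"
      have zz: "z = (\<lambda>i. ?t * ?z i)" using 2(1) by (intro ext) simp
      have Rz: "?R z = (\<lambda>i. ?t * ?R ?z i)" by (subst zz) (rule mvec_scale)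
      have errz: "err N Xs (\<lambda>i. ?t * y i) = (\<lambda>i. ?t * err N Xs y i)" for y
        unfolding mvec_scale by (simp add: right_diff_distrib)
      have "ip D (?R z) (err N Xs (?R z)) = ?t * (?t * ip D (?R ?z) (err N Xs (?R ?z)))"
        by (simp only: Rz errz ip_scale_left ip_scale_right)
      hence "\<bar>ip D (?R z) (err N Xs (?R z))\<bar> = ?t\<^sup>2 * \<bar>ip D (?R ?z) (err N Xs (?R ?z))\<bar>"
        by (simp add: abs_mult power2_eq_square)
      also have "\<dots> \<le> ?t\<^sup>2 * (1 / 2)"
        using E1(3)[OF Xs(2) 2(2) 2(2)] small unfolding pull_cov_root
        by (intro mult_left_mono) (auto simp: power2_eq_square)
      finally show ?thesis by (simp add: vnorm_sq)
    qed
    \<comment> \<open>A length is a supremum of inner products with unit vectors \<open>z\<close>;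
      moving the symmetric \<open>?R\<close> onto \<open>z\<close> turns these into forms with
      \<open>cov_root\<close> on the left.\<close>
    have R_err: "vnorm D (?R (err N Xs (pull d G v))) \<le> 240000 * (?K * vpsi d G * e)"
      if "\<And>z w. z \<in> unit_vecs D \<Longrightarrow> w \<in> unit_vecs d \<Longrightarrow> \<bar>ip D (pull D cov_root z) (err N Xs (pull d G w))\<bar> \<le> 240000 * (?K * vpsi d G * e)"
        "v \<in> unit_vecs d" for d G v
    proof (rule vnorm_le_of_ip)
      fix z assume z: "z \<in> unit_vecs D"
      have "ip D z (?R (err N Xs (pull d G v))) = ip D (pull D cov_root z) (err N Xs (pull d G v))"
        unfolding pull_cov_root by (rule ip_mvec_spectral[symmetric])
      thus "\<bar>ip D z (?R (err N Xs (pull d G v)))\<bar> \<le> 240000 * (?K * vpsi d G * e)" using that(1)[OF z that(2)] by simp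
    qed (use vpsi_nonneg e0 in simp)
    let ?W = "mmul D (mmul D A (\<lambda>i j. pinv D D ?T i j - dagger i j)) (mtrans B)"
    have bound: "\<bar>ip d1 v (mvec d2 ?W w)\<bar> \<le> 480000 * ?a * ?b * e" if v: "v \<in> unit_vecs d1" and w: "w \<in> unit_vecs d2" for v w
    proof -
      let ?va = "mvec d1 (mtrans A) v" and ?wb = "mvec d2 (mtrans B) w"
      let ?p = "ip D (pull d1 A v) (err N Xs (pull d2 B w))"
      let ?x = "vnorm D (?R (err N Xs (pull d1 A v)))" and ?y = "vnorm D (?R (err N Xs (pull d2 B w)))"
      have "ip d1 v (mvec d2 ?W w) = ip D ?va (\<lambda>i. mvec D (pinv D D ?T) ?wb i - mvec D dagger ?wb i)"
        unfolding mvec_mmul mvec_diff_mat using ip_mvec_left[of d1 D A _ v] by (simp only: ip_commute)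
      moreover have "\<bar>ip D ?va (\<lambda>i. mvec D (pinv D D ?T) ?wb i - mvec D dagger ?wb i)\<bar> \<le> \<bar>?p\<bar> + 2 * ?x * ?y"
        unfolding pull_def dagger_def cov
        by (rule pinv_perturbation[OF Q l_nonneg padded_sample_cov sample_cov_sym E0(3)[OF Xs(1)] half[unfolded cov]])
      moreover have "\<bar>?p\<bar> \<le> 240000 * (?a * ?b * e)" by (rule E4(3)[OF Xs(5) v w])
      \<comment> \<open>By \<open>small\<close> the factor \<open>240000 * (?K\<^sup>2 * e)\<close>
        is at most 1/2, so \<open>2 * ?x * ?y\<close> obeys the same bound as the linear
        term.\<close>
      moreover have "?x * ?y \<le> 120000 * (?a * ?b * e)"
      proof -
        have "?x * ?y \<le> (240000 * (?K * ?a * e)) * (240000 * (?K * ?b * e))"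
          using vpsi_nonneg e0
          by (intro mult_mono R_err[OF E2(3)[OF Xs(3)] v] R_err[OF E3(3)[OF Xs(4)] w]) auto
        also have "\<dots> = (240000 * (?K\<^sup>2 * e)) * (240000 * (?a * ?b * e))"
          by (simp add: power2_eq_square)
        also have "\<dots> \<le> (1 / 2) * (240000 * (?a * ?b * e))"
          using vpsi_nonneg e0 by (intro mult_right_mono small) auto
        finally show ?thesis by (simp add: mult_ac)
      qed
      ultimately have "\<bar>ip d1 v (mvec d2 ?W w)\<bar> \<le> 480000 * (?a * ?b * e)" by linarith
      thus ?thesis by simp
    qed
    have nonneg: "0 \<le> 480000 * ?a * ?b * e" using vpsi_nonneg e0 by simp
    show "spec_norm d1 d2 ?W \<le> 480000 * ?a * ?b * e"
      unfolding spec_norm_def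
    proof (rule cSup_least)
      fix t assume "t \<in> insert 0 ((\<lambda>v. vnorm d1 (mvec d2 ?W v)) ` unit_vecs d2)"
      thus "t \<le> 480000 * ?a * ?b * e"
        using nonneg vnorm_le_of_ip[OF bound nonneg] by auto
    qed simp
  qed
qed

text \<open>Whitening gives variance 1 along an eigenvector with positive eigenvalue, whereas every
  scale above the norm dominates the standard deviation.\<close>

lemma one_le_vpsi_cov_root:
  assumes "mrank D D (cov_mat M D) \<noteq> 0"
  shows "1 \<le> vpsi D cov_root"
proof -
  have "{k. k < D \<and> l k \<noteq> 0} \<noteq> {}" using assms unfolding cov mrank_spectral[OF Q] by auto
  then obtain k where k: "k < D" "l k \<noteq> 0" by blast
  have lk: "0 < l k" using k l_nonneg[of k] by simp
  have unit: "col k \<in> unit_vecs D" by (simp add: unit_vecs_def vnorm_ip ip_columns[OF Q k(1) k(1)])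
  hence le1: "ip D (col k) (col k) \<le> 1" by (simp add: unit_vecs_def vnorm_ip)
  let ?z = "pull D cov_root (col k)"
  have "?z = (\<lambda>i. if i < D then sqrt (inverse (l k)) * Q i k else 0)"
    unfolding pull_cov_root by (rule mvec_spectral_column[OF Q k(1)])
  hence "dev ?z x = dev (\<lambda>i. sqrt (inverse (l k)) * Q i k) x" for x
    unfolding dev_def by (intro ip_cong) auto
  hence "dev ?z x = sqrt (inverse (l k)) * dev (col k) x" for x
    using dev_scale[of "sqrt (inverse (l k))" "col k"] by simp
  hence "expectation (\<lambda>x. (dev ?z x)\<^sup>2) = inverse (l k) * expectation (\<lambda>x. (dev (col k) x)\<^sup>2)"
    using lk by (simp add: power_mult_distrib)
  hence one: "expectation (\<lambda>x. (dev ?z x)\<^sup>2) = 1" using l_eq[OF k(1)] k(2) by simp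
  show ?thesis
  proof (rule dense_ge)
    fix s assume s: "vpsi D cov_root < s"
    have "1 \<le> s\<^sup>2" using subgauss_moments(3)[OF measurable_dev pull_subgauss[OF le1 s]] one by simp
    moreover have "0 \<le> s" using s vpsi_nonneg[of D cov_root] by linarith
    ultimately show "1 \<le> s" using power2_le_imp_le[of 1 s] by simp
  qed
qed

end

theorem theorem1:
  "\<exists>C>0. \<exists>C'>0. \<forall>(D::nat) (d1::nat) (d2::nat) (N::nat) (\<mu>::(nat \<Rightarrow> real) measure)
      (A::nat \<Rightarrow> nat \<Rightarrow> real) (B::nat \<Rightarrow> nat \<Rightarrow> real) (u::real).
    prob_space \<mu> \<longrightarrow>
    sets \<mu> = sets (PiM {..<D} (\<lambda>_. borel)) \<longrightarrow>
    subgaussian \<mu> D (\<lambda>x. x) \<longrightarrow>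
    0 < u \<longrightarrow>
    (let \<Sigma> = cov_mat \<mu> D; m = mean_vec \<mu> D; r = real (mrank D D \<Sigma>) in
     real N > C * (r + u) *
        (vpsi2 \<mu> D (\<lambda>x. mvec D (psd_sqrt D (pinv D D \<Sigma>)) (\<lambda>i. x i - m i))) ^ 4 \<longrightarrow>
     (\<exists>E \<in> sets (PiM {..<N} (\<lambda>_. \<mu>)).
        measure (PiM {..<N} (\<lambda>_. \<mu>)) E \<ge> 1 - exp (- u) \<and>
        (\<forall>Xs\<in>E.
           spec_norm d1 d2
             (mmul D (mmul D A (\<lambda>i j. pinv D D (sample_cov D N Xs) i j - pinv D D \<Sigma> i j))
                 (mtrans B))
           \<le> C' * vpsi2 \<mu> d1 (\<lambda>x. mvec D (mmul D A (pinv D D \<Sigma>)) (\<lambda>i. x i - m i))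
                * vpsi2 \<mu> d2 (\<lambda>x. mvec D (mmul D B (pinv D D \<Sigma>)) (\<lambda>i. x i - m i))
                * sqrt ((r + u) / real N))))"
\<comment> \<open>Squaring
  \<open>240000 * (?K\<^sup>2 * sqrt ((?r + u) / real N)) \<le> 1 / 2\<close> and clearing
  denominators shows why the constant on \<open>N\<close> is 480000 squared and the norm enters with
  its fourth power.\<close>
proof (rule exI[of _ "480000\<^sup>2"], rule conjI, simp, rule exI[of _ 480000], rule conjI, simp,
    intro allI impI, unfold Let_def, intro impI)
  fix D d1 d2 N :: nat and \<mu> :: "(nat \<Rightarrow> real) measure" and A B :: "nat \<Rightarrow> nat \<Rightarrow> real" and u :: real
  assume "prob_space \<mu>" and sets: "sets \<mu> = sets (PiM {..<D} (\<lambda>_. borel))"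
    and sub: "subgaussian \<mu> D (\<lambda>x. x)" and u: "0 < u"
    and N: "480000\<^sup>2 * (real (mrank D D (cov_mat \<mu> D)) + u) *
      (vpsi2 \<mu> D (\<lambda>x. mvec D (psd_sqrt D (pinv D D (cov_mat \<mu> D))) (\<lambda>i. x i - mean_vec \<mu> D i))) ^ 4 < real N"
  interpret prob_space \<mu> by fact
  interpret subgaussian_vector \<mu> D by standard (fact sets sub)+
  have "cov_mat \<mu> D i j = cov_mat \<mu> D j i" for i j by (simp add: cov_mat_def mult.commute)
  moreover have "padded D (cov_mat \<mu> D)" by (simp add: padded_def cov_mat_def)
  ultimately obtain Q l where "orthogonal_mat D Q" "cov_mat \<mu> D = spectral D Q l"
    using spectral_theorem[of D "cov_mat \<mu> D"] by blast
  then interpret spectral_covariance \<mu> D Q l by unfold_locales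
  let ?r = "real (mrank D D (cov_mat \<mu> D))" and ?K = "vpsi D cov_root"
  have "vpsi2 \<mu> D (\<lambda>x. mvec D (psd_sqrt D (pinv D D (cov_mat \<mu> D))) (\<lambda>i. x i - mean_vec \<mu> D i)) = ?K"
    unfolding vpsi_def dagger_eq[symmetric] psd_sqrt_dagger ..
  with N have hN: "480000\<^sup>2 * (?r + u) * ?K ^ 4 < real N" by simp
  have "0 \<le> 480000\<^sup>2 * (?r + u) * ?K ^ 4" using u by (intro mult_nonneg_nonneg) auto
  hence N0: "0 < N" using hN by linarith
  have rN: "?r + u \<le> real N" if "?r \<noteq> 0"
  proof -
    have "1 \<le> ?K" using one_le_vpsi_cov_root that by simp
    hence "1 \<le> ?K ^ 4" by (rule one_le_power)
    hence "(?r + u) * 1 \<le> (480000\<^sup>2 * (?r + u)) * ?K ^ 4" using u by (intro mult_mono) auto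
    from this[unfolded mult_1_right] hN show ?thesis by (rule order_trans[OF _ less_imp_le])
  qed
  have "240000 * (?K\<^sup>2 * sqrt ((?r + u) / real N)) \<le> 1 / 2"
  proof (rule power2_le_imp_le)
    have "(240000 * (?K\<^sup>2 * sqrt ((?r + u) / real N)))\<^sup>2 = 240000\<^sup>2 * (?K ^ 4 * ((?r + u) / real N))"
      using u by (simp add: power_mult_distrib flip: power_mult)
    also have "\<dots> \<le> (1 / 2)\<^sup>2"
      using hN N0 by (simp add: field_simps power2_eq_square)
    finally show "(240000 * (?K\<^sup>2 * sqrt ((?r + u) / real N)))\<^sup>2 \<le> (1 / 2)\<^sup>2" .
  qed simp
  from pinv_deviation[OF u N0 rN this, of d1 d2 A B]
  obtain E where E: "E \<in> sets (PiM {..<N} (\<lambda>_. \<mu>))" "measure (PiM {..<N} (\<lambda>_. \<mu>)) E \<ge> 1 - exp (- u)"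
    "\<And>Xs. Xs \<in> E \<Longrightarrow> spec_norm d1 d2 (mmul D (mmul D A (\<lambda>i j. pinv D D (sample_cov D N Xs) i j - dagger i j)) (mtrans B))
       \<le> 480000 * vpsi d1 A * vpsi d2 B * sqrt ((?r + u) / real N)" by blast
  show "\<exists>E \<in> sets (PiM {..<N} (\<lambda>_. \<mu>)).
        measure (PiM {..<N} (\<lambda>_. \<mu>)) E \<ge> 1 - exp (- u) \<and>
        (\<forall>Xs\<in>E.
           spec_norm d1 d2
             (mmul D (mmul D A (\<lambda>i j. pinv D D (sample_cov D N Xs) i j - pinv D D (cov_mat \<mu> D) i j))
                 (mtrans B))
           \<le> 480000 * vpsi2 \<mu> d1 (\<lambda>x. mvec D (mmul D A (pinv D D (cov_mat \<mu> D))) (\<lambda>i. x i - mean_vec \<mu> D i))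
                * vpsi2 \<mu> d2 (\<lambda>x. mvec D (mmul D B (pinv D D (cov_mat \<mu> D))) (\<lambda>i. x i - mean_vec \<mu> D i))
                * sqrt ((?r + u) / real N))"
    using E unfolding vpsi_def dagger_eq by blast
qed

end
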